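(* Assume $T$ is $\mathrm{NIP}$. Let $C$ be a small set of parameters and let $S$ be a stable $C$-definable set. Then $S^{eq}$ has the bounded stabilizing property $\mathrm{BS}$; that is, for every small set of parameters $A\supseteq C$ and every finite tuple $a$ of $M$, there is no strictly increasing chain of length $|T(C)|^+$ of definably closed sets between $S^{eq}\cap \mathrm{dcl}(A)$ and $S^{eq}\cap\mathrm{dcl}(Aa)$.
   Context: $T$ is a complete first-order theory that eliminates imaginaries, $M$ is its monster model, parameter sets are small. $|T(C)|$ denotes the cardinality of the theory with constants for $C$ added, i.e. $|T|+|C|$. $S$ is stable if $S$ with its induced structure is stable (in an $\mathrm{NIP}$ theory a stable definable set is stably embedded). $S^{eq}$ is the family of all quotients of $C$-definable subsets of powers of $S$ by $C$-definable equivalence relations (identified with sets in $M$, by elimination of imaginaries). A subset $X\subseteq S^{eq}$ is called definably closed when it is so inside $S^{eq}$, i.e. $X=S^{eq}\cap\mathrm{dcl}(X\cup C)$. *)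

theory Defs
  imports Main
begin

unbundle cardinal_syntax

section \<open>Many-sorted first-order logic\<close>

text \<open>
  The sorts are the elements of the type \<open>'s\<close>. A symbol of \<open>'f\<close> or \<open>'r\<close> belongs to the language iff
  it has a type there, so languages without function or relation symbols are covered.
  Variables are de Bruijn indices into a context, the list of the sorts of the free variables;
  assignments are tuples matching the context.
\<close>

record ('s, 'f, 'r) lang =
  fun_type :: "'f \<Rightarrow> ('s list \<times> 's) option"
  rel_type :: "'r \<Rightarrow> 's list option"

datatype 'f tm = Var nat | App 'f "'f tm list"

datatype ('s, 'f, 'r) fm =
    Falsum
  | Eq "'f tm" "'f tm"
  | Rel 'r "'f tm list"
  | Neg "('s, 'f, 'r) fm"
  | Conj "('s, 'f, 'r) fm" "('s, 'f, 'r) fm"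
  | Ex 's "('s, 'f, 'r) fm"

inductive has_sort :: "('s, 'f, 'r) lang \<Rightarrow> 's list \<Rightarrow> 'f tm \<Rightarrow> 's \<Rightarrow> bool"
  for L :: "('s, 'f, 'r) lang" and \<Gamma> :: "'s list" where
  "i < length \<Gamma> \<Longrightarrow> has_sort L \<Gamma> (Var i) (\<Gamma> ! i)"
| "fun_type L f = Some (ss, s) \<Longrightarrow> list_all2 (has_sort L \<Gamma>) ts ss \<Longrightarrow> has_sort L \<Gamma> (App f ts) s"

primrec wf_fm :: "('s, 'f, 'r) lang \<Rightarrow> 's list \<Rightarrow> ('s, 'f, 'r) fm \<Rightarrow> bool" where
  "wf_fm L \<Gamma> Falsum \<longleftrightarrow> True"
| "wf_fm L \<Gamma> (Eq t u) \<longleftrightarrow> (\<exists>s. has_sort L \<Gamma> t s \<and> has_sort L \<Gamma> u s)"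
| "wf_fm L \<Gamma> (Rel r ts) \<longleftrightarrow> (\<exists>ss. rel_type L r = Some ss \<and> list_all2 (has_sort L \<Gamma>) ts ss)"
| "wf_fm L \<Gamma> (Neg \<phi>) \<longleftrightarrow> wf_fm L \<Gamma> \<phi>"
| "wf_fm L \<Gamma> (Conj \<phi> \<psi>) \<longleftrightarrow> wf_fm L \<Gamma> \<phi> \<and> wf_fm L \<Gamma> \<psi>"
| "wf_fm L \<Gamma> (Ex s \<phi>) \<longleftrightarrow> wf_fm L (s # \<Gamma>) \<phi>"

record ('s, 'f, 'r, 'm) struct =
  carr :: "'s \<Rightarrow> 'm set"
  fun_int :: "'f \<Rightarrow> 'm list \<Rightarrow> 'm"
  rel_int :: "'r \<Rightarrow> 'm list \<Rightarrow> bool"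

definition universe :: "('s, 'f, 'r, 'm) struct \<Rightarrow> 'm set" where
  "universe M = (\<Union>s. carr M s)"

definition tuples :: "('s, 'f, 'r, 'm) struct \<Rightarrow> 's list \<Rightarrow> 'm list set" where
  "tuples M \<Gamma> = {xs. list_all2 (\<lambda>x s. x \<in> carr M s) xs \<Gamma>}"

text \<open>Sorts are disjoint, so that an element, hence also a parameter set, determines its sorts.\<close>

definition is_struct :: "('s, 'f, 'r) lang \<Rightarrow> ('s, 'f, 'r, 'm) struct \<Rightarrow> bool" where
  "is_struct L M \<longleftrightarrow>
     (\<forall>s. carr M s \<noteq> {}) \<and>
     (\<forall>s t. s \<noteq> t \<longrightarrow> carr M s \<inter> carr M t = {}) \<and>
     (\<forall>f ss s. fun_type L f = Some (ss, s) \<longrightarrow> (\<forall>xs \<in> tuples M ss. fun_int M f xs \<in> carr M s))"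

primrec val :: "('s, 'f, 'r, 'm) struct \<Rightarrow> 'm list \<Rightarrow> 'f tm \<Rightarrow> 'm" where
  "val M xs (Var i) = xs ! i"
| "val M xs (App f ts) = fun_int M f (map (val M xs) ts)"

primrec sat :: "('s, 'f, 'r, 'm) struct \<Rightarrow> 'm list \<Rightarrow> ('s, 'f, 'r) fm \<Rightarrow> bool" where
  "sat M xs Falsum \<longleftrightarrow> False"
| "sat M xs (Eq t u) \<longleftrightarrow> val M xs t = val M xs u"
| "sat M xs (Rel r ts) \<longleftrightarrow> rel_int M r (map (val M xs) ts)"
| "sat M xs (Neg \<phi>) \<longleftrightarrow> \<not> sat M xs \<phi>"
| "sat M xs (Conj \<phi> \<psi>) \<longleftrightarrow> sat M xs \<phi> \<and> sat M xs \<psi>"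
| "sat M xs (Ex s \<phi>) \<longleftrightarrow> (\<exists>x \<in> carr M s. sat M (x # xs) \<phi>)"

text \<open>
  A complete theory decides every sentence (consistency follows from having a model), so it is the
  full set of its consequences and \<open>|T|\<close> is the number of sentences of the language.
\<close>

definition complete_theory :: "('s, 'f, 'r) lang \<Rightarrow> ('s, 'f, 'r) fm set \<Rightarrow> bool" where
  "complete_theory L T \<longleftrightarrow>
     (\<forall>\<phi> \<in> T. wf_fm L [] \<phi>) \<and> (\<forall>\<phi>. wf_fm L [] \<phi> \<longrightarrow> (\<phi> \<in> T \<longleftrightarrow> Neg \<phi> \<notin> T))"

definition is_model :: "('s, 'f, 'r) lang \<Rightarrow> ('s, 'f, 'r) fm set \<Rightarrow> ('s, 'f, 'r, 'm) struct \<Rightarrow> bool" where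
  "is_model L T M \<longleftrightarrow> is_struct L M \<and> (\<forall>\<phi> \<in> T. sat M [] \<phi>)"


section \<open>Definability, automorphisms and the monster model\<close>

definition definable ::
  "('s, 'f, 'r) lang \<Rightarrow> ('s, 'f, 'r, 'm) struct \<Rightarrow> 'm set \<Rightarrow> 's list \<Rightarrow> 'm list set \<Rightarrow> bool" where
  "definable L M A \<Gamma> X \<longleftrightarrow>
     (\<exists>\<Delta> \<phi> bs. wf_fm L (\<Gamma> @ \<Delta>) \<phi> \<and> bs \<in> tuples M \<Delta> \<and> set bs \<subseteq> A \<and>
        X = {xs \<in> tuples M \<Gamma>. sat M (xs @ bs) \<phi>})"

definition definable_rel ::
  "('s, 'f, 'r) lang \<Rightarrow> ('s, 'f, 'r, 'm) struct \<Rightarrow> 'm set \<Rightarrow> 's list \<Rightarrow> ('m list \<times> 'm list) set \<Rightarrow> bool" where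
  "definable_rel L M A \<Gamma> E \<longleftrightarrow>
     E \<subseteq> tuples M \<Gamma> \<times> tuples M \<Gamma> \<and> definable L M A (\<Gamma> @ \<Gamma>) {xs @ ys | xs ys. (xs, ys) \<in> E}"

definition definable_map ::
  "('s, 'f, 'r) lang \<Rightarrow> ('s, 'f, 'r, 'm) struct \<Rightarrow> 'm set \<Rightarrow> 's list \<Rightarrow> 'm list set \<Rightarrow> 's list
     \<Rightarrow> ('m list \<Rightarrow> 'm list) \<Rightarrow> bool" where
  "definable_map L M A \<Gamma> D \<Delta> f \<longleftrightarrow>
     D \<subseteq> tuples M \<Gamma> \<and> f ` D \<subseteq> tuples M \<Delta> \<and> definable L M A (\<Gamma> @ \<Delta>) {xs @ f xs | xs. xs \<in> D}"

definition dcl :: "('s, 'f, 'r) lang \<Rightarrow> ('s, 'f, 'r, 'm) struct \<Rightarrow> 'm set \<Rightarrow> 'm set" where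
  "dcl L M A = {b. \<exists>s. b \<in> carr M s \<and> definable L M A [s] {[b]}}"

definition automorphism :: "('s, 'f, 'r) lang \<Rightarrow> ('s, 'f, 'r, 'm) struct \<Rightarrow> ('m \<Rightarrow> 'm) \<Rightarrow> bool" where
  "automorphism L M \<sigma> \<longleftrightarrow>
     (\<forall>s. bij_betw \<sigma> (carr M s) (carr M s)) \<and>
     (\<forall>f ss s. fun_type L f = Some (ss, s) \<longrightarrow>
        (\<forall>xs \<in> tuples M ss. \<sigma> (fun_int M f xs) = fun_int M f (map \<sigma> xs))) \<and>
     (\<forall>r ss. rel_type L r = Some ss \<longrightarrow>
        (\<forall>xs \<in> tuples M ss. rel_int M r xs \<longleftrightarrow> rel_int M r (map \<sigma> xs)))"

definition partial_elementary ::
  "('s, 'f, 'r) lang \<Rightarrow> ('s, 'f, 'r, 'm) struct \<Rightarrow> 'm set \<Rightarrow> ('m \<Rightarrow> 'm) \<Rightarrow> bool" where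
  "partial_elementary L M A g \<longleftrightarrow>
     (\<forall>s. g ` (A \<inter> carr M s) \<subseteq> carr M s) \<and>
     (\<forall>\<Gamma> \<phi> xs. wf_fm L \<Gamma> \<phi> \<longrightarrow> xs \<in> tuples M \<Gamma> \<longrightarrow> set xs \<subseteq> A \<longrightarrow>
        (sat M xs \<phi> \<longleftrightarrow> sat M (map g xs) \<phi>))"

text \<open>A set \<open>p\<close> of pairs \<open>(\<phi>, bs)\<close> stands for the partial type of all \<open>\<phi>(xs, bs)\<close> in the variables \<open>xs\<close>.\<close>

definition saturated ::
  "'k rel \<Rightarrow> ('s, 'f, 'r) lang \<Rightarrow> ('s, 'f, 'r, 'm) struct \<Rightarrow> bool" where
  "saturated \<kappa> L M \<longleftrightarrow>
     (\<forall>A \<Gamma> p. A \<subseteq> universe M \<longrightarrow> |A| <o \<kappa> \<longrightarrow>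
        (\<forall>(\<phi>, bs) \<in> p. \<exists>\<Delta>. wf_fm L (\<Gamma> @ \<Delta>) \<phi> \<and> bs \<in> tuples M \<Delta> \<and> set bs \<subseteq> A) \<longrightarrow>
        (\<forall>q \<subseteq> p. finite q \<longrightarrow> (\<exists>xs \<in> tuples M \<Gamma>. \<forall>(\<phi>, bs) \<in> q. sat M (xs @ bs) \<phi>)) \<longrightarrow>
        (\<exists>xs \<in> tuples M \<Gamma>. \<forall>(\<phi>, bs) \<in> p. sat M (xs @ bs) \<phi>))"

definition strongly_homogeneous ::
  "'k rel \<Rightarrow> ('s, 'f, 'r) lang \<Rightarrow> ('s, 'f, 'r, 'm) struct \<Rightarrow> bool" where
  "strongly_homogeneous \<kappa> L M \<longleftrightarrow>
     (\<forall>A g. A \<subseteq> universe M \<longrightarrow> |A| <o \<kappa> \<longrightarrow> partial_elementary L M A g \<longrightarrow>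
        (\<exists>\<sigma>. automorphism L M \<sigma> \<and> (\<forall>x \<in> A. \<sigma> x = g x)))"

text \<open>``Small'' means of cardinality less than \<open>\<kappa>\<close>.\<close>

definition monster_model ::
  "'k rel \<Rightarrow> ('s, 'f, 'r) lang \<Rightarrow> ('s, 'f, 'r) fm set \<Rightarrow> ('s, 'f, 'r, 'm) struct \<Rightarrow> bool" where
  "monster_model \<kappa> L T M \<longleftrightarrow>
     Card_order \<kappa> \<and> |T| <o \<kappa> \<and> is_model L T M \<and> saturated \<kappa> L M \<and> strongly_homogeneous \<kappa> L M"

definition small_set :: "'k rel \<Rightarrow> ('s, 'f, 'r, 'm) struct \<Rightarrow> 'm set \<Rightarrow> bool" where
  "small_set \<kappa> M A \<longleftrightarrow> A \<subseteq> universe M \<and> |A| <o \<kappa>"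

text \<open>
  Elimination of imaginaries, in the monster model: every class of a \<open>\<emptyset>\<close>-definable equivalence relation
  on a product of sorts has a code, i.e. a finite tuple fixed by exactly the automorphisms that
  preserve the class.
\<close>

definition eliminates_imaginaries :: "('s, 'f, 'r) lang \<Rightarrow> ('s, 'f, 'r, 'm) struct \<Rightarrow> bool" where
  "eliminates_imaginaries L M \<longleftrightarrow>
     (\<forall>\<Gamma> E. equiv (tuples M \<Gamma>) E \<longrightarrow> definable_rel L M {} \<Gamma> E \<longrightarrow>
        (\<forall>a \<in> tuples M \<Gamma>. \<exists>\<Delta>. \<exists>e \<in> tuples M \<Delta>. \<forall>\<sigma>. automorphism L M \<sigma> \<longrightarrow>
           (map \<sigma> ` (E `` {a}) = E `` {a} \<longleftrightarrow> map \<sigma> e = e)))"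


section \<open>NIP and stability\<close>

text \<open>
  The independence and order properties are stated with arbitrarily long finite configurations.
  They are thus properties of the complete theory of \<open>M\<close>; by compactness they amount to
  infinite configurations in a sufficiently saturated model.
\<close>

definition has_IP ::
  "('s, 'f, 'r, 'm) struct \<Rightarrow> 's list \<Rightarrow> 's list \<Rightarrow> ('s, 'f, 'r) fm \<Rightarrow> bool" where
  "has_IP M \<Gamma> \<Delta> \<phi> \<longleftrightarrow>
     (\<forall>n::nat. \<exists>a. (\<forall>i<n. a i \<in> tuples M \<Gamma>) \<and>
        (\<forall>I \<subseteq> {..<n}. \<exists>b \<in> tuples M \<Delta>. \<forall>i<n. sat M (a i @ b) \<phi> \<longleftrightarrow> i \<in> I))"

definition NIP :: "('s, 'f, 'r) lang \<Rightarrow> ('s, 'f, 'r, 'm) struct \<Rightarrow> bool" where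
  "NIP L M \<longleftrightarrow> (\<forall>\<Gamma> \<Delta> \<phi>. wf_fm L (\<Gamma> @ \<Delta>) \<phi> \<longrightarrow> \<not> has_IP M \<Gamma> \<Delta> \<phi>)"

definition has_OP ::
  "('s, 'f, 'r, 'm) struct \<Rightarrow> 's list \<Rightarrow> 's list \<Rightarrow> ('s, 'f, 'r) fm \<Rightarrow> bool" where
  "has_OP M \<Gamma> \<Delta> \<phi> \<longleftrightarrow>
     (\<forall>n::nat. \<exists>a b. (\<forall>i<n. a i \<in> tuples M \<Gamma> \<and> b i \<in> tuples M \<Delta>) \<and>
        (\<forall>i<n. \<forall>j<n. sat M (a i @ b j) \<phi> \<longleftrightarrow> i < j))"

definition stable :: "('s, 'f, 'r) lang \<Rightarrow> ('s, 'f, 'r, 'm) struct \<Rightarrow> bool" where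
  "stable L M \<longleftrightarrow> (\<forall>\<Gamma> \<Delta> \<phi>. wf_fm L (\<Gamma> @ \<Delta>) \<phi> \<longrightarrow> \<not> has_OP M \<Gamma> \<Delta> \<phi>)"


section \<open>The structure induced on a definable set\<close>

text \<open>
  Let \<open>S\<close> be a \<open>C\<close>-definable set of \<open>\<Gamma>\<close>-tuples. An element of the power \<open>S\<^sup>k\<close> is represented in \<open>M\<close> as the
  concatenation of \<open>k\<close> elements of \<open>S\<close>.
\<close>

definition pow_sorts :: "'s list \<Rightarrow> nat \<Rightarrow> 's list" where
  "pow_sorts \<Gamma> k = concat (replicate k \<Gamma>)"

definition pow_set :: "'m list set \<Rightarrow> nat \<Rightarrow> 'm list set" where
  "pow_set S k = {concat xss | xss. length xss = k \<and> set xss \<subseteq> S}"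

text \<open>
  The induced structure is one-sorted with carrier \<open>S\<close>; its language has one relation symbol \<open>(k, R)\<close> for
  each \<open>C\<close>-definable \<open>R \<subseteq> S\<^sup>k\<close>, and no function symbols.
\<close>

definition induced_lang ::
  "('s, 'f, 'r) lang \<Rightarrow> ('s, 'f, 'r, 'm) struct \<Rightarrow> 'm set \<Rightarrow> 's list \<Rightarrow> 'm list set
     \<Rightarrow> (unit, unit, nat \<times> 'm list set) lang" where
  "induced_lang L M C \<Gamma> S =
     \<lparr>fun_type = (\<lambda>_. None),
      rel_type = (\<lambda>(k, R). if R \<subseteq> pow_set S k \<and> definable L M C (pow_sorts \<Gamma> k) R
                           then Some (replicate k ()) else None)\<rparr>"

definition induced_struct :: "'m list set \<Rightarrow> (unit, unit, nat \<times> 'm list set, 'm list) struct" where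
  "induced_struct S =
     \<lparr>carr = (\<lambda>_. S), fun_int = (\<lambda>_ _. undefined), rel_int = (\<lambda>(k, R) xss. concat xss \<in> R)\<rparr>"

definition stable_set ::
  "('s, 'f, 'r) lang \<Rightarrow> ('s, 'f, 'r, 'm) struct \<Rightarrow> 'm set \<Rightarrow> 's list \<Rightarrow> 'm list set \<Rightarrow> bool" where
  "stable_set L M C \<Gamma> S \<longleftrightarrow> stable (induced_lang L M C \<Gamma> S) (induced_struct S)"

text \<open>
  \<open>S\<^sup>e\<^sup>q\<close> as a set of tuples of \<open>M\<close>: a quotient \<open>D / E\<close>, with \<open>D \<subseteq> S\<^sup>k\<close> and \<open>E\<close> both \<open>C\<close>-definable, is identified
  with the image of a \<open>C\<close>-definable map \<open>f\<close> on \<open>D\<close> whose fibres are the \<open>E\<close>-classes. All such \<open>f\<close> are admitted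
  instead of one chosen for each \<open>(D, E)\<close>: two of them differ by a \<open>C\<close>-definable bijection, so
  definable closures over \<open>C\<close> do not depend on the choice. If a code of the \<open>E\<close>-classes is not uniform in
  the class, \<open>D\<close> splits into \<open>E\<close>-invariant \<open>C\<close>-definable pieces that have such a map.
\<close>

definition Seq ::
  "('s, 'f, 'r) lang \<Rightarrow> ('s, 'f, 'r, 'm) struct \<Rightarrow> 'm set \<Rightarrow> 's list \<Rightarrow> 'm list set \<Rightarrow> 'm list set" where
  "Seq L M C \<Gamma> S =
     {f d | k D E \<Delta> f d.
        D \<subseteq> pow_set S k \<and> definable L M C (pow_sorts \<Gamma> k) D \<and>
        equiv D E \<and> definable_rel L M C (pow_sorts \<Gamma> k) E \<and>
        definable_map L M C (pow_sorts \<Gamma> k) D \<Delta> f \<and>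
        (\<forall>x \<in> D. \<forall>y \<in> D. f x = f y \<longleftrightarrow> (x, y) \<in> E) \<and>
        d \<in> D}"


section \<open>The bounded stabilizing property\<close>

text \<open>
  \<open>Q\<close> is a set of finite tuples such as \<open>S\<^sup>e\<^sup>q\<close>. A tuple lies in \<open>dcl A\<close> iff all its coordinates do.
\<close>

definition dcl_in ::
  "('s, 'f, 'r) lang \<Rightarrow> ('s, 'f, 'r, 'm) struct \<Rightarrow> 'm list set \<Rightarrow> 'm set \<Rightarrow> 'm list set" where
  "dcl_in L M Q A = Q \<inter> lists (dcl L M A)"

definition dcl_closed_in ::
  "('s, 'f, 'r) lang \<Rightarrow> ('s, 'f, 'r, 'm) struct \<Rightarrow> 'm set \<Rightarrow> 'm list set \<Rightarrow> 'm list set \<Rightarrow> bool" where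
  "dcl_closed_in L M C Q X \<longleftrightarrow> X = dcl_in L M Q ((\<Union>x \<in> X. set x) \<union> C)"

text \<open>
  A chain of length \<open>|T(C)|\<^sup>+\<close> is indexed by the initial ordinal \<open>cardSuc ( |T| +c |C| )\<close>, which is given as
  a (reflexive) well-order.
\<close>

definition bounded_stabilizing ::
  "'k rel \<Rightarrow> ('s, 'f, 'r) lang \<Rightarrow> ('s, 'f, 'r) fm set \<Rightarrow> ('s, 'f, 'r, 'm) struct \<Rightarrow> 'm set
     \<Rightarrow> 'm list set \<Rightarrow> bool" where
  "bounded_stabilizing \<kappa> L T M C Q \<longleftrightarrow>
     (\<forall>A a. C \<subseteq> A \<longrightarrow> small_set \<kappa> M A \<longrightarrow> set a \<subseteq> universe M \<longrightarrow>
        \<not> (\<exists>X. (\<forall>i \<in> Field (cardSuc ( |T| +c |C| )).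
                  dcl_closed_in L M C Q (X i) \<and>
                  dcl_in L M Q A \<subseteq> X i \<and> X i \<subseteq> dcl_in L M Q (A \<union> set a)) \<and>
               (\<forall>i j. (i, j) \<in> cardSuc ( |T| +c |C| ) \<longrightarrow> i \<noteq> j \<longrightarrow> X i \<subset> X j)))"

end

theory Submission
  imports Defs "HOL-Library.Ramsey"
begin

text \<open>
  An NIP theory restricts a stable set \<open>S\<close> much more than the stability of its induced structure
  says. Even a formula \<open>\<psi>(x, z)\<close> with \<open>x\<close> in a power of \<open>S\<close> and \<open>z\<close> anywhere has no long ladders
  (lemma \<open>no_ladder\<close>): a ladder in \<open>S\<close> is, by stability and Ramsey, as good as an indiscernible set,
  on which \<open>\<psi>\<close> would have the independence property. Bounded ladders bound binary trees, hence
  every set \<open>\<phi>(S, c)\<close> is invariant over finitely many elements of \<open>S\<close> (\<open>stably_embedded\<close>) and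
  has a code in \<open>S\<^sup>e\<^sup>q\<close>, by elimination of imaginaries (\<open>code_in_Seq\<close>). Consequently a definably closed \<open>X \<supseteq> S\<^sup>e\<^sup>q \<inter> dcl(A)\<close> is also
  closed over \<open>A\<close>: it contains \<open>S\<^sup>e\<^sup>q \<inter> dcl(A X)\<close> (\<open>closed_over_parameters\<close>).

  Suppose that there is a strictly increasing chain of length \<open>|T(C)|\<^sup>+\<close> of such sets, all inside
  \<open>dcl(A a)\<close>. Choose a new point \<open>e\<^sub>i\<close> at each step; it is not in \<open>dcl(A X\<^sub>i)\<close>. There are at most \<open>|T|\<close>
  formulas, so infinitely many \<open>e\<^sub>i\<close> arise from \<open>a\<close> by the same formula, \<open>e\<^sub>n = h(w\<^sub>n, a)\<close> with
  parameters \<open>w\<^sub>n\<close> in \<open>A\<close>. The value \<open>e\<^sub>n\<close> can be moved by an automorphism over \<open>A\<close> that fixes the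
  earlier values.

  This contradicts NIP (\<open>no_independent_sequence\<close>). By Ramsey it may be assumed that the set of
  \<open>b \<in> 2\<^sup>N\<close> for which some \<open>y\<close> has \<open>h(w\<^sub>n, y) = e\<^sub>n\<close> exactly at the places \<open>n\<close> prescribed by \<open>b\<close> is the
  same for all increasing \<open>N\<close>-tuples of indices. It contains the pattern of positive conditions only, because of \<open>a\<close>.
  Suppose that it contains \<open>b\<close> but not the pattern in which one positive condition of \<open>b\<close> is
  negated. Then the other conditions of \<open>b\<close> imply that condition. This implication is a
  formula between the values, which come from \<open>S\<close>, and the place of the condition; automorphisms
  that fix the first \<open>k\<close> of many values and move all the following ones turn it into a long
  ladder. So all patterns occur, and the formula \<open>h(w, y) = x\<close> has the independence property.
\<close>

section \<open>Expressible relations between tuples\<close>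

primrec ren_tm :: "(nat \<Rightarrow> nat) \<Rightarrow> 'f tm \<Rightarrow> 'f tm" where
  "ren_tm f (Var i) = Var (f i)"
| "ren_tm f (App g ts) = App g (map (ren_tm f) ts)"

definition lift_ren :: "(nat \<Rightarrow> nat) \<Rightarrow> nat \<Rightarrow> nat" where
  "lift_ren f i = (case i of 0 \<Rightarrow> 0 | Suc j \<Rightarrow> Suc (f j))"

primrec ren_fm :: "(nat \<Rightarrow> nat) \<Rightarrow> ('s, 'f, 'r) fm \<Rightarrow> ('s, 'f, 'r) fm" where
  "ren_fm f Falsum = Falsum"
| "ren_fm f (Eq t u) = Eq (ren_tm f t) (ren_tm f u)"
| "ren_fm f (Rel r ts) = Rel r (map (ren_tm f) ts)"
| "ren_fm f (Neg \<phi>) = Neg (ren_fm f \<phi>)"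
| "ren_fm f (Conj \<phi> \<psi>) = Conj (ren_fm f \<phi>) (ren_fm f \<psi>)"
| "ren_fm f (Ex s \<phi>) = Ex s (ren_fm (lift_ren f) \<phi>)"

lemma has_sort_ren:
  assumes "has_sort L \<Gamma>' t s" and "\<forall>i<length \<Gamma>'. f i < length \<Gamma> \<and> \<Gamma> ! f i = \<Gamma>' ! i"
  shows "has_sort L \<Gamma> (ren_tm f t) s"
  using assms(1)
proof (induction rule: has_sort.induct)
  case (1 i)
  then show ?case using assms(2) has_sort.intros(1)[of "f i" \<Gamma> L] by auto
next
  case (2 g ss s ts)
  have "list_all2 (has_sort L \<Gamma>) (map (ren_tm f) ts) ss"
    unfolding list_all2_map1 using 2(2) by (rule list_all2_mono) simp
  then show ?case using 2(1) by (auto intro: has_sort.intros(2))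
qed

lemma val_ren:
  assumes "has_sort L \<Gamma>' t s" and "\<forall>i<length \<Gamma>'. xs ! f i = xs' ! i"
  shows "val M xs (ren_tm f t) = val M xs' t"
  using assms(1)
proof (induction rule: has_sort.induct)
  case (1 i)
  then show ?case using assms(2) by simp
next
  case (2 g ss s ts)
  have "list_all2 (\<lambda>t u. val M xs (ren_tm f t) = val M xs' t) ts ss"
    using 2(2) by (rule list_all2_mono) simp
  then have "map (val M xs \<circ> ren_tm f) ts = map (val M xs') ts"
    by (induction rule: list_all2_induct) auto
  then show ?case by (simp only: ren_tm.simps ren_fm.simps val.simps sat.simps map_map)
qed

lemma wf_ren:
  assumes "wf_fm L \<Gamma>' \<phi>" and "\<forall>i<length \<Gamma>'. f i < length \<Gamma> \<and> \<Gamma> ! f i = \<Gamma>' ! i"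
  shows "wf_fm L \<Gamma> (ren_fm f \<phi>)"
  using assms
proof (induction \<phi> arbitrary: \<Gamma> \<Gamma>' f)
  case (Eq t u)
  then obtain s where s: "has_sort L \<Gamma>' t s" "has_sort L \<Gamma>' u s" by auto
  show ?case using has_sort_ren[OF s(1) Eq(2)] has_sort_ren[OF s(2) Eq(2)] by auto
next
  case (Rel r ts)
  then obtain ss where ss: "rel_type L r = Some ss" "list_all2 (has_sort L \<Gamma>') ts ss" by auto
  have "list_all2 (has_sort L \<Gamma>) (map (ren_tm f) ts) ss"
    unfolding list_all2_map1 using ss(2)
    by (rule list_all2_mono) (rule has_sort_ren[OF _ Rel(2)])
  then show ?case using ss by simp
next
  case (Ex s \<phi>)
  have "\<forall>i<length (s # \<Gamma>'). lift_ren f i < length (s # \<Gamma>) \<and> (s # \<Gamma>) ! lift_ren f i = (s # \<Gamma>') ! i"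
    using Ex(3) by (auto simp: lift_ren_def split: nat.split)
  then show ?case using Ex by auto
qed auto

lemma sat_ren:
  assumes "wf_fm L \<Gamma>' \<phi>" and "\<forall>i<length \<Gamma>'. xs ! f i = xs' ! i"
  shows "sat M xs (ren_fm f \<phi>) = sat M xs' \<phi>"
  using assms
proof (induction \<phi> arbitrary: \<Gamma>' f xs xs')
  case (Eq t u)
  then obtain s where s: "has_sort L \<Gamma>' t s" "has_sort L \<Gamma>' u s" by auto
  show ?case using val_ren[OF s(1) Eq(2), of M] val_ren[OF s(2) Eq(2), of M] by simp
next
  case (Rel r ts)
  then obtain ss where ss: "list_all2 (has_sort L \<Gamma>') ts ss" by auto
  have "list_all2 (\<lambda>t u. val M xs (ren_tm f t) = val M xs' t) ts ss"
    using ss by (rule list_all2_mono) (rule val_ren[OF _ Rel(2)])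
  then have "map (val M xs \<circ> ren_tm f) ts = map (val M xs') ts"
    by (induction rule: list_all2_induct) auto
  then show ?case by (simp only: ren_tm.simps ren_fm.simps val.simps sat.simps map_map)
next
  case (Ex s \<phi>)
  have "\<forall>i<length (s # \<Gamma>'). (x # xs) ! lift_ren f i = (x # xs') ! i" for x
    using Ex(3) by (auto simp: lift_ren_def nth_Cons split: nat.split)
  then have "sat M (x # xs) (ren_fm (lift_ren f) \<phi>) = sat M (x # xs') \<phi>" for x
    using Ex(1)[of "s # \<Gamma>'"] Ex(2) by simp
  then show ?case by simp
next
  case (Neg \<phi>) then show ?case by (metis ren_fm.simps(4) sat.simps(4) wf_fm.simps(4))
next
  case (Conj \<phi> \<psi>) then show ?case by (metis ren_fm.simps(5) sat.simps(5) wf_fm.simps(5))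
qed auto

lemma tuples_length: "xs \<in> tuples M \<Gamma> \<Longrightarrow> length xs = length \<Gamma>"
  by (auto simp: tuples_def list_all2_lengthD)

lemma tuples_iff: "xs \<in> tuples M \<Gamma> \<longleftrightarrow> length xs = length \<Gamma> \<and> (\<forall>i<length \<Gamma>. xs ! i \<in> carr M (\<Gamma> ! i))"
  by (auto simp: tuples_def list_all2_conv_all_nth)

lemma tuples_Nil [simp]: "xs \<in> tuples M [] \<longleftrightarrow> xs = []"
  by (auto simp: tuples_def)

lemma tuples_Cons: "xs \<in> tuples M (s # \<Gamma>) \<longleftrightarrow> (\<exists>y ys. xs = y # ys \<and> y \<in> carr M s \<and> ys \<in> tuples M \<Gamma>)"
  by (auto simp: tuples_def list_all2_Cons2)

lemma tuples_append:
  "xs \<in> tuples M \<Gamma> \<Longrightarrow> ys \<in> tuples M \<Delta> \<Longrightarrow> xs @ ys \<in> tuples M (\<Gamma> @ \<Delta>)"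
  by (auto simp: tuples_def intro: list_all2_appendI)

lemma tuples_appendE:
  assumes "zs \<in> tuples M (\<Gamma> @ \<Delta>)"
  obtains xs ys where "zs = xs @ ys" "xs \<in> tuples M \<Gamma>" "ys \<in> tuples M \<Delta>"
  using assms by (auto simp: tuples_def list_all2_append2)

lemma tuples_universe: "xs \<in> tuples M \<Gamma> \<Longrightarrow> set xs \<subseteq> universe M"
  by (auto simp: tuples_iff universe_def set_conv_nth)

text \<open>
  Formulas are handled through the relations they define between blocks of variables: a relation
  between tuples with contexts \<open>\<Theta> ! 0\<close>, \<open>\<Theta> ! 1\<close>, \dots is a predicate of the list of these tuples.
  De Bruijn bookkeeping is thus confined to the lemma \<open>expressible_fm\<close>, which lets a formula speak of
  any choice of blocks.
\<close>

definition blocks :: "('s, 'f, 'r, 'm) struct \<Rightarrow> 's list list \<Rightarrow> 'm list list set" where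
  "blocks M \<Theta> = {xss. list_all2 (\<lambda>xs \<Gamma>. xs \<in> tuples M \<Gamma>) xss \<Theta>}"

definition expressible ::
  "('s, 'f, 'r) lang \<Rightarrow> ('s, 'f, 'r, 'm) struct \<Rightarrow> 's list list \<Rightarrow> ('m list list \<Rightarrow> bool) \<Rightarrow> bool" where
  "expressible L M \<Theta> P \<longleftrightarrow>
     (\<exists>\<phi>. wf_fm L (concat \<Theta>) \<phi> \<and> (\<forall>xss \<in> blocks M \<Theta>. sat M (concat xss) \<phi> \<longleftrightarrow> P xss))"

lemma blocks_iff:
  "xss \<in> blocks M \<Theta> \<longleftrightarrow> length xss = length \<Theta> \<and> (\<forall>i<length \<Theta>. xss ! i \<in> tuples M (\<Theta> ! i))"
  by (auto simp: blocks_def list_all2_conv_all_nth)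

lemma blocks_Cons: "ys # xss \<in> blocks M (\<Delta> # \<Theta>) \<longleftrightarrow> ys \<in> tuples M \<Delta> \<and> xss \<in> blocks M \<Theta>"
  by (simp add: blocks_def)

lemma blocks_Nil [simp]: "xss \<in> blocks M [] \<longleftrightarrow> xss = []"
  by (auto simp: blocks_def)

lemma blocks_concat: "xss \<in> blocks M \<Theta> \<Longrightarrow> concat xss \<in> tuples M (concat \<Theta>)"
  unfolding blocks_def mem_Collect_eq
  by (induction rule: list_all2_induct) (auto intro: tuples_append)

lemma tuples_concatE:
  assumes "zs \<in> tuples M (concat \<Theta>)"
  obtains xss where "zs = concat xss" "xss \<in> blocks M \<Theta>"
  using assms
proof (induction \<Theta> arbitrary: zs thesis)
  case Nil
  then show ?case by (metis blocks_Nil concat.simps(1) tuples_Nil)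
next
  case (Cons \<Gamma> \<Theta>)
  from Cons(3) obtain xs ys where xy: "zs = xs @ ys" "xs \<in> tuples M \<Gamma>" "ys \<in> tuples M (concat \<Theta>)"
    by (auto elim: tuples_appendE)
  obtain xss where "ys = concat xss" "xss \<in> blocks M \<Theta>" using Cons(1)[OF _ xy(3)] by blast
  then show ?case using xy Cons(2)[of "xs # xss"] by (simp add: blocks_Cons)
qed

lemma expressible_cong:
  "expressible L M \<Theta> P \<Longrightarrow> (\<And>xss. xss \<in> blocks M \<Theta> \<Longrightarrow> P xss = Q xss) \<Longrightarrow> expressible L M \<Theta> Q"
  by (auto simp: expressible_def)

lemma expressible_not: "expressible L M \<Theta> P \<Longrightarrow> expressible L M \<Theta> (\<lambda>xss. \<not> P xss)"
  unfolding expressible_def by (metis sat.simps(4) wf_fm.simps(4))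

lemma expressible_conj:
  "expressible L M \<Theta> P \<Longrightarrow> expressible L M \<Theta> Q \<Longrightarrow> expressible L M \<Theta> (\<lambda>xss. P xss \<and> Q xss)"
  unfolding expressible_def
proof (elim exE conjE)
  fix \<phi> \<psi>
  assume "wf_fm L (concat \<Theta>) \<phi>" "\<forall>xss\<in>blocks M \<Theta>. sat M (concat xss) \<phi> = P xss"
    "wf_fm L (concat \<Theta>) \<psi>" "\<forall>xss\<in>blocks M \<Theta>. sat M (concat xss) \<psi> = Q xss"
  then show "\<exists>\<phi>. wf_fm L (concat \<Theta>) \<phi> \<and> (\<forall>xss\<in>blocks M \<Theta>. sat M (concat xss) \<phi> = (P xss \<and> Q xss))"
    by (intro exI[of _ "Conj \<phi> \<psi>"]) simp
qed

lemma expressible_True: "expressible L M \<Theta> (\<lambda>_. True)"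
  unfolding expressible_def by (intro exI[of _ "Neg Falsum"]) simp

lemma expressible_const: "expressible L M \<Theta> (\<lambda>_. b)"
  using expressible_True[of L M \<Theta>] expressible_not[OF expressible_True[of L M \<Theta>]] by (cases b) auto

lemma expressible_imp:
  assumes "expressible L M \<Theta> P" "expressible L M \<Theta> Q"
  shows "expressible L M \<Theta> (\<lambda>xss. P xss \<longrightarrow> Q xss)"
  using expressible_not[OF expressible_conj[OF assms(1) expressible_not[OF assms(2)]]]
  by (rule expressible_cong) auto

lemma expressible_iff:
  assumes "expressible L M \<Theta> P" "expressible L M \<Theta> Q"
  shows "expressible L M \<Theta> (\<lambda>xss. P xss \<longleftrightarrow> Q xss)"
  using expressible_conj[OF expressible_imp[OF assms] expressible_imp[OF assms(2,1)]]
  by (rule expressible_cong) auto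

lemma expressible_Ball_finite:
  assumes "finite I" and "\<And>i. i \<in> I \<Longrightarrow> expressible L M \<Theta> (P i)"
  shows "expressible L M \<Theta> (\<lambda>xss. \<forall>i\<in>I. P i xss)"
  using assms
proof (induction I)
  case empty
  then show ?case using expressible_True by simp
next
  case (insert i I)
  then show ?case using expressible_conj[of L M \<Theta> "P i" "\<lambda>xss. \<forall>i\<in>I. P i xss"] by simp
qed

lemma expressible_all_less:
  fixes n :: nat
  assumes "\<And>i. i < n \<Longrightarrow> expressible L M \<Theta> (P i)"
  shows "expressible L M \<Theta> (\<lambda>xss. \<forall>i<n. P i xss)"
proof -
  have "expressible L M \<Theta> (\<lambda>xss. \<forall>i\<in>{..<n}. P i xss)"
    by (rule expressible_Ball_finite) (use assms in auto)
  then show ?thesis by (rule expressible_cong) auto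
qed

lemma Ex_block:
  assumes "wf_fm L (\<Delta> @ \<Gamma>) \<phi>"
  shows "\<exists>\<psi>. wf_fm L \<Gamma> \<psi> \<and> (\<forall>xs. sat M xs \<psi> \<longleftrightarrow> (\<exists>ys \<in> tuples M \<Delta>. sat M (ys @ xs) \<phi>))"
  using assms
proof (induction \<Delta> arbitrary: \<phi>)
  case Nil
  then show ?case by auto
next
  case (Cons s \<Delta>)
  have "wf_fm L (\<Delta> @ \<Gamma>) (Ex s \<phi>)" using Cons(2) by simp
  from Cons(1)[OF this] obtain \<psi> where \<psi>: "wf_fm L \<Gamma> \<psi>"
    "\<forall>xs. sat M xs \<psi> \<longleftrightarrow> (\<exists>ys \<in> tuples M \<Delta>. sat M (ys @ xs) (Ex s \<phi>))"
    by blast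
  have "(\<exists>ys \<in> tuples M (s # \<Delta>). sat M (ys @ xs) \<phi>) \<longleftrightarrow>
      (\<exists>ys \<in> tuples M \<Delta>. \<exists>y \<in> carr M s. sat M (y # ys @ xs) \<phi>)" for xs
    unfolding Bex_def tuples_Cons by (metis append_Cons)
  then have "sat M xs \<psi> \<longleftrightarrow> (\<exists>ys \<in> tuples M (s # \<Delta>). sat M (ys @ xs) \<phi>)" for xs
    using \<psi>(2) by simp
  then show ?case using \<psi>(1) by blast
qed

lemma expressible_ex:
  assumes "expressible L M (\<Delta> # \<Theta>) P"
  shows "expressible L M \<Theta> (\<lambda>xss. \<exists>ys \<in> tuples M \<Delta>. P (ys # xss))"
proof -
  obtain \<phi> where \<phi>: "wf_fm L (\<Delta> @ concat \<Theta>) \<phi>" "\<forall>xss\<in>blocks M (\<Delta> # \<Theta>). sat M (concat xss) \<phi> = P xss"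
    using assms by (auto simp: expressible_def)
  obtain \<psi> where \<psi>: "wf_fm L (concat \<Theta>) \<psi>"
    "\<forall>xs. sat M xs \<psi> \<longleftrightarrow> (\<exists>ys \<in> tuples M \<Delta>. sat M (ys @ xs) \<phi>)"
    using Ex_block[OF \<phi>(1)] by blast
  have "sat M (concat xss) \<psi> \<longleftrightarrow> (\<exists>ys \<in> tuples M \<Delta>. P (ys # xss))" if "xss \<in> blocks M \<Theta>" for xss
  proof -
    have "sat M (ys @ concat xss) \<phi> = P (ys # xss)" if "ys \<in> tuples M \<Delta>" for ys
      using \<phi>(2) that \<open>xss \<in> blocks M \<Theta>\<close> by (metis blocks_Cons concat.simps(2))
    then show ?thesis using \<psi>(2) by blast
  qed
  then show ?thesis using \<psi>(1) unfolding expressible_def by blast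
qed

lemma expressible_all:
  assumes "expressible L M (\<Delta> # \<Theta>) P"
  shows "expressible L M \<Theta> (\<lambda>xss. \<forall>ys \<in> tuples M \<Delta>. P (ys # xss))"
  using expressible_not[OF expressible_ex[OF expressible_not[OF assms]]]
  by (rule expressible_cong) auto

definition block_index :: "'a list list \<Rightarrow> nat list \<Rightarrow> nat list" where
  "block_index \<Theta> js = concat (map (\<lambda>j. map ((+) (length (concat (take j \<Theta>)))) [0..<length (\<Theta> ! j)]) js)"

lemma nth_concat_block:
  "j < length xss \<Longrightarrow> i < length (xss ! j) \<Longrightarrow>
     concat xss ! (length (concat (take j xss)) + i) = xss ! j ! i
     \<and> length (concat (take j xss)) + i < length (concat xss)"
proof (induction xss arbitrary: j)
  case (Cons xs xss)
  show ?case
  proof (cases j)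
    case 0
    then show ?thesis using Cons by (simp add: nth_append)
  next
    case (Suc k)
    then show ?thesis using Cons by (simp add: nth_append add.assoc)
  qed
qed simp

lemma block_index_map:
  assumes "map length xss = map length \<Theta>" and "\<forall>j \<in> set js. j < length \<Theta>"
  shows "concat (map ((!) xss) js) = map ((!) (concat xss)) (block_index \<Theta> js)"
    and "\<forall>i \<in> set (block_index \<Theta> js). i < length (concat \<Theta>)"
proof -
  have l: "length xss = length \<Theta>" using assms(1) by (metis length_map)
  have eq: "length (concat (take j xss)) = length (concat (take j \<Theta>))" for j
    unfolding length_concat by (metis assms(1) take_map)
  have len: "length (xss ! j) = length (\<Theta> ! j)" if "j < length \<Theta>" for j
    using assms(1) that l by (metis nth_map)
  have "xss ! j = map ((!) (concat xss)) (map ((+) (length (concat (take j \<Theta>)))) [0..<length (\<Theta> ! j)])"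
    if "j < length \<Theta>" for j
    using nth_concat_block[of j xss] that l eq[of j] len[OF that]
    by (intro nth_equalityI) auto
  then show "concat (map ((!) xss) js) = map ((!) (concat xss)) (block_index \<Theta> js)"
    using assms(2) by (induction js) (auto simp: block_index_def)
  show "\<forall>i \<in> set (block_index \<Theta> js). i < length (concat \<Theta>)"
  proof
    fix i assume "i \<in> set (block_index \<Theta> js)"
    then obtain j where "j \<in> set js" "length (concat (take j \<Theta>)) \<le> i"
      "i < length (\<Theta> ! j) + length (concat (take j \<Theta>))"
      unfolding block_index_def by auto
    then show "i < length (concat \<Theta>)"
      using assms(2) nth_concat_block[of j \<Theta> "i - length (concat (take j \<Theta>))"] by auto
  qed
qed

lemma expressible_fm:
  assumes "wf_fm L (concat (map ((!) \<Theta>) js)) \<phi>" and "\<forall>j \<in> set js. j < length \<Theta>"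
  shows "expressible L M \<Theta> (\<lambda>xss. sat M (concat (map ((!) xss) js)) \<phi>)"
proof -
  let ?f = "(!) (block_index \<Theta> js)"
  have b: "concat (map ((!) \<Theta>) js) = map ((!) (concat \<Theta>)) (block_index \<Theta> js)"
    "\<forall>i \<in> set (block_index \<Theta> js). i < length (concat \<Theta>)"
    using block_index_map[of \<Theta> \<Theta> js] assms(2) by auto
  have 1: "wf_fm L (concat \<Theta>) (ren_fm ?f \<phi>)"
    using assms(1) by (rule wf_ren) (use b in auto)
  have "sat M (concat xss) (ren_fm ?f \<phi>) = sat M (concat (map ((!) xss) js)) \<phi>"
    if "xss \<in> blocks M \<Theta>" for xss
  proof -
    have "map length xss = map length \<Theta>"
      using that by (auto simp: blocks_iff tuples_length intro!: nth_equalityI)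
    then have "concat (map ((!) xss) js) = map ((!) (concat xss)) (block_index \<Theta> js)"
      using block_index_map(1) assms(2) by blast
    moreover have "length (concat (map ((!) \<Theta>) js)) = length (block_index \<Theta> js)" using b(1) by simp
    ultimately show ?thesis using assms(1) by (intro sat_ren) auto
  qed
  then show ?thesis using 1 unfolding expressible_def by blast
qed

lemma expressible_eq:
  assumes "i < length \<Theta>" "j < length \<Theta>" "\<Theta> ! i = \<Theta> ! j"
  shows "expressible L M \<Theta> (\<lambda>xss. xss ! i = xss ! j)"
proof -
  let ?n = "length (\<Theta> ! i)"
  have "expressible L M \<Theta> (\<lambda>xss. \<forall>k<?n. sat M (concat (map ((!) xss) [i, j])) (Eq (Var k) (Var (?n + k))))"
  proof (intro expressible_all_less expressible_fm)
    fix k assume "k < ?n"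
    then have "has_sort L (\<Theta> ! i @ \<Theta> ! i) (Var k) (\<Theta> ! i ! k)"
      and "has_sort L (\<Theta> ! i @ \<Theta> ! i) (Var (?n + k)) (\<Theta> ! i ! k)"
      using has_sort.intros(1)[of k "\<Theta> ! i @ \<Theta> ! i" L]
        has_sort.intros(1)[of "?n + k" "\<Theta> ! i @ \<Theta> ! i" L] by (auto simp: nth_append)
    then show "wf_fm L (concat (map ((!) \<Theta>) [i, j])) (Eq (Var k) (Var (?n + k)))"
      using assms(3) by auto
  qed (use assms in auto)
  then show ?thesis
  proof (rule expressible_cong)
    fix xss assume "xss \<in> blocks M \<Theta>"
    then have "length (xss ! i) = ?n" "length (xss ! j) = ?n"
      using assms by (auto simp: blocks_iff dest!: tuples_length)
    then show "(\<forall>k<?n. sat M (concat (map ((!) xss) [i, j])) (Eq (Var k) (Var (?n + k)))) = (xss ! i = xss ! j)"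
      by (auto simp: nth_append list_eq_iff_nth_eq)
  qed
qed


text \<open>
  Sorts are disjoint, so a position of \<open>es\<close> that carries a parameter automatically has the sort of
  that parameter, and variables can be renamed accordingly.
\<close>

lemma reparametrize:
  assumes "is_struct L M" and "wf_fm L (\<Gamma> @ \<Delta>) \<phi>" and "bs \<in> tuples M \<Delta>" and "es \<in> tuples M \<Xi>"
    and "set bs \<subseteq> set es"
  shows "\<exists>\<psi>. wf_fm L (\<Gamma> @ \<Xi>) \<psi> \<and> (\<forall>xs \<in> tuples M \<Gamma>. sat M (xs @ es) \<psi> \<longleftrightarrow> sat M (xs @ bs) \<phi>)"
proof -
  have "\<exists>k. k < length \<Xi> \<and> es ! k = bs ! i \<and> \<Xi> ! k = \<Delta> ! i" if "i < length \<Delta>" for i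
  proof -
    have i: "bs ! i \<in> carr M (\<Delta> ! i)" "bs ! i \<in> set es"
      using that assms(3,5) by (auto simp: tuples_iff)
    then obtain k where k: "k < length \<Xi>" "es ! k = bs ! i"
      using assms(4) by (auto simp: in_set_conv_nth tuples_iff)
    then have "bs ! i \<in> carr M (\<Xi> ! k)" using assms(4) by (metis tuples_iff)
    then have "\<Xi> ! k = \<Delta> ! i" using i(1) assms(1) by (auto simp: is_struct_def)
    then show ?thesis using k by blast
  qed
  then obtain g where g: "\<And>i. i < length \<Delta> \<Longrightarrow> g i < length \<Xi> \<and> es ! g i = bs ! i \<and> \<Xi> ! g i = \<Delta> ! i"
    by metis
  let ?f = "\<lambda>i. if i < length \<Gamma> then i else length \<Gamma> + g (i - length \<Gamma>)"
  have "wf_fm L (\<Gamma> @ \<Xi>) (ren_fm ?f \<phi>)"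
    using assms(2) by (rule wf_ren) (use g in \<open>auto simp: nth_append\<close>)
  moreover have "sat M (xs @ es) (ren_fm ?f \<phi>) = sat M (xs @ bs) \<phi>" if "xs \<in> tuples M \<Gamma>" for xs
    using assms(2) by (rule sat_ren) (use g tuples_length[OF that] in \<open>auto simp: nth_append\<close>)
  ultimately show ?thesis by blast
qed

section \<open>Automorphisms and definability over small sets\<close>

definition auts ::
  "('s, 'f, 'r) lang \<Rightarrow> ('s, 'f, 'r, 'm) struct \<Rightarrow> 'm set \<Rightarrow> ('m \<Rightarrow> 'm) set" where
  "auts L M B = {\<sigma>. automorphism L M \<sigma> \<and> (\<forall>x \<in> B. \<sigma> x = x)}"

lemma auts_mono: "B \<subseteq> B' \<Longrightarrow> auts L M B' \<subseteq> auts L M B"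
  by (auto simp: auts_def)

lemma auts_automorphism: "\<sigma> \<in> auts L M B \<Longrightarrow> automorphism L M \<sigma>"
  by (simp add: auts_def)

lemma auts_fix_list: "\<sigma> \<in> auts L M B \<Longrightarrow> set xs \<subseteq> B \<Longrightarrow> map \<sigma> xs = xs"
  by (auto simp: auts_def intro!: map_idI)

lemma aut_carr: "automorphism L M \<sigma> \<Longrightarrow> x \<in> carr M s \<Longrightarrow> \<sigma> x \<in> carr M s"
  unfolding automorphism_def bij_betw_def by blast

lemma aut_tuples: "automorphism L M \<sigma> \<Longrightarrow> xs \<in> tuples M \<Gamma> \<Longrightarrow> map \<sigma> xs \<in> tuples M \<Gamma>"
  by (auto simp: tuples_iff aut_carr)

lemma aut_blocks:
  "automorphism L M \<sigma> \<Longrightarrow> xss \<in> blocks M \<Theta> \<Longrightarrow> map (map \<sigma>) xss \<in> blocks M \<Theta>"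
  by (auto simp: blocks_iff aut_tuples)

lemma aut_tuples_surj:
  assumes "automorphism L M \<sigma>" "xs \<in> tuples M \<Gamma>"
  shows "\<exists>ys \<in> tuples M \<Gamma>. map \<sigma> ys = xs"
  using assms(2)
proof (induction \<Gamma> arbitrary: xs)
  case (Cons s \<Gamma>)
  then obtain z zs where z: "xs = z # zs" "z \<in> carr M s" "zs \<in> tuples M \<Gamma>"
    unfolding tuples_Cons by blast
  have "z \<in> \<sigma> ` carr M s" using assms(1) z(2) by (simp add: automorphism_def bij_betw_def)
  then obtain y where "y \<in> carr M s" "\<sigma> y = z" by blast
  moreover obtain ys where "ys \<in> tuples M \<Gamma>" "map \<sigma> ys = zs" using Cons(1)[OF z(3)] by blast
  ultimately show ?case using z(1) by (intro bexI[of _ "y # ys"]) (auto simp: tuples_Cons)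
qed simp

lemma aut_inj:
  assumes "automorphism L M \<sigma>" "x \<in> carr M s" "y \<in> carr M s" "\<sigma> x = \<sigma> y"
  shows "x = y"
  using assms unfolding automorphism_def bij_betw_def inj_on_def by blast

lemma aut_tuples_inj:
  assumes "automorphism L M \<sigma>" "xs \<in> tuples M \<Gamma>" "ys \<in> tuples M \<Gamma>" "map \<sigma> xs = map \<sigma> ys"
  shows "xs = ys"
proof (rule nth_equalityI)
  show "length xs = length ys" using assms(2,3) by (simp add: tuples_length)
  fix i assume "i < length xs"
  then show "xs ! i = ys ! i"
    using assms aut_inj[OF assms(1), of "xs ! i" "\<Gamma> ! i" "ys ! i"]
    by (metis length_map nth_map tuples_iff)
qed

lemma auts_comp: "\<sigma> \<in> auts L M B \<Longrightarrow> \<tau> \<in> auts L M B \<Longrightarrow> \<sigma> \<circ> \<tau> \<in> auts L M B"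
proof -
  assume a: "\<sigma> \<in> auts L M B" "\<tau> \<in> auts L M B"
  then have b: "bij_betw \<sigma> (carr M s) (carr M s)" "bij_betw \<tau> (carr M s) (carr M s)" for s
    by (auto simp: auts_def automorphism_def)
  have t: "automorphism L M \<tau>" "automorphism L M \<sigma>" using a by (auto simp: auts_def)
  have "automorphism L M (\<sigma> \<circ> \<tau>)"
    unfolding automorphism_def
  proof (intro conjI allI impI ballI)
    fix s show "bij_betw (\<sigma> \<circ> \<tau>) (carr M s) (carr M s)" using b by (metis bij_betw_trans)
  next
    fix f ss s xs assume "fun_type L f = Some (ss, s)" and xs: "xs \<in> tuples M ss"
    then show "(\<sigma> \<circ> \<tau>) (fun_int M f xs) = fun_int M f (map (\<sigma> \<circ> \<tau>) xs)"
      using t aut_tuples[OF t(1) xs] unfolding automorphism_def by (simp add: o_def)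
  next
    fix r ss xs assume "rel_type L r = Some ss" and xs: "xs \<in> tuples M ss"
    then have "rel_int M r xs = rel_int M r (map \<tau> xs)"
      "rel_int M r (map \<tau> xs) = rel_int M r (map \<sigma> (map \<tau> xs))"
      using t aut_tuples[OF t(1) xs] unfolding automorphism_def by blast+
    then show "rel_int M r xs = rel_int M r (map (\<sigma> \<circ> \<tau>) xs)" by (simp add: o_def)
  qed
  then show ?thesis using a by (auto simp: auts_def)
qed

lemma id_auts: "id \<in> auts L M B"
  by (auto simp: auts_def automorphism_def)

lemma val_carr:
  assumes "is_struct L M" "has_sort L \<Gamma> t s" "xs \<in> tuples M \<Gamma>"
  shows "val M xs t \<in> carr M s"
  using assms(2)
proof (induction rule: has_sort.induct)
  case (1 i)
  then show ?case using assms(3) by (simp add: tuples_iff)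
next
  case (2 f ss s ts)
  have "map (val M xs) ts \<in> tuples M ss"
    unfolding tuples_def mem_Collect_eq list_all2_map1 using 2(2) by (rule list_all2_mono) simp
  then show ?case using assms(1) 2(1) by (simp add: is_struct_def)
qed

lemma vals_tuples:
  assumes "is_struct L M" "list_all2 (has_sort L \<Gamma>) ts ss" "xs \<in> tuples M \<Gamma>"
  shows "map (val M xs) ts \<in> tuples M ss"
  unfolding tuples_def mem_Collect_eq list_all2_map1 using assms(2)
  by (rule list_all2_mono) (rule val_carr[OF assms(1) _ assms(3)])

lemma aut_val:
  assumes "is_struct L M" "automorphism L M \<sigma>" "has_sort L \<Gamma> t s" "xs \<in> tuples M \<Gamma>"
  shows "val M (map \<sigma> xs) t = \<sigma> (val M xs t)"
  using assms(3)
proof (induction rule: has_sort.induct)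
  case (1 i)
  then show ?case using assms(4) by (simp add: tuples_length)
next
  case (2 f ss s ts)
  have "list_all2 (has_sort L \<Gamma>) ts ss" using 2(2) by (rule list_all2_mono) simp
  then have "map (val M xs) ts \<in> tuples M ss" by (rule vals_tuples[OF assms(1) _ assms(4)])
  then have "\<sigma> (fun_int M f (map (val M xs) ts)) = fun_int M f (map \<sigma> (map (val M xs) ts))"
    using assms(2) 2(1) unfolding automorphism_def by blast
  moreover have "\<forall>t \<in> set ts. val M (map \<sigma> xs) t = \<sigma> (val M xs t)"
    using 2(2) by (auto simp: list_all2_conv_all_nth in_set_conv_nth)
  then have "map (val M (map \<sigma> xs)) ts = map \<sigma> (map (val M xs) ts)" by simp
  ultimately show ?case by (metis val.simps(2))
qed

lemma aut_sat:
  assumes "is_struct L M" "automorphism L M \<sigma>" "wf_fm L \<Gamma> \<phi>" "xs \<in> tuples M \<Gamma>"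
  shows "sat M (map \<sigma> xs) \<phi> = sat M xs \<phi>"
  using assms(3,4)
proof (induction \<phi> arbitrary: \<Gamma> xs)
  case (Eq t u)
  then obtain s where s: "has_sort L \<Gamma> t s" "has_sort L \<Gamma> u s" by auto
  show ?case
    using aut_val[OF assms(1,2) s(1) Eq(2)] aut_val[OF assms(1,2) s(2) Eq(2)]
      aut_inj[OF assms(2)] val_carr[OF assms(1) s(1) Eq(2)] val_carr[OF assms(1) s(2) Eq(2)]
    by (metis sat.simps(2))
next
  case (Rel r ts)
  then obtain ss where ss: "rel_type L r = Some ss" "list_all2 (has_sort L \<Gamma>) ts ss" by auto
  have t: "map (val M xs) ts \<in> tuples M ss" by (rule vals_tuples[OF assms(1) ss(2) Rel(2)])
  have "\<forall>t \<in> set ts. val M (map \<sigma> xs) t = \<sigma> (val M xs t)"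
  proof
    fix t assume "t \<in> set ts"
    then obtain s where "has_sort L \<Gamma> t s" using ss(2) by (auto simp: list_all2_conv_all_nth in_set_conv_nth)
    then show "val M (map \<sigma> xs) t = \<sigma> (val M xs t)" by (rule aut_val[OF assms(1,2) _ Rel(2)])
  qed
  then have "map (val M (map \<sigma> xs)) ts = map \<sigma> (map (val M xs) ts)" by simp
  moreover have "rel_int M r (map (val M xs) ts) = rel_int M r (map \<sigma> (map (val M xs) ts))"
    using assms(2) ss(1) t unfolding automorphism_def by blast
  ultimately show ?case by (metis sat.simps(3))
next
  case (Ex s \<phi>)
  have 1: "sat M (\<sigma> y # map \<sigma> xs) \<phi> = sat M (y # xs) \<phi>" if "y \<in> carr M s" for y
  proof -
    have "y # xs \<in> tuples M (s # \<Gamma>)" using that Ex(3) by (auto simp: tuples_Cons)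
    then show ?thesis using Ex(1)[of "s # \<Gamma>" "y # xs"] Ex(2) by simp
  qed
  have "\<sigma> ` carr M s = carr M s" using assms(2) by (auto simp: automorphism_def bij_betw_def)
  then have "sat M (map \<sigma> xs) (Ex s \<phi>) \<longleftrightarrow> (\<exists>y \<in> carr M s. sat M (\<sigma> y # map \<sigma> xs) \<phi>)"
    by (metis (no_types, lifting) imageE imageI sat.simps(6))
  then show ?case using 1 by auto
next
  case (Neg \<phi>) then show ?case by (metis sat.simps(4) wf_fm.simps(4))
next
  case (Conj \<phi> \<psi>) then show ?case by (metis sat.simps(5) wf_fm.simps(5))
qed simp

lemma aut_expressible:
  assumes "is_struct L M" "automorphism L M \<sigma>" "expressible L M \<Theta> P" "xss \<in> blocks M \<Theta>"
  shows "P (map (map \<sigma>) xss) = P xss"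
proof -
  obtain \<phi> where \<phi>: "wf_fm L (concat \<Theta>) \<phi>" "\<forall>xss\<in>blocks M \<Theta>. sat M (concat xss) \<phi> = P xss"
    using assms(3) by (auto simp: expressible_def)
  have "sat M (map \<sigma> (concat xss)) \<phi> = sat M (concat xss) \<phi>"
    by (rule aut_sat[OF assms(1,2) \<phi>(1) blocks_concat[OF assms(4)]])
  then show ?thesis
    using \<phi>(2) assms(4) aut_blocks[OF assms(2,4)] by (simp add: map_concat)
qed

lemma definable_finite_Int:
  assumes "finite I" "\<And>i. i \<in> I \<Longrightarrow> definable L M B \<Gamma> (X i)"
  shows "definable L M B \<Gamma> (tuples M \<Gamma> \<inter> (\<Inter>i\<in>I. X i))"
  using assms
proof (induction I)
  case empty
  show ?case unfolding definable_def
    by (intro exI[of _ "[]"] exI[of _ "Neg Falsum"]) auto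
next
  case (insert i I)
  then have "definable L M B \<Gamma> (X i)" and d: "definable L M B \<Gamma> (tuples M \<Gamma> \<inter> (\<Inter>i\<in>I. X i))"
    by auto
  then obtain \<Delta> \<phi> bs where
    1: "wf_fm L (\<Gamma> @ \<Delta>) \<phi>" "bs \<in> tuples M \<Delta>" "set bs \<subseteq> B"
      "X i = {xs \<in> tuples M \<Gamma>. sat M (xs @ bs) \<phi>}"
    unfolding definable_def by (elim exE conjE)
  from d obtain \<Delta>' \<phi>' bs' where
    2: "wf_fm L (\<Gamma> @ \<Delta>') \<phi>'" "bs' \<in> tuples M \<Delta>'" "set bs' \<subseteq> B"
      "tuples M \<Gamma> \<inter> (\<Inter>i\<in>I. X i) = {xs \<in> tuples M \<Gamma>. sat M (xs @ bs') \<phi>'}"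
    unfolding definable_def by (elim exE conjE)
  have "expressible L M [\<Gamma>, \<Delta>, \<Delta>']
      (\<lambda>xss. sat M (concat (map ((!) xss) [0, 1])) \<phi> \<and> sat M (concat (map ((!) xss) [0, 2])) \<phi>')"
    by (intro expressible_conj expressible_fm) (use 1 2 in auto)
  then obtain \<psi> where \<psi>: "wf_fm L (\<Gamma> @ \<Delta> @ \<Delta>') \<psi>"
    "\<forall>xss\<in>blocks M [\<Gamma>, \<Delta>, \<Delta>']. sat M (concat xss) \<psi> \<longleftrightarrow>
      sat M (concat (map ((!) xss) [0, 1])) \<phi> \<and> sat M (concat (map ((!) xss) [0, 2])) \<phi>'"
    by (auto simp: expressible_def)
  have "sat M (xs @ bs @ bs') \<psi> \<longleftrightarrow> sat M (xs @ bs) \<phi> \<and> sat M (xs @ bs') \<phi>'" if "xs \<in> tuples M \<Gamma>" for xs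
    using \<psi>(2)[rule_format, of "[xs, bs, bs']"] that 1(2) 2(2) by (simp add: blocks_Cons)
  then have "tuples M \<Gamma> \<inter> (\<Inter>i\<in>insert i I. X i) = {xs \<in> tuples M \<Gamma>. sat M (xs @ bs @ bs') \<psi>}"
    using 1(4) 2(4) by auto
  moreover have "bs @ bs' \<in> tuples M (\<Delta> @ \<Delta>')" "set (bs @ bs') \<subseteq> B"
    using 1 2 by (auto intro: tuples_append)
  ultimately show ?case using \<psi>(1) unfolding definable_def by blast
qed

lemma definable_Compl:
  assumes "definable L M B \<Gamma> X"
  shows "definable L M B \<Gamma> (tuples M \<Gamma> - X)"
proof -
  obtain \<Delta> \<phi> bs where 1: "wf_fm L (\<Gamma> @ \<Delta>) \<phi>" "bs \<in> tuples M \<Delta>" "set bs \<subseteq> B"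
      "X = {xs \<in> tuples M \<Gamma>. sat M (xs @ bs) \<phi>}"
    using assms unfolding definable_def by (elim exE conjE)
  show ?thesis unfolding definable_def
    by (intro exI[of _ \<Delta>] exI[of _ "Neg \<phi>"] exI[of _ bs]) (use 1 in auto)
qed

lemma definable_finite_Un:
  assumes "finite I" "\<And>i. i \<in> I \<Longrightarrow> definable L M B \<Gamma> (X i)"
  shows "definable L M B \<Gamma> (\<Union>i\<in>I. X i)"
proof -
  have "X i \<subseteq> tuples M \<Gamma>" if "i \<in> I" for i using assms(2)[OF that] by (auto simp: definable_def)
  then have "(\<Union>i\<in>I. X i) = tuples M \<Gamma> - (tuples M \<Gamma> \<inter> (\<Inter>i\<in>I. tuples M \<Gamma> - X i))" by auto
  moreover have "definable L M B \<Gamma> (tuples M \<Gamma> - (tuples M \<Gamma> \<inter> (\<Inter>i\<in>I. tuples M \<Gamma> - X i)))"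
    by (intro definable_Compl definable_finite_Int assms)
  ultimately show ?thesis by simp
qed

lemma definable_mono: "definable L M B \<Gamma> X \<Longrightarrow> B \<subseteq> B' \<Longrightarrow> definable L M B' \<Gamma> X"
  unfolding definable_def by blast

lemma definable_invariant:
  assumes "is_struct L M" "definable L M B \<Gamma> X" "\<sigma> \<in> auts L M B" "xs \<in> tuples M \<Gamma>"
  shows "map \<sigma> xs \<in> X \<longleftrightarrow> xs \<in> X"
proof -
  obtain \<Delta> \<phi> bs where 1: "wf_fm L (\<Gamma> @ \<Delta>) \<phi>" "bs \<in> tuples M \<Delta>" "set bs \<subseteq> B"
      "X = {xs \<in> tuples M \<Gamma>. sat M (xs @ bs) \<phi>}"
    using assms(2) unfolding definable_def by (elim exE conjE)
  have s: "automorphism L M \<sigma>" using assms(3) by (rule auts_automorphism)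
  have "sat M (map \<sigma> (xs @ bs)) \<phi> = sat M (xs @ bs) \<phi>"
    by (rule aut_sat[OF assms(1) s 1(1)]) (intro tuples_append assms 1)
  then show ?thesis
    using 1(4) aut_tuples[OF s assms(4)] assms(4) auts_fix_list[OF assms(3) 1(3)] by simp
qed

lemma dcl_mono: "B \<subseteq> B' \<Longrightarrow> dcl L M B \<subseteq> dcl L M B'"
  unfolding dcl_def by (auto intro: definable_mono)

lemma dcl_universe: "dcl L M B \<subseteq> universe M"
  by (auto simp: dcl_def universe_def)

lemma dcl_fixed:
  assumes "is_struct L M" "y \<in> dcl L M B" "\<sigma> \<in> auts L M B"
  shows "\<sigma> y = y"
proof -
  obtain s where s: "y \<in> carr M s" "definable L M B [s] {[y]}" using assms(2) by (auto simp: dcl_def)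
  have "[y] \<in> tuples M [s]" using s(1) by (simp add: tuples_Cons)
  then show ?thesis using definable_invariant[OF assms(1) s(2) assms(3), of "[y]"] by simp
qed

lemma universe_tuples: "set xs \<subseteq> universe M \<Longrightarrow> \<exists>\<Delta>. xs \<in> tuples M \<Delta>"
proof (induction xs)
  case Nil
  show ?case by (intro exI[of _ "[]"]) simp
next
  case (Cons b bs)
  then obtain s \<Delta> where "b \<in> carr M s" "bs \<in> tuples M \<Delta>" by (auto simp: universe_def)
  then show ?case by (intro exI[of _ "s # \<Delta>"]) (simp add: tuples_Cons)
qed

locale monster =
  fixes L :: "('s, 'f, 'r) lang" and T :: "('s, 'f, 'r) fm set"
    and M :: "('s, 'f, 'r, 'm) struct" and \<kappa> :: "'k rel"
  assumes complete: "complete_theory L T" and monster: "monster_model \<kappa> L T M"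
begin

lemma struct: "is_struct L M"
  using monster by (auto simp: monster_model_def is_model_def)

lemmas sat_aut = aut_sat[OF struct]
lemmas expressible_aut = aut_expressible[OF struct]
lemmas fixed_dcl = dcl_fixed[OF struct]

text \<open>A complete theory contains one of any two consecutive iterated negations of \<open>Falsum\<close>.\<close>

lemma infinite_T: "infinite T"
proof
  assume "finite T"
  define F :: "nat \<Rightarrow> ('s, 'f, 'r) fm" where "F n = (Neg ^^ n) Falsum" for n
  have F_Suc: "F (Suc n) = Neg (F n)" for n by (simp add: F_def)
  have F_0: "F 0 = Falsum" by (simp add: F_def)
  have "F m = F n \<Longrightarrow> m = n" for m n
  proof (induction n arbitrary: m)
    case 0
    then show ?case by (cases m) (simp_all add: F_0 F_Suc)
  next
    case (Suc n)
    then show ?case by (cases m) (simp_all add: F_0 F_Suc)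
  qed
  then have inj: "inj F" by (rule injI)
  have wf: "wf_fm L [] (F n)" for n unfolding F_def by (induction n) auto
  have "\<exists>m\<ge>n. F m \<in> T" for n
  proof -
    have "F n \<in> T \<or> F (Suc n) \<in> T"
      using complete wf[of n] unfolding complete_theory_def F_Suc by blast
    then show ?thesis using le_Suc_eq by blast
  qed
  then have "infinite {m. F m \<in> T}" unfolding infinite_nat_iff_unbounded_le by auto
  moreover have "finite {m. F m \<in> T}"
    using \<open>finite T\<close> inj finite_vimageI[of T F] by (simp add: vimage_def)
  ultimately show False by blast
qed

lemma small_Un_finite:
  assumes "small_set \<kappa> M B" "finite F" "F \<subseteq> universe M"
  shows "small_set \<kappa> M (B \<union> F)"
proof -
  have k: "Card_order \<kappa>" "|T| <o \<kappa>" using monster by (auto simp: monster_model_def)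
  then have "infinite (Field \<kappa>)"
    using infinite_T by (metis card_of_Field_ordIso card_of_ordLeq_infinite ordIso_symmetric
        ordLess_imp_ordLeq ordLeq_ordIso_trans)
  moreover have "|F| <o \<kappa>"
    using finite_ordLess_infinite[of "|F|" \<kappa>] calculation assms(2) k(1)
    by (simp add: card_order_on_well_order_on card_of_well_order_on Field_card_of)
  ultimately show ?thesis
    using card_of_Un_ordLess_infinite_Field[of \<kappa> B F] assms k(1) by (auto simp: small_set_def)
qed

text \<open>
  Strong homogeneity for the map that is the identity on \<open>B\<close> and takes \<open>xs\<close> to \<open>ys\<close>. Formulas of the
  form \<open>x\<^sub>i = x\<^sub>j\<close> and \<open>x\<^sub>i = b\<close> in the type make the map well defined.
\<close>

lemma same_type_conjugate:
  assumes B: "small_set \<kappa> M B" and xy: "xs \<in> tuples M \<Gamma>" "ys \<in> tuples M \<Gamma>"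
    and type: "\<And>\<Delta> \<phi> bs. wf_fm L (\<Gamma> @ \<Delta>) \<phi> \<Longrightarrow> bs \<in> tuples M \<Delta> \<Longrightarrow> set bs \<subseteq> B \<Longrightarrow>
      sat M (xs @ bs) \<phi> \<Longrightarrow> sat M (ys @ bs) \<phi>"
  shows "\<exists>\<sigma> \<in> auts L M B. map \<sigma> xs = ys"
proof -
  have len: "length xs = length \<Gamma>" "length ys = length \<Gamma>" using xy by (auto simp: tuples_length)
  have type': "sat M (xs @ bs) \<phi> = sat M (ys @ bs) \<phi>"
    if "wf_fm L (\<Gamma> @ \<Delta>) \<phi>" "bs \<in> tuples M \<Delta>" "set bs \<subseteq> B" for \<Delta> \<phi> bs
    using type[of \<Delta> \<phi> bs] type[of \<Delta> "Neg \<phi>" bs] that by auto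
  have eqB: "ys ! i = b" if "i < length \<Gamma>" "xs ! i = b" "b \<in> B" for i b
  proof -
    have b: "b \<in> carr M (\<Gamma> ! i)" using xy(1) that by (auto simp: tuples_iff)
    have "has_sort L (\<Gamma> @ [\<Gamma> ! i]) (Var i) (\<Gamma> ! i)"
      "has_sort L (\<Gamma> @ [\<Gamma> ! i]) (Var (length \<Gamma>)) (\<Gamma> ! i)"
      using has_sort.intros(1)[of i "\<Gamma> @ [\<Gamma> ! i]" L]
        has_sort.intros(1)[of "length \<Gamma>" "\<Gamma> @ [\<Gamma> ! i]" L] that(1) by (auto simp: nth_append)
    then have "wf_fm L (\<Gamma> @ [\<Gamma> ! i]) (Eq (Var i) (Var (length \<Gamma>)))" by auto
    from type[OF this, of "[b]"] show ?thesis
      using that b len by (simp add: nth_append tuples_Cons)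
  qed
  have eqx: "ys ! i = ys ! j" if "i < length \<Gamma>" "j < length \<Gamma>" "xs ! i = xs ! j" for i j
  proof -
    have "xs ! i \<in> carr M (\<Gamma> ! i)" "xs ! j \<in> carr M (\<Gamma> ! j)" using xy(1) that by (auto simp: tuples_iff)
    then have "\<Gamma> ! i = \<Gamma> ! j" using that(3) struct unfolding is_struct_def by (metis disjoint_iff)
    then have "wf_fm L (\<Gamma> @ []) (Eq (Var i) (Var j))"
      using has_sort.intros(1)[of i \<Gamma> L] has_sort.intros(1)[of j \<Gamma> L] that(1,2) by auto
    from type[OF this, of "[]"] show ?thesis using that by simp
  qed
  define g where "g z = (if z \<in> B then z else ys ! (SOME i. i < length \<Gamma> \<and> xs ! i = z))" for z
  have gx: "g (xs ! i) = ys ! i" if "i < length \<Gamma>" for i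
  proof (cases "xs ! i \<in> B")
    case True
    then show ?thesis using eqB[OF that] by (simp add: g_def)
  next
    case False
    have "(SOME j. j < length \<Gamma> \<and> xs ! j = xs ! i) < length \<Gamma> \<and>
        xs ! (SOME j. j < length \<Gamma> \<and> xs ! j = xs ! i) = xs ! i"
      by (rule someI[of _ i]) (use that in simp)
    then show ?thesis using eqx[OF _ that] False by (simp add: g_def)
  qed
  then have gmap: "map g xs = ys" using len by (simp add: list_eq_iff_nth_eq)
  have gB: "g z = z" if "z \<in> B" for z using that by (simp add: g_def)
  have "partial_elementary L M (B \<union> set xs) g"
    unfolding partial_elementary_def
  proof (intro conjI allI impI)
    fix s
    have "g (xs ! i) \<in> carr M s" if "i < length \<Gamma>" "xs ! i \<in> carr M s" for i
    proof -
      have "xs ! i \<in> carr M (\<Gamma> ! i)" using xy(1) that by (auto simp: tuples_iff)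
      then have "s = \<Gamma> ! i" using that(2) struct unfolding is_struct_def by (metis disjoint_iff)
      then show ?thesis using gx[OF that(1)] xy(2) that(1) by (simp add: tuples_iff)
    qed
    then show "g ` ((B \<union> set xs) \<inter> carr M s) \<subseteq> carr M s"
      using gB len by (auto simp: in_set_conv_nth)
  next
    fix \<Xi> \<phi> zs
    assume z: "wf_fm L \<Xi> \<phi>" "zs \<in> tuples M \<Xi>" "set zs \<subseteq> B \<union> set xs"
    define bs where "bs = filter (\<lambda>z. z \<in> B) zs"
    have bB: "set bs \<subseteq> B" "set bs \<subseteq> universe M"
      using tuples_universe[OF z(2)] by (auto simp: bs_def)
    have "\<exists>\<Delta>. bs \<in> tuples M \<Delta>" using bB(2) by (rule universe_tuples)
    then obtain \<Delta> where \<Delta>: "bs \<in> tuples M \<Delta>" by blast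
    have "set zs \<subseteq> set (xs @ bs)" using z(3) by (auto simp: bs_def)
    then have "\<exists>k. k < length \<Gamma> + length \<Delta> \<and> (xs @ bs) ! k = zs ! i" if "i < length \<Xi>" for i
      using that tuples_length[OF z(2)] len tuples_length[OF \<Delta>]
      by (metis in_set_conv_nth length_append nth_mem subsetD)
    then obtain k where k: "\<And>i. i < length \<Xi> \<Longrightarrow> k i < length \<Gamma> + length \<Delta> \<and> (xs @ bs) ! k i = zs ! i"
      by metis
    have xb: "xs @ bs \<in> tuples M (\<Gamma> @ \<Delta>)" using xy(1) \<Delta> by (rule tuples_append)
    have sort: "(\<Gamma> @ \<Delta>) ! k i = \<Xi> ! i" if "i < length \<Xi>" for i
    proof -
      have "zs ! i \<in> carr M ((\<Gamma> @ \<Delta>) ! k i)" "zs ! i \<in> carr M (\<Xi> ! i)"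
        using xb z(2) k[OF that] that by (auto simp: tuples_iff)
      then show ?thesis using struct unfolding is_struct_def by (metis disjoint_iff)
    qed
    have wf: "wf_fm L (\<Gamma> @ \<Delta>) (ren_fm k \<phi>)"
      by (rule wf_ren[OF z(1)]) (use k sort in auto)
    have "sat M zs \<phi> = sat M (xs @ bs) (ren_fm k \<phi>)"
      by (rule sat_ren[OF z(1), symmetric]) (use k in auto)
    also have "\<dots> = sat M (ys @ bs) (ren_fm k \<phi>)" by (rule type'[OF wf \<Delta> bB(1)])
    also have "ys @ bs = map g (xs @ bs)" using gmap gB bB(1) by (auto intro!: map_idI[symmetric])
    also have "sat M (map g (xs @ bs)) (ren_fm k \<phi>) = sat M (map g zs) \<phi>"
      by (rule sat_ren[OF z(1)])
        (use k len tuples_length[OF \<Delta>] tuples_length[OF z(2)] in \<open>simp add: nth_map del: map_append\<close>)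
    finally show "sat M zs \<phi> = sat M (map g zs) \<phi>" .
  qed
  moreover have "small_set \<kappa> M (B \<union> set xs)"
    using small_Un_finite[OF B] tuples_universe[OF xy(1)] by simp
  ultimately obtain \<sigma> where \<sigma>: "automorphism L M \<sigma>" "\<forall>z \<in> B \<union> set xs. \<sigma> z = g z"
    using monster unfolding monster_model_def strongly_homogeneous_def small_set_def by meson
  then have "\<sigma> \<in> auts L M B" "map \<sigma> xs = ys" using gB gmap by (auto simp: auts_def)
  then show ?thesis by blast
qed

text \<open>
  Saturation is used twice: a point of \<open>X\<close> has a \<open>B\<close>-definable neighbourhood inside \<open>X\<close>, because
  otherwise its type over \<open>B\<close> would be realized outside \<open>X\<close>, and these neighbourhoods cover \<open>X\<close>, so
  finitely many of them do.
\<close>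

lemma invariant_definable:
  assumes B: "small_set \<kappa> M B" and X: "definable L M B' \<Gamma> X"
    and inv: "\<And>\<sigma> xs. \<sigma> \<in> auts L M B \<Longrightarrow> xs \<in> X \<Longrightarrow> map \<sigma> xs \<in> X"
  shows "definable L M B \<Gamma> X"
proof -
  obtain \<Xi> \<zeta> cs where X_eq: "wf_fm L (\<Gamma> @ \<Xi>) \<zeta>" "cs \<in> tuples M \<Xi>"
    "X = {xs \<in> tuples M \<Gamma>. sat M (xs @ cs) \<zeta>}"
    using X unfolding definable_def by (elim exE conjE)
  let ?A = "B \<union> set cs"
  have A: "?A \<subseteq> universe M" "|?A| <o \<kappa>"
    using small_Un_finite[OF B _ tuples_universe[OF X_eq(2)]] by (auto simp: small_set_def)
  have satd: "\<exists>xs\<in>tuples M \<Gamma>. \<forall>(\<phi>, bs)\<in>p. sat M (xs @ bs) \<phi>"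
    if "\<forall>(\<phi>, bs)\<in>p. \<exists>\<Delta>. wf_fm L (\<Gamma> @ \<Delta>) \<phi> \<and> bs \<in> tuples M \<Delta> \<and> set bs \<subseteq> ?A"
      "\<And>q. q \<subseteq> p \<Longrightarrow> finite q \<Longrightarrow> \<exists>xs\<in>tuples M \<Gamma>. \<forall>(\<phi>, bs)\<in>q. sat M (xs @ bs) \<phi>" for p
  proof -
    have "saturated \<kappa> L M" using monster by (simp add: monster_model_def)
    from this[unfolded saturated_def, THEN spec, THEN spec, THEN spec, THEN mp, THEN mp, THEN mp, THEN mp, OF A that(1)]
    show ?thesis using that(2) by blast
  qed
  define FB where "FB = {(\<phi>, bs). \<exists>\<Delta>. wf_fm L (\<Gamma> @ \<Delta>) \<phi> \<and> bs \<in> tuples M \<Delta> \<and> set bs \<subseteq> B}"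
  define D where "D = (\<lambda>(\<phi>, bs). {xs \<in> tuples M \<Gamma>. sat M (xs @ bs) \<phi>})"
  have defD: "definable L M B \<Gamma> (D f)" if "f \<in> FB" for f
    using that unfolding FB_def D_def definable_def by auto
  have nbhd: "\<exists>Y. definable L M B \<Gamma> Y \<and> xs \<in> Y \<and> Y \<subseteq> X" if xs: "xs \<in> X" for xs
  proof -
    let ?p = "{f \<in> FB. xs \<in> D f}"
    have xt: "xs \<in> tuples M \<Gamma>" using xs X_eq(3) by simp
    have "\<not> (\<exists>ys\<in>tuples M \<Gamma>. \<forall>(\<phi>, bs)\<in>insert (Neg \<zeta>, cs) ?p. sat M (ys @ bs) \<phi>)"
    proof
      assume "\<exists>ys\<in>tuples M \<Gamma>. \<forall>(\<phi>, bs)\<in>insert (Neg \<zeta>, cs) ?p. sat M (ys @ bs) \<phi>"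
      then obtain ys where ys: "ys \<in> tuples M \<Gamma>"
        "\<forall>(\<phi>, bs)\<in>insert (Neg \<zeta>, cs) ?p. sat M (ys @ bs) \<phi>" by blast
      have "sat M (ys @ bs) \<phi>"
        if "wf_fm L (\<Gamma> @ \<Delta>) \<phi>" "bs \<in> tuples M \<Delta>" "set bs \<subseteq> B" "sat M (xs @ bs) \<phi>" for \<Delta> \<phi> bs
      proof -
        have "(\<phi>, bs) \<in> ?p" using that xt by (auto simp: FB_def D_def)
        then show ?thesis using ys(2) by fastforce
      qed
      then obtain \<sigma> where "\<sigma> \<in> auts L M B" "map \<sigma> xs = ys"
        using same_type_conjugate[OF B xt ys(1)] by blast
      then have "ys \<in> X" using inv xs by blast
      then show False using ys(2) X_eq(3) by auto
    qed
    then obtain q where q: "q \<subseteq> insert (Neg \<zeta>, cs) ?p" "finite q"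
      "\<not> (\<exists>ys\<in>tuples M \<Gamma>. \<forall>(\<phi>, bs)\<in>q. sat M (ys @ bs) \<phi>)"
      using satd[of "insert (Neg \<zeta>, cs) ?p"] X_eq(1,2) unfolding FB_def by fastforce
    let ?q = "q \<inter> ?p"
    let ?Y = "tuples M \<Gamma> \<inter> (\<Inter>f\<in>?q. D f)"
    have "definable L M B \<Gamma> ?Y" using q(2) defD by (intro definable_finite_Int) auto
    moreover have "xs \<in> ?Y" using xt by auto
    moreover have "?Y \<subseteq> X"
    proof
      fix ys assume ys: "ys \<in> ?Y"
      then have "\<exists>(\<phi>, bs)\<in>q. \<not> sat M (ys @ bs) \<phi>" using q(3) by blast
      then obtain \<phi> bs where f: "(\<phi>, bs) \<in> q" "\<not> sat M (ys @ bs) \<phi>" by blast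
      then have "(\<phi>, bs) \<notin> ?p" using ys by (auto simp: D_def)
      then have "\<phi> = Neg \<zeta>" "bs = cs" using f(1) q(1) by auto
      then show "ys \<in> X" using f(2) ys X_eq(3) by simp
    qed
    ultimately show ?thesis by blast
  qed
  define F where "F = {f \<in> FB. D f \<subseteq> X}"
  have cover: "X = (\<Union>f\<in>F. D f)"
  proof
    show "X \<subseteq> (\<Union>f\<in>F. D f)"
    proof
      fix xs assume "xs \<in> X"
      then obtain Y where Y: "definable L M B \<Gamma> Y" "xs \<in> Y" "Y \<subseteq> X" using nbhd by blast
      then obtain \<Delta> \<phi> bs where "wf_fm L (\<Gamma> @ \<Delta>) \<phi>" "bs \<in> tuples M \<Delta>" "set bs \<subseteq> B"
        "Y = {xs \<in> tuples M \<Gamma>. sat M (xs @ bs) \<phi>}" unfolding definable_def by (elim exE conjE)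
      then have "(\<phi>, bs) \<in> F" "Y = D (\<phi>, bs)" using Y(3) by (auto simp: F_def FB_def D_def)
      then show "xs \<in> (\<Union>f\<in>F. D f)" using Y(2) by blast
    qed
  qed (auto simp: F_def)
  let ?p = "insert (\<zeta>, cs) ((\<lambda>(\<phi>, bs). (Neg \<phi>, bs)) ` F)"
  have "\<not> (\<exists>ys\<in>tuples M \<Gamma>. \<forall>(\<phi>, bs)\<in>?p. sat M (ys @ bs) \<phi>)"
  proof
    assume "\<exists>ys\<in>tuples M \<Gamma>. \<forall>(\<phi>, bs)\<in>?p. sat M (ys @ bs) \<phi>"
    then obtain ys where ys: "ys \<in> tuples M \<Gamma>" "\<forall>(\<phi>, bs)\<in>?p. sat M (ys @ bs) \<phi>" by blast
    then have "ys \<in> X" using X_eq(3) by simp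
    then obtain \<phi> bs where "(\<phi>, bs) \<in> F" "ys \<in> D (\<phi>, bs)" using cover by auto
    then show False using ys(2) by (auto simp: D_def)
  qed
  then obtain q where q: "q \<subseteq> ?p" "finite q"
    "\<not> (\<exists>ys\<in>tuples M \<Gamma>. \<forall>(\<phi>, bs)\<in>q. sat M (ys @ bs) \<phi>)"
    using satd[of ?p] X_eq(1,2) unfolding F_def FB_def by fastforce
  obtain G where G: "G \<subseteq> F" "finite G" "q \<subseteq> insert (\<zeta>, cs) ((\<lambda>(\<phi>, bs). (Neg \<phi>, bs)) ` G)"
  proof -
    have "q - {(\<zeta>, cs)} \<subseteq> (\<lambda>(\<phi>, bs). (Neg \<phi>, bs)) ` F" "finite (q - {(\<zeta>, cs)})"
      using q(1,2) by blast+
    from finite_subset_image[OF this(2,1)]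
    obtain G where "G \<subseteq> F" "finite G" "q - {(\<zeta>, cs)} = (\<lambda>(\<phi>, bs). (Neg \<phi>, bs)) ` G"
      by blast
    then show ?thesis using that[of G] by blast
  qed
  have "X = (\<Union>f\<in>G. D f)"
  proof
    show "X \<subseteq> (\<Union>f\<in>G. D f)"
    proof
      fix ys assume ys: "ys \<in> X"
      then have "\<exists>(\<phi>, bs)\<in>q. \<not> sat M (ys @ bs) \<phi>" using q(3) X_eq(3) by blast
      then obtain f where "f \<in> G" "\<not> sat M (ys @ snd f) (Neg (fst f))"
        using G(3) ys X_eq(3) by (fastforce split: prod.splits)
      then show "ys \<in> (\<Union>f\<in>G. D f)" using ys X_eq(3) by (auto simp: D_def split: prod.splits)
    qed
    show "(\<Union>f\<in>G. D f) \<subseteq> X" using G(1) cover by blast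
  qed
  then show ?thesis
    using definable_finite_Un[OF G(2), of L M B \<Gamma> D] defD G(1) by (auto simp: F_def)
qed

lemma definable_singleton: "t \<in> tuples M \<Gamma> \<Longrightarrow> definable L M (set t) \<Gamma> {t}"
proof -
  assume t: "t \<in> tuples M \<Gamma>"
  have "expressible L M [\<Gamma>, \<Gamma>] (\<lambda>xss. xss ! 0 = xss ! 1)" by (rule expressible_eq) auto
  then obtain \<phi> where \<phi>: "wf_fm L (\<Gamma> @ \<Gamma>) \<phi>"
    "\<forall>xss\<in>blocks M [\<Gamma>, \<Gamma>]. sat M (concat xss) \<phi> = (xss ! 0 = xss ! 1)"
    by (auto simp: expressible_def)
  have "sat M (xs @ t) \<phi> \<longleftrightarrow> xs = t" if "xs \<in> tuples M \<Gamma>" for xs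
    using \<phi>(2)[rule_format, of "[xs, t]"] that t by (simp add: blocks_Cons)
  then show ?thesis unfolding definable_def
    by (intro exI[of _ \<Gamma>] exI[of _ \<phi>] exI[of _ t]) (use t \<phi>(1) in auto)
qed

lemma fixed_definable:
  assumes "small_set \<kappa> M B" "t \<in> tuples M \<Gamma>" "\<And>\<sigma>. \<sigma> \<in> auts L M B \<Longrightarrow> map \<sigma> t = t"
  shows "definable L M B \<Gamma> {t}"
  using invariant_definable[OF assms(1) definable_singleton[OF assms(2)]] assms(3) by auto

lemma fixed_in_dcl:
  assumes "small_set \<kappa> M B" "y \<in> universe M" "\<And>\<sigma>. \<sigma> \<in> auts L M B \<Longrightarrow> \<sigma> y = y"
  shows "y \<in> dcl L M B"
proof -
  obtain s where s: "y \<in> carr M s" using assms(2) by (auto simp: universe_def)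
  then have "definable L M B [s] {[y]}" using assms by (intro fixed_definable) (auto simp: tuples_Cons)
  then show ?thesis using s by (auto simp: dcl_def)
qed

lemma dcl_definable:
  assumes "small_set \<kappa> M B" "t \<in> tuples M \<Gamma>" "set t \<subseteq> dcl L M B"
  shows "definable L M B \<Gamma> {t}"
  using fixed_definable[OF assms(1,2)] fixed_dcl assms(3) by (metis map_idI subsetD)

text \<open>With \<open>d\<close> as a block of its own, the definition can afterwards be varied in \<open>d\<close>.\<close>

lemma definable_split:
  assumes "definable L M (set d \<union> C) \<Gamma> X" "d \<in> tuples M \<Xi>"
  shows "\<exists>\<Delta> c \<phi>. wf_fm L (\<Gamma> @ \<Xi> @ \<Delta>) \<phi> \<and> c \<in> tuples M \<Delta> \<and> set c \<subseteq> C \<and>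
    X = {xs \<in> tuples M \<Gamma>. sat M (xs @ d @ c) \<phi>}"
proof -
  obtain \<Delta>0 \<phi>0 bs where 1: "wf_fm L (\<Gamma> @ \<Delta>0) \<phi>0" "bs \<in> tuples M \<Delta>0" "set bs \<subseteq> set d \<union> C"
      "X = {xs \<in> tuples M \<Gamma>. sat M (xs @ bs) \<phi>0}"
    using assms(1) unfolding definable_def by (elim exE conjE)
  define c where "c = filter (\<lambda>b. b \<in> C) bs"
  have "set c \<subseteq> universe M" using tuples_universe[OF 1(2)] by (auto simp: c_def)
  then obtain \<Delta> where c: "c \<in> tuples M \<Delta>" using universe_tuples by blast
  have "set bs \<subseteq> set (d @ c)" using 1(3) by (auto simp: c_def)
  then obtain \<phi> where "wf_fm L (\<Gamma> @ \<Xi> @ \<Delta>) \<phi>"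
    "\<forall>xs \<in> tuples M \<Gamma>. sat M (xs @ d @ c) \<phi> \<longleftrightarrow> sat M (xs @ bs) \<phi>0"
    using reparametrize[OF struct 1(1,2) tuples_append[OF assms(2) c]] by blast
  moreover have "set c \<subseteq> C" by (auto simp: c_def)
  ultimately show ?thesis using c 1(4) by blast
qed

end

section \<open>Finite combinatorics: Ramsey, trees and ladders\<close>

lemma ex_strict_mono_enum:
  fixes A :: "nat set"
  assumes "finite A" "k \<le> card A"
  obtains f where "strict_mono_on {..<k} f" "f ` {..<k} \<subseteq> A"
proof
  let ?f = "\<lambda>i. sorted_list_of_set A ! i"
  have l: "length (sorted_list_of_set A) = card A" by simp
  have "sorted_wrt (<) (sorted_list_of_set A)" by simp
  then show "strict_mono_on {..<k} ?f"
    using assms(2) by (auto intro!: strict_mono_onI simp: sorted_wrt_iff_nth_less)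
  show "?f ` {..<k} \<subseteq> A" using assms nth_mem[of _ "sorted_list_of_set A"] l by auto
qed

text \<open>
  Ramsey's theorem for colourings of increasing sequences of indices, with any finite set of
  colours; \<open>h\<close> enumerates a homogeneous set.
\<close>

lemma ramsey_sequences:
  fixes m n :: nat
  assumes "finite K"
  shows "\<exists>N. \<forall>col :: nat list \<Rightarrow> 'c.
    (\<forall>is. length is = n \<and> sorted_wrt (<) is \<and> set is \<subseteq> {..<N} \<longrightarrow> col is \<in> K) \<longrightarrow>
    (\<exists>h k. strict_mono_on {..<m} h \<and> h ` {..<m} \<subseteq> {..<N} \<and>
      (\<forall>is. length is = n \<and> sorted_wrt (<) is \<and> set is \<subseteq> {..<m} \<longrightarrow> col (map h is) = k))"
proof -
  obtain e where e: "bij_betw e K {0..<card K}" using ex_bij_betw_finite_nat[OF assms] by blast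
  let ?qs = "replicate (card K) m"
  obtain N :: nat where N: "partn_lst {..<N} ?qs n" using ramsey_full[of ?qs n] by blast
  show ?thesis
  proof (intro exI[of _ N] allI impI)
    fix col :: "nat list \<Rightarrow> 'c"
    assume col: "\<forall>is. length is = n \<and> sorted_wrt (<) is \<and> set is \<subseteq> {..<N} \<longrightarrow> col is \<in> K"
    define f where "f X = e (col (sorted_list_of_set X))" for X
    have "f \<in> nsets {..<N} n \<rightarrow> {..<length ?qs}"
    proof
      fix X assume "X \<in> nsets {..<N} n"
      then have "col (sorted_list_of_set X) \<in> K" using col by (auto simp: nsets_def)
      then show "f X \<in> {..<length ?qs}" using e by (auto simp: f_def bij_betw_def)
    qed
    then obtain i H where i: "i < card K" "H \<in> nsets {..<N} m" "f ` nsets H n \<subseteq> {i}"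
      using N unfolding partn_lst_def monochromatic_def by fastforce
    then have H: "H \<subseteq> {..<N}" "finite H" "card H = m" by (auto simp: nsets_def)
    obtain h where h: "strict_mono_on {..<m} h" "h ` {..<m} \<subseteq> H"
      using ex_strict_mono_enum[OF H(2)] H(3) by blast
    have "col (map h is) = inv_into K e i"
      if "length is = n" "sorted_wrt (<) is" "set is \<subseteq> {..<m}" for "is"
    proof -
      have s: "sorted_wrt (<) (map h is)"
        using that(2,3) h(1) unfolding sorted_wrt_map
        by (auto elim!: sorted_wrt_mono_rel[rotated] simp: strict_mono_on_def)
      then have d: "distinct (map h is)" "sorted (map h is)"
        by (auto simp: strict_sorted_iff simp del: distinct_map)
      have sub: "set (map h is) \<subseteq> H" using that(3) h(2) by auto
      have X: "set (map h is) \<in> nsets H n"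
        using sub d(1) that(1) H(2) distinct_card[OF d(1)] by (simp add: nsets_def)
      have "sorted_list_of_set (set (map h is)) = map h is"
        using d by (metis sorted_list_of_set.idem_if_sorted_distinct)
      moreover have "f (set (map h is)) = i" using X i(3) by blast
      ultimately have "e (col (map h is)) = i" by (simp add: f_def)
      moreover have "col (map h is) \<in> K" using col that(1) s sub H(1) by auto
      ultimately show ?thesis using e by (metis bij_betw_def inv_into_f_f)
    qed
    then show "\<exists>h k. strict_mono_on {..<m} h \<and> h ` {..<m} \<subseteq> {..<N} \<and>
      (\<forall>is. length is = n \<and> sorted_wrt (<) is \<and> set is \<subseteq> {..<m} \<longrightarrow> col (map h is) = k)"
      using h H(1) by blast
  qed
qed

text \<open>
  A binary tree of height \<open>d\<close> with nodes in \<open>P\<close>, all of whose branches are realized in \<open>W\<close>. The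
  recursion replaces the tree by its root and the sets of realizations of the two subtrees.
\<close>

primrec shattered :: "('a \<Rightarrow> 'b \<Rightarrow> bool) \<Rightarrow> 'a set \<Rightarrow> nat \<Rightarrow> 'b set \<Rightarrow> bool" where
  "shattered r P 0 W \<longleftrightarrow> W \<noteq> {}"
| "shattered r P (Suc d) W \<longleftrightarrow>
     (\<exists>x \<in> P. shattered r P d {z \<in> W. r x z} \<and> shattered r P d {z \<in> W. \<not> r x z})"

lemma shattered_mono: "shattered r P d W \<Longrightarrow> W \<subseteq> W' \<Longrightarrow> shattered r P d W'"
proof (induction d arbitrary: W W')
  case (Suc d)
  then obtain x where x: "x \<in> P" "shattered r P d {z \<in> W. r x z}" "shattered r P d {z \<in> W. \<not> r x z}"
    by auto
  have "{z \<in> W. r x z} \<subseteq> {z \<in> W'. r x z}" "{z \<in> W. \<not> r x z} \<subseteq> {z \<in> W'. \<not> r x z}"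
    using Suc(3) by auto
  then show ?case using x Suc(1) by (auto intro!: bexI[of _ x])
qed auto

lemma shattered_nonempty: "shattered r P d W \<Longrightarrow> W \<noteq> {}"
proof (induction d arbitrary: W)
  case (Suc d)
  then obtain x where "shattered r P d {z \<in> W. r x z}" by auto
  then show ?case using Suc(1) by blast
qed auto

text \<open>The Ramsey property of trees: either both subtrees keep their height in the colour of the
  root, or one of them already has enough height in the other colour.\<close>

lemma shattered_colouring:
  "shattered r (P \<union> Q) (p + q) W \<Longrightarrow> shattered r P p W \<or> shattered r Q q W"
proof (induction "p + q" arbitrary: p q W)
  case 0
  then show ?case by simp
next
  case (Suc d)
  note IH = Suc(1)
  have "shattered r (P \<union> Q) (Suc d) W" using Suc(2,3) by simp
  then obtain x where x: "x \<in> P \<union> Q" "shattered r (P \<union> Q) d {z \<in> W. r x z}"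
    "shattered r (P \<union> Q) d {z \<in> W. \<not> r x z}" by auto
  have W: "W \<noteq> {}" using Suc(3) by (rule shattered_nonempty)
  have sub: "{z \<in> W. r x z} \<subseteq> W" "{z \<in> W. \<not> r x z} \<subseteq> W" by auto
  show ?case
  proof (cases "x \<in> P")
    case True
    show ?thesis
    proof (cases p)
      case 0
      then show ?thesis using W by simp
    next
      case (Suc p')
      then have d: "d = p' + q" using \<open>Suc d = p + q\<close> by simp
      have "shattered r P p' {z \<in> W. r x z} \<or> shattered r Q q {z \<in> W. r x z}"
        "shattered r P p' {z \<in> W. \<not> r x z} \<or> shattered r Q q {z \<in> W. \<not> r x z}"
        using IH[OF d] x(2,3) unfolding d by blast+
      then show ?thesis
        using True shattered_mono[OF _ sub(1), of r Q q] shattered_mono[OF _ sub(2), of r Q q]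
        unfolding Suc shattered.simps by blast
    qed
  next
    case False
    then have "x \<in> Q" using x(1) by blast
    show ?thesis
    proof (cases q)
      case 0
      then show ?thesis using W by simp
    next
      case (Suc q')
      then have d: "d = p + q'" using \<open>Suc d = p + q\<close> by simp
      have "shattered r P p {z \<in> W. r x z} \<or> shattered r Q q' {z \<in> W. r x z}"
        "shattered r P p {z \<in> W. \<not> r x z} \<or> shattered r Q q' {z \<in> W. \<not> r x z}"
        using IH[OF d] x(2,3) unfolding d by blast+
      then show ?thesis
        using \<open>x \<in> Q\<close> shattered_mono[OF _ sub(1), of r P p] shattered_mono[OF _ sub(2), of r P p]
        unfolding Suc shattered.simps by blast
    qed
  qed
qed

text \<open>
  Take any branch \<open>z\<close> of the tree and colour the nodes by their relation to \<open>z\<close>: half of the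
  height survives in one colour. Descending from the root of that subtree to the side that \<open>z\<close> is
  not on yields the next pair.
\<close>

lemma tree_half_ladder:
  fixes m :: nat
  shows "\<exists>d. \<forall>P W. shattered r P d W \<longrightarrow> (\<exists>x z b. (\<forall>i<m. x i \<in> P \<and> z i \<in> W) \<and>
     (\<forall>i<m. \<forall>j<m. r (x i) (z j) \<longleftrightarrow> (if i < j then \<not> b i else b j)))"
proof (induction m)
  case 0
  then show ?case by auto
next
  case (Suc m)
  then obtain d where d: "\<And>P W. shattered r P d W \<Longrightarrow> \<exists>x z b. (\<forall>i<m. x i \<in> P \<and> z i \<in> W) \<and>
     (\<forall>i<m. \<forall>j<m. r (x i) (z j) \<longleftrightarrow> (if i < j then \<not> b i else b j))"
    by metis
  show ?case
  proof (intro exI[of _ "Suc d + Suc d"] allI impI)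
    fix P W assume sh: "shattered r P (Suc d + Suc d) W"
    then obtain z0 where z0: "z0 \<in> W" using shattered_nonempty by blast
    have P: "{x \<in> P. r x z0 = True} \<union> {x \<in> P. r x z0 = False} = P" by auto
    have "shattered r {x \<in> P. r x z0 = True} (Suc d) W \<or> shattered r {x \<in> P. r x z0 = False} (Suc d) W"
      by (rule shattered_colouring) (simp only: P sh)
    then obtain b0 where "shattered r {x \<in> P. r x z0 = b0} (Suc d) W" by blast
    then obtain x0 where x0: "x0 \<in> P" "r x0 z0 = b0"
      "shattered r {x \<in> P. r x z0 = b0} d {z \<in> W. r x0 z = (\<not> b0)}"
      by (cases b0) auto
    obtain x z b where xz: "\<forall>i<m. x i \<in> {x \<in> P. r x z0 = b0} \<and> z i \<in> {z \<in> W. r x0 z = (\<not> b0)}"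
      "\<forall>i<m. \<forall>j<m. r (x i) (z j) \<longleftrightarrow> (if i < j then \<not> b i else b j)"
      using d[OF x0(3)] by (elim exE conjE)
    define x' where "x' i = (case i of 0 \<Rightarrow> x0 | Suc j \<Rightarrow> x j)" for i
    define z' where "z' i = (case i of 0 \<Rightarrow> z0 | Suc j \<Rightarrow> z j)" for i
    define b' where "b' i = (case i of 0 \<Rightarrow> b0 | Suc j \<Rightarrow> b j)" for i
    have "x' i \<in> P \<and> z' i \<in> W" if "i < Suc m" for i
      using that xz(1) x0(1) z0 by (cases i) (auto simp: x'_def z'_def)
    moreover have "r (x' i) (z' j) \<longleftrightarrow> (if i < j then \<not> b' i else b' j)" if "i < Suc m" "j < Suc m" for i j
      using that xz x0(2) by (cases i; cases j) (auto simp: x'_def z'_def b'_def)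
    ultimately show "\<exists>x z b. (\<forall>i<Suc m. x i \<in> P \<and> z i \<in> W) \<and>
     (\<forall>i<Suc m. \<forall>j<Suc m. r (x i) (z j) \<longleftrightarrow> (if i < j then \<not> b i else b j))" by blast
  qed
qed

definition ladder :: "('a \<Rightarrow> 'b \<Rightarrow> bool) \<Rightarrow> 'a set \<Rightarrow> 'b set \<Rightarrow> nat \<Rightarrow> bool" where
  "ladder r P W m \<longleftrightarrow>
     (\<exists>x z. (\<forall>i<m. x i \<in> P \<and> z i \<in> W) \<and> (\<forall>i<m. \<forall>j<m. r (x i) (z j) \<longleftrightarrow> i < j))"

lemma ladder_le: "ladder r P W m \<Longrightarrow> k \<le> m \<Longrightarrow> ladder r P W k"
proof -
  assume "ladder r P W m" and k: "k \<le> m"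
  then obtain x z where "\<forall>i<m. x i \<in> P \<and> z i \<in> W" "\<forall>i<m. \<forall>j<m. r (x i) (z j) \<longleftrightarrow> i < j"
    unfolding ladder_def by (elim exE conjE)
  then show ?thesis unfolding ladder_def using k
    by (intro exI[of _ x] exI[of _ z]) simp
qed

text \<open>Half of the bits \<open>b\<close> agree, and on the corresponding indices the relation is a ladder.\<close>

lemma tree_ladder:
  "\<exists>d. \<forall>P W. shattered r P d W \<longrightarrow> ladder r P W m \<or> ladder (\<lambda>x z. \<not> r x z) P W m"
proof -
  obtain d where d: "\<And>P W. shattered r P d W \<Longrightarrow> \<exists>x z b. (\<forall>i<2*m. x i \<in> P \<and> z i \<in> W) \<and>
     (\<forall>i<2*m. \<forall>j<2*m. r (x i) (z j) \<longleftrightarrow> (if i < j then \<not> b i else b j))"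
    using tree_half_ladder[of r "2 * m"] by metis
  show ?thesis
  proof (intro exI[of _ d] allI impI)
    fix P W assume "shattered r P d W"
    obtain x z b where xz: "\<forall>i<2*m. x i \<in> P \<and> z i \<in> W"
      "\<forall>i<2*m. \<forall>j<2*m. r (x i) (z j) \<longleftrightarrow> (if i < j then \<not> b i else b j)"
      using d[OF \<open>shattered r P d W\<close>] by (elim exE conjE)
    have "card {i. i < 2 * m \<and> b i} + card {i. i < 2 * m \<and> \<not> b i} = card ({i. i < 2 * m \<and> b i} \<union> {i. i < 2 * m \<and> \<not> b i})"
      by (intro card_Un_disjoint[symmetric]) auto
    also have "{i. i < 2 * m \<and> b i} \<union> {i. i < 2 * m \<and> \<not> b i} = {..<2 * m}" by auto
    finally have "m \<le> card {i. i < 2 * m \<and> b i = True} \<or> m \<le> card {i. i < 2 * m \<and> b i = False}" by auto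
    then obtain c where c: "m \<le> card {i. i < 2 * m \<and> b i = c}" by blast
    obtain f where f: "strict_mono_on {..<m} f" "f ` {..<m} \<subseteq> {i. i < 2 * m \<and> b i = c}"
      using ex_strict_mono_enum[OF _ c] by auto
    have lt: "f i < f j \<longleftrightarrow> i < j" if "i < m" "j < m" for i j
      using strict_mono_on_less[OF f(1)] that by auto
    have fm: "f i < 2 * m \<and> b (f i) = c" if "i < m" for i using f(2) that by auto
    have "r (x (f i)) (z (f j)) \<longleftrightarrow> (if i < j then \<not> c else c)" if "i < m" "j < m" for i j
      using xz(2) fm[OF that(1)] fm[OF that(2)] lt[OF that] by simp
    moreover have "x (f i) \<in> P \<and> z (f i) \<in> W" if "i < m" for i using xz(1) fm[OF that] by blast
    ultimately have "(\<forall>i<m. x (f i) \<in> P \<and> z (f i) \<in> W) \<and>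
        (\<forall>i<m. \<forall>j<m. r (x (f i)) (z (f j)) = (if i < j then \<not> c else c))" by blast
    then show "ladder r P W m \<or> ladder (\<lambda>x z. \<not> r x z) P W m"
      unfolding ladder_def
      by (cases c) (rule disjI2 disjI1, rule exI[of _ "\<lambda>i. x (f i)"], rule exI[of _ "\<lambda>i. z (f i)"], simp)+
  qed
qed

section \<open>Formulas on a stable set have bounded ladders\<close>

lemma pow_sorts_add: "pow_sorts \<Gamma> (k + l) = pow_sorts \<Gamma> k @ pow_sorts \<Gamma> l"
  by (simp add: pow_sorts_def replicate_add)

lemma pow_sorts_mult: "concat (replicate n (pow_sorts \<Gamma> k)) = pow_sorts \<Gamma> (n * k)"
  by (induction n) (simp_all add: pow_sorts_add pow_sorts_def[of _ 0])

lemma pow_set_append: "x \<in> pow_set S k \<Longrightarrow> y \<in> pow_set S l \<Longrightarrow> x @ y \<in> pow_set S (k + l)"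
  unfolding pow_set_def mem_Collect_eq
  by (elim exE conjE, rename_tac us vs, rule_tac x = "us @ vs" in exI) auto

lemma pow_set_concat: "set us \<subseteq> pow_set S k \<Longrightarrow> concat us \<in> pow_set S (length us * k)"
proof (induction us)
  case Nil
  then show ?case by (simp add: pow_set_def)
next
  case (Cons u us)
  then show ?case by (simp add: pow_set_append)
qed

lemma pow_set_tuples: "S \<subseteq> tuples M \<Gamma> \<Longrightarrow> pow_set S k \<subseteq> tuples M (pow_sorts \<Gamma> k)"
proof
  fix x assume S: "S \<subseteq> tuples M \<Gamma>" and "x \<in> pow_set S k"
  then obtain us where "x = concat us" "length us = k" "set us \<subseteq> S" by (auto simp: pow_set_def)
  then have "us \<in> blocks M (replicate k \<Gamma>)" using S by (auto simp: blocks_iff dest!: nth_mem)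
  then show "x \<in> tuples M (pow_sorts \<Gamma> k)"
    using blocks_concat \<open>x = concat us\<close> by (metis pow_sorts_def)
qed

lemma definable_pow_set:
  assumes "definable L M C \<Gamma> S"
  shows "definable L M C (pow_sorts \<Gamma> k) (pow_set S k)"
proof -
  obtain \<Delta> \<phi> c where S: "wf_fm L (\<Gamma> @ \<Delta>) \<phi>" "c \<in> tuples M \<Delta>" "set c \<subseteq> C"
      "S = {xs \<in> tuples M \<Gamma>. sat M (xs @ c) \<phi>}"
    using assms unfolding definable_def by (elim exE conjE)
  let ?\<Theta> = "replicate k \<Gamma> @ [\<Delta>]"
  have "expressible L M ?\<Theta> (\<lambda>xss. \<forall>i<k. sat M (concat (map ((!) xss) [i, k])) \<phi>)"
    by (intro expressible_all_less expressible_fm) (use S(1) in \<open>auto simp: nth_append\<close>)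
  then obtain \<psi> where \<psi>: "wf_fm L (concat ?\<Theta>) \<psi>"
    "\<forall>xss\<in>blocks M ?\<Theta>. sat M (concat xss) \<psi> = (\<forall>i<k. sat M (concat (map ((!) xss) [i, k])) \<phi>)"
    unfolding expressible_def by (elim exE conjE)
  have sat: "sat M (concat us @ c) \<psi> \<longleftrightarrow> set us \<subseteq> S" if us: "us \<in> blocks M (replicate k \<Gamma>)" for us
  proof -
    have l: "length us = k" using us by (simp add: blocks_iff)
    have "us @ [c] \<in> blocks M ?\<Theta>" using us S(2) by (auto simp: blocks_iff nth_append less_Suc_eq)
    from \<psi>(2)[rule_format, OF this] have "sat M (concat us @ c) \<psi> \<longleftrightarrow> (\<forall>i<k. sat M (us ! i @ c) \<phi>)"
      using l by (simp add: nth_append)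
    also have "\<dots> \<longleftrightarrow> (\<forall>i<k. us ! i \<in> S)" using us S(4) by (auto simp: blocks_iff)
    also have "\<dots> \<longleftrightarrow> set us \<subseteq> S" using l by (metis in_set_conv_nth subset_code(1))
    finally show ?thesis .
  qed
  have "pow_set S k = {xs \<in> tuples M (pow_sorts \<Gamma> k). sat M (xs @ c) \<psi>}"
  proof (intro set_eqI iffI)
    fix x assume "x \<in> pow_set S k"
    then obtain us where u: "x = concat us" "length us = k" "set us \<subseteq> S" by (auto simp: pow_set_def)
    then have "us \<in> blocks M (replicate k \<Gamma>)" using S(4) by (auto simp: blocks_iff dest!: nth_mem)
    then show "x \<in> {xs \<in> tuples M (pow_sorts \<Gamma> k). sat M (xs @ c) \<psi>}"
      using sat u blocks_concat by (metis (mono_tags, lifting) mem_Collect_eq pow_sorts_def)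
  next
    fix x assume x: "x \<in> {xs \<in> tuples M (pow_sorts \<Gamma> k). sat M (xs @ c) \<psi>}"
    then have "x \<in> tuples M (concat (replicate k \<Gamma>))" by (simp add: pow_sorts_def)
    then obtain us where "x = concat us" "us \<in> blocks M (replicate k \<Gamma>)" by (rule tuples_concatE)
    then show "x \<in> pow_set S k" using sat x by (auto simp: pow_set_def blocks_iff)
  qed
  then show ?thesis unfolding definable_def using \<psi>(1) S(2,3)
    by (intro exI[of _ \<Delta>] exI[of _ \<psi>] exI[of _ c]) (simp add: pow_sorts_def)
qed

locale stable_in_NIP = monster L T M \<kappa>
  for L :: "('s, 'f, 'r) lang" and T :: "('s, 'f, 'r) fm set"
    and M :: "('s, 'f, 'r, 'm) struct" and \<kappa> :: "'k rel" +
  fixes C :: "'m set" and \<Gamma> :: "'s list" and S :: "'m list set"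
  assumes EI: "eliminates_imaginaries L M" and NIP: "NIP L M" and small_C: "small_set \<kappa> M C"
    and def_S: "definable L M C \<Gamma> S" and stable_S: "stable_set L M C \<Gamma> S"
begin

lemma S_tuples: "S \<subseteq> tuples M \<Gamma>"
  using def_S by (auto simp: definable_def)

lemmas pow_tuples = subsetD[OF pow_set_tuples[OF S_tuples]]

lemma pow_set_aut:
  assumes "\<sigma> \<in> auts L M C" "x \<in> tuples M (pow_sorts \<Gamma> k)"
  shows "map \<sigma> x \<in> pow_set S k \<longleftrightarrow> x \<in> pow_set S k"
  using definable_invariant[OF struct definable_pow_set[OF def_S] assms] .

lemma pow_set_surj:
  assumes "\<sigma> \<in> auts L M C" "x \<in> pow_set S k"
  shows "\<exists>y \<in> pow_set S k. map \<sigma> y = x"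
proof -
  obtain y where "y \<in> tuples M (pow_sorts \<Gamma> k)" "map \<sigma> y = x"
    using aut_tuples_surj[OF auts_automorphism[OF assms(1)] pow_tuples[OF assms(2)]] by blast
  then show ?thesis using pow_set_aut[OF assms(1)] assms(2) by blast
qed

text \<open>
  A relation between powers of \<open>S\<close> is named by a symbol of the induced language, applied to the
  concatenation of its two arguments.
\<close>

lemma no_ladder_in_S:
  assumes "wf_fm L (pow_sorts \<Gamma> p @ pow_sorts \<Gamma> q) \<rho>"
  shows "\<exists>m. \<not> ladder (\<lambda>u v. sat M (u @ v) \<rho>) (pow_set S p) (pow_set S q) m"
proof (rule ccontr)
  assume "\<nexists>m. \<not> ladder (\<lambda>u v. sat M (u @ v) \<rho>) (pow_set S p) (pow_set S q) m"
  then have lad: "ladder (\<lambda>u v. sat M (u @ v) \<rho>) (pow_set S p) (pow_set S q) m" for m by blast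
  define R where "R = {xs \<in> pow_set S (p + q). sat M xs \<rho>}"
  let ?r = "(p + q, R)"
  let ?\<phi> = "Rel ?r (map Var [0..<p + q]) :: (unit, unit, nat \<times> 'm list set) fm"
  let ?L = "induced_lang L M C \<Gamma> S" and ?M = "induced_struct S"
  have "definable L M C (pow_sorts \<Gamma> (p + q)) {xs \<in> tuples M (pow_sorts \<Gamma> (p + q)). sat M xs \<rho>}"
    unfolding definable_def
    by (intro exI[of _ "[]"] exI[of _ \<rho>]) (use assms in \<open>auto simp: pow_sorts_add\<close>)
  then have "definable L M C (pow_sorts \<Gamma> (p + q)) (tuples M (pow_sorts \<Gamma> (p + q)) \<inter>
      (\<Inter>b\<in>{True, False}. if b then pow_set S (p + q) else {xs \<in> tuples M (pow_sorts \<Gamma> (p + q)). sat M xs \<rho>}))"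
    using definable_pow_set[OF def_S] by (intro definable_finite_Int) auto
  moreover have "tuples M (pow_sorts \<Gamma> (p + q)) \<inter>
      (\<Inter>b\<in>{True, False}. if b then pow_set S (p + q) else {xs \<in> tuples M (pow_sorts \<Gamma> (p + q)). sat M xs \<rho>}) = R"
    using pow_tuples by (auto simp: R_def)
  ultimately have "rel_type ?L ?r = Some (replicate (p + q) ())"
    by (auto simp: induced_lang_def R_def)
  moreover have "has_sort ?L (replicate (p + q) ()) (Var i) ()" if "i < p + q" for i
    using has_sort.intros(1)[of i "replicate (p + q) ()" ?L] that by simp
  ultimately have wf: "wf_fm ?L (replicate p () @ replicate q ()) ?\<phi>"
    by (auto simp: list_all2_conv_all_nth replicate_add[symmetric])
  have tup: "xs \<in> tuples ?M (replicate n ()) \<longleftrightarrow> length xs = n \<and> set xs \<subseteq> S" for xs and n :: nat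
    by (auto simp: tuples_iff induced_struct_def in_set_conv_nth dest: nth_mem)
  have "has_OP ?M (replicate p ()) (replicate q ()) ?\<phi>"
    unfolding has_OP_def
  proof
    fix n :: nat
    obtain u v where uv: "\<forall>i<n. u i \<in> pow_set S p \<and> v i \<in> pow_set S q"
      "\<forall>i<n. \<forall>j<n. sat M (u i @ v j) \<rho> \<longleftrightarrow> i < j"
      using lad[of n] unfolding ladder_def by (elim exE conjE)
    then have "\<forall>i. \<exists>a b. i < n \<longrightarrow> length a = p \<and> set a \<subseteq> S \<and> u i = concat a \<and>
        length b = q \<and> set b \<subseteq> S \<and> v i = concat b"
      unfolding pow_set_def by blast
    then obtain a b where ab: "\<And>i. i < n \<Longrightarrow> length (a i) = p \<and> set (a i) \<subseteq> S \<and> u i = concat (a i) \<and>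
        length (b i) = q \<and> set (b i) \<subseteq> S \<and> v i = concat (b i)"
      by metis
    have "sat ?M (a i @ b j) ?\<phi> \<longleftrightarrow> i < j" if "i < n" "j < n" for i j
    proof -
      have l: "length (a i @ b j) = p + q" using ab[OF that(1)] ab[OF that(2)] by simp
      have "map (val ?M (a i @ b j)) (map Var [0..<p + q]) = a i @ b j"
        using l by (intro nth_equalityI) auto
      then have "sat ?M (a i @ b j) ?\<phi> \<longleftrightarrow> concat (a i @ b j) \<in> R"
        by (simp add: induced_struct_def del: map_map)
      also have "\<dots> \<longleftrightarrow> sat M (u i @ v j) \<rho>"
      proof -
        have "u i @ v j \<in> pow_set S (p + q)" using uv(1) that by (intro pow_set_append) auto
        then show ?thesis using ab[OF that(1)] ab[OF that(2)] by (simp add: R_def)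
      qed
      finally show ?thesis using uv(2) that by blast
    qed
    then show "\<exists>a b. (\<forall>i<n. a i \<in> tuples ?M (replicate p ()) \<and> b i \<in> tuples ?M (replicate q ())) \<and>
        (\<forall>i<n. \<forall>j<n. sat ?M (a i @ b j) ?\<phi> = (i < j))"
      using ab by (intro exI[of _ a] exI[of _ b] conjI allI impI) (auto simp only: tup)
  qed
  then show False using stable_S wf unfolding stable_set_def stable_def by blast
qed


text \<open>
  Now for parameters outside \<open>S\<close>. By Ramsey a long ladder \<open>x\<close> may be taken homogeneous for the
  relations \<open>\<exists>z. \<forall>l<n. \<psi>(x\<^sub>l, z) \<longleftrightarrow> l \<in> I\<close> of \<open>S\<close>. The ladder satisfies those for initial segments \<open>I\<close>.
  If such a relation changed its truth value when two consecutive arguments are swapped, it would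
  order the sequence, against stability of \<open>S\<close>; so all of them hold, which is the independence
  property of \<open>\<psi>\<close>.
\<close>

lemma no_ladder:
  assumes \<psi>: "wf_fm L (pow_sorts \<Gamma> k @ \<Delta>) \<psi>"
  shows "\<exists>m. \<not> ladder (\<lambda>x z. sat M (x @ z) \<psi>) (pow_set S k) (tuples M \<Delta>) m"
proof (rule ccontr)
  assume "\<nexists>m. \<not> ladder (\<lambda>x z. sat M (x @ z) \<psi>) (pow_set S k) (tuples M \<Delta>) m"
  then have lad: "ladder (\<lambda>x z. sat M (x @ z) \<psi>) (pow_set S k) (tuples M \<Delta>) m" for m by blast
  have "has_IP M (pow_sorts \<Gamma> k) \<Delta> \<psi>"
    unfolding has_IP_def
  proof
    fix n :: nat
    let ?P = "pow_sorts \<Gamma> k"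
    define R where "R I f \<longleftrightarrow> (\<exists>z \<in> tuples M \<Delta>. \<forall>l<n. sat M (f l @ z) \<psi> \<longleftrightarrow> l \<in> I)"
      for I :: "nat set" and f :: "nat \<Rightarrow> 'm list"
    have R_cong: "R I f = R I g" if "\<And>l. l < n \<Longrightarrow> f l = g l" for I f g
      using that by (auto simp: R_def)
    \<comment> \<open>For the swap at \<open>i\<close>, argument \<open>Suc i\<close> is read from an extra last block; block \<open>Suc i\<close> is a dummy.\<close>
    define slot where "slot i l = (if l = Suc i then n else l)" for i l
    have "\<exists>m. \<not> ladder (\<lambda>us v. R I (\<lambda>l. (us @ [v]) ! slot i l)) {us. length us = n \<and> set us \<subseteq> pow_set S k}
        (pow_set S k) m" for I i
    proof -
      let ?\<Theta> = "replicate (Suc n) ?P"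
      have "expressible L M ?\<Theta> (\<lambda>xss. \<exists>z \<in> tuples M \<Delta>. \<forall>l<n.
          sat M (concat (map ((!) (z # xss)) [Suc (slot i l), 0])) \<psi> \<longleftrightarrow> l \<in> I)"
        by (intro expressible_ex expressible_all_less expressible_iff expressible_const expressible_fm)
          (use \<psi> in \<open>auto simp: slot_def simp del: replicate_Suc\<close>)
      then obtain \<rho> where \<rho>: "wf_fm L (concat ?\<Theta>) \<rho>"
        "\<forall>xss\<in>blocks M ?\<Theta>. sat M (concat xss) \<rho> = (\<exists>z \<in> tuples M \<Delta>. \<forall>l<n.
          sat M (concat (map ((!) (z # xss)) [Suc (slot i l), 0])) \<psi> \<longleftrightarrow> l \<in> I)"
        unfolding expressible_def by (elim exE conjE)
      have "concat ?\<Theta> = pow_sorts \<Gamma> (n * k) @ pow_sorts \<Gamma> k"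
        by (simp add: replicate_append_same[symmetric] pow_sorts_mult del: replicate_append_same)
      then obtain m where m: "\<not> ladder (\<lambda>u v. sat M (u @ v) \<rho>) (pow_set S (n * k)) (pow_set S k) m"
        using no_ladder_in_S \<rho>(1) by metis
      have "\<not> ladder (\<lambda>us v. R I (\<lambda>l. (us @ [v]) ! slot i l)) {us. length us = n \<and> set us \<subseteq> pow_set S k}
        (pow_set S k) m"
      proof
        assume "ladder (\<lambda>us v. R I (\<lambda>l. (us @ [v]) ! slot i l)) {us. length us = n \<and> set us \<subseteq> pow_set S k}
          (pow_set S k) m"
        then obtain u v where uv: "\<forall>a<m. u a \<in> {us. length us = n \<and> set us \<subseteq> pow_set S k} \<and> v a \<in> pow_set S k"
          "\<forall>a<m. \<forall>b<m. R I (\<lambda>l. (u a @ [v b]) ! slot i l) \<longleftrightarrow> a < b"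
          unfolding ladder_def by (elim exE conjE)
        have "sat M (concat (u a) @ v b) \<rho> \<longleftrightarrow> a < b" if "a < m" "b < m" for a b
        proof -
          have ab: "length (u a) = n" "set (u a) \<subseteq> pow_set S k" "v b \<in> pow_set S k" using uv(1) that by auto
          have "u a @ [v b] \<in> blocks M ?\<Theta>"
            using ab pow_tuples by (auto simp: blocks_iff nth_append less_Suc_eq simp del: replicate_Suc dest!: nth_mem)
          from \<rho>(2)[rule_format, OF this] show ?thesis using uv(2) that by (simp add: R_def)
        qed
        moreover have "concat (u a) \<in> pow_set S (n * k) \<and> v a \<in> pow_set S k" if "a < m" for a
          using uv(1) that pow_set_concat[of "u a" S k] by auto
        ultimately have "ladder (\<lambda>u v. sat M (u @ v) \<rho>) (pow_set S (n * k)) (pow_set S k) m"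
          unfolding ladder_def by (intro exI[of _ "\<lambda>a. concat (u a)"] exI[of _ v]) simp
        then show False using m by simp
      qed
      then show ?thesis by blast
    qed
    note ex_bound = this
    define bound where "bound I i = (SOME m. \<not> ladder (\<lambda>us v. R I (\<lambda>l. (us @ [v]) ! slot i l))
        {us. length us = n \<and> set us \<subseteq> pow_set S k} (pow_set S k) m)" for I i
    have bound: "\<not> ladder (\<lambda>us v. R I (\<lambda>l. (us @ [v]) ! slot i l))
        {us. length us = n \<and> set us \<subseteq> pow_set S k} (pow_set S k) (bound I i)" for I i
      unfolding bound_def by (rule someI_ex) (rule ex_bound)
    define m where "m = Max ((\<lambda>(I, i). bound I i) ` (Pow {..<n} \<times> {..n}))"
    have m: "\<not> ladder (\<lambda>us v. R I (\<lambda>l. (us @ [v]) ! slot i l))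
        {us. length us = n \<and> set us \<subseteq> pow_set S k} (pow_set S k) m" if "I \<subseteq> {..<n}" "i < n" for I i
    proof -
      have "bound I i \<le> m" unfolding m_def by (rule Max_ge) (use that in force)+
      then show ?thesis using bound ladder_le by blast
    qed
    define K where "K = Pow (Pow {..<n})"
    have "finite K" by (simp add: K_def)
    from ramsey_sequences[OF this, of n "2 * m + 2 * n + 1"]
    obtain N where N: "\<And>col :: nat list \<Rightarrow> nat set set. \<forall>is. length is = n \<and> sorted_wrt (<) is \<and> set is \<subseteq> {..<N} \<longrightarrow> col is \<in> K \<Longrightarrow>
      \<exists>h k. strict_mono_on {..<2 * m + 2 * n + 1} h \<and> h ` {..<2 * m + 2 * n + 1} \<subseteq> {..<N} \<and>
      (\<forall>is. length is = n \<and> sorted_wrt (<) is \<and> set is \<subseteq> {..<2 * m + 2 * n + 1} \<longrightarrow> col (map h is) = k)"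
      by blast
    obtain x z where xz: "\<forall>i<N. x i \<in> pow_set S k \<and> z i \<in> tuples M \<Delta>"
      "\<forall>i<N. \<forall>j<N. sat M (x i @ z j) \<psi> \<longleftrightarrow> i < j"
      using lad[of N] unfolding ladder_def by (elim exE conjE)
    obtain h G where h: "strict_mono_on {..<2 * m + 2 * n + 1} h" "h ` {..<2 * m + 2 * n + 1} \<subseteq> {..<N}"
      and G: "\<forall>is. length is = n \<and> sorted_wrt (<) is \<and> set is \<subseteq> {..<2 * m + 2 * n + 1} \<longrightarrow>
        {I. I \<subseteq> {..<n} \<and> R I (\<lambda>l. x (map h is ! l))} = G"
      using N[of "\<lambda>is. {I. I \<subseteq> {..<n} \<and> R I (\<lambda>l. x (is ! l))}"] unfolding K_def by blast
    define y where "y p = x (h p)" for p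
    have yS: "y p \<in> pow_set S k" if "p < 2 * m + 2 * n + 1" for p
      using xz(1) h(2) that by (auto simp: y_def)
    have G': "R I (\<lambda>l. y (f l)) \<longleftrightarrow> I \<in> G"
      if "I \<subseteq> {..<n}" "\<And>l. l < n \<Longrightarrow> f l < 2 * m + 2 * n + 1"
        "\<And>l l'. l < l' \<Longrightarrow> l' < n \<Longrightarrow> f l < f l'" for I f
    proof -
      let ?is = "map f [0..<n]"
      have "length ?is = n" "sorted_wrt (<) ?is" "set ?is \<subseteq> {..<2 * m + 2 * n + 1}"
        using that by (auto simp: sorted_wrt_iff_nth_less)
      then have "I \<in> G \<longleftrightarrow> R I (\<lambda>l. x (map h ?is ! l))" using G that(1) by blast
      also have "\<dots> = R I (\<lambda>l. y (f l))" by (rule R_cong) (simp add: y_def)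
      finally show ?thesis by blast
    qed
    have all: "I \<in> G" if "I \<subseteq> {..<n}" for I
      using that
    proof (induction "\<Sum>I" arbitrary: I rule: less_induct)
      case less
      have finI: "finite I" using less(2) finite_subset by blast
      show ?case
      proof (cases "\<forall>i. Suc i \<in> I \<longrightarrow> i \<in> I")
        case True
        define t where "t = (LEAST t. t \<notin> I)"
        have tI: "t \<notin> I" unfolding t_def
          by (rule LeastI_ex) (use finI in \<open>metis ex_new_if_finite infinite_UNIV_nat\<close>)
        have below: "l \<in> I" if "l < t" for l using that not_less_Least[of l "\<lambda>t. t \<notin> I"] by (auto simp: t_def)
        have "t + d \<notin> I" for d using tI True by (induction d) auto
        then have It: "l \<in> I \<longleftrightarrow> l < t" for l using below by (metis le_add_diff_inverse not_le)
        have tn: "t \<le> n" using less(2) below by (metis lessThan_iff linorder_not_less order_less_irrefl subsetD)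
        have hl: "h l < N" if "l < 2 * m + 2 * n + 1" for l using h(2) that by auto
        have "sat M (y l @ z (h t)) \<psi> \<longleftrightarrow> l \<in> I" if "l < n" for l
        proof -
          have "sat M (y l @ z (h t)) \<psi> \<longleftrightarrow> h l < h t" using xz(2) hl that tn by (simp add: y_def)
          also have "\<dots> \<longleftrightarrow> l < t" using strict_mono_on_less[OF h(1)] that tn by simp
          finally show ?thesis using It by simp
        qed
        then have "R I y" unfolding R_def using xz(1) hl[of t] tn by (intro bexI[of _ "z (h t)"]) auto
        then show ?thesis using G'[of I "\<lambda>l. l"] less(2) by simp
      next
        case False
        then obtain i where i: "Suc i \<in> I" "i \<notin> I" by blast
        have n: "Suc i < n" using i less(2) by auto
        define I' where "I' = insert i (I - {Suc i})"
        have I'n: "I' \<subseteq> {..<n}" using less(2) n by (auto simp: I'_def)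
        have "\<Sum>I' = i + (\<Sum>I - Suc i)"
          unfolding I'_def using finI i by (subst sum.insert) (auto simp: sum_diff1_nat)
        moreover have "\<Sum>I \<ge> Suc i" using finI i(1) by (meson member_le_sum le0)
        ultimately have I'G: "I' \<in> G" using less(1)[of I'] I'n by simp
        show ?thesis
        proof (rule ccontr)
          assume IG: "I \<notin> G"
          \<comment> \<open>The \<open>2 * m\<close> indices from \<open>i\<close> on are left for the two swapped arguments.\<close>
          define J where "J p q l = (if l < i then l else if l = i then p else if l = Suc i then q else i + 2 * m + l)"
            for p q l :: nat
          have J: "R I0 (\<lambda>l. y (J p q l)) \<longleftrightarrow> I0 \<in> G"
            if "I0 \<subseteq> {..<n}" "p < q" "i \<le> p" "q < i + 2 * m" for I0 p q
            by (rule G') (use that n in \<open>auto simp: J_def\<close>)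
          have swap: "R I' (\<lambda>l. y (J p q l)) = R I (\<lambda>l. y (J q p l))" for p q
          proof -
            have "(\<forall>l<n. sat M (y (J p q l) @ z) \<psi> \<longleftrightarrow> l \<in> I') \<longleftrightarrow>
              (\<forall>l<n. sat M (y (J q p l) @ z) \<psi> \<longleftrightarrow> l \<in> I)" (is "?A \<longleftrightarrow> ?B") for z
            proof -
              define tr where "tr l = (if l = i then Suc i else if l = Suc i then i else l)" for l
              have tr: "tr l < n \<longleftrightarrow> l < n" "J q p (tr l) = J p q l" "tr l \<in> I \<longleftrightarrow> l \<in> I'" "tr (tr l) = l" for l
                using n i by (auto simp: tr_def J_def I'_def)
              have "?B \<longleftrightarrow> (\<forall>l<n. sat M (y (J q p (tr l)) @ z) \<psi> \<longleftrightarrow> tr l \<in> I)"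
                by (metis tr(1,4))
              then show ?thesis using tr by simp
            qed
            then show ?thesis unfolding R_def by blast
          qed
          let ?u = "\<lambda>a. map (\<lambda>l. y (J (i + 2 * a + 1) 0 l)) [0..<n]"
          let ?v = "\<lambda>b. y (i + 2 * b)"
          have "ladder (\<lambda>us v. R I' (\<lambda>l. (us @ [v]) ! slot i l))
              {us. length us = n \<and> set us \<subseteq> pow_set S k} (pow_set S k) m"
            unfolding ladder_def
          proof (intro exI[of _ ?u] exI[of _ ?v] conjI allI impI)
            fix a assume a: "a < m"
            have "J (i + 2 * a + 1) 0 l < 2 * m + 2 * n + 1" if "l < n" for l
              using that a n by (auto simp: J_def)
            then show "?u a \<in> {us. length us = n \<and> set us \<subseteq> pow_set S k}" using yS by auto
            show "?v a \<in> pow_set S k" using a n by (intro yS) simp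
            fix b assume b: "b < m"
            have "R I' (\<lambda>l. (?u a @ [?v b]) ! slot i l) = R I' (\<lambda>l. y (J (i + 2 * a + 1) (i + 2 * b) l))"
              by (rule R_cong) (auto simp: slot_def nth_append J_def)
            also have "\<dots> \<longleftrightarrow> a < b"
            proof (cases "a < b")
              case True
              then show ?thesis using J[OF I'n, of "i + 2 * a + 1" "i + 2 * b"] I'G b by simp
            next
              case False
              then show ?thesis
                using J[OF less(2), of "i + 2 * b" "i + 2 * a + 1"] IG a swap by simp
            qed
            finally show "R I' (\<lambda>l. (?u a @ [?v b]) ! slot i l) = (a < b)" .
          qed
          then show False using m[OF I'n] n by simp
        qed
      qed
    qed
    have "R I y" if "I \<subseteq> {..<n}" for I using G'[of I "\<lambda>l. l"] all[OF that] that by simp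
    moreover have "y i \<in> tuples M ?P" if "i < n" for i using yS pow_tuples that by simp
    ultimately show "\<exists>a. (\<forall>i<n. a i \<in> tuples M (pow_sorts \<Gamma> k)) \<and>
        (\<forall>I\<subseteq>{..<n}. \<exists>b\<in>tuples M \<Delta>. \<forall>i<n. sat M (a i @ b) \<psi> = (i \<in> I))"
      unfolding R_def by blast
  qed
  then show False using NIP \<psi> unfolding NIP_def by blast
qed

end

section \<open>Codes in \<open>S\<^sup>e\<^sup>q\<close>\<close>

lemma blocks_append:
  "xss \<in> blocks M \<Theta> \<Longrightarrow> yss \<in> blocks M \<Psi> \<Longrightarrow> xss @ yss \<in> blocks M (\<Theta> @ \<Psi>)"
  by (auto simp: blocks_def intro: list_all2_appendI)

lemma definable_expressible:
  assumes "expressible L M (\<Theta> @ \<Psi>) P" "cs \<in> blocks M \<Psi>" "set (concat cs) \<subseteq> B"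
  shows "definable L M B (concat \<Theta>) {concat xss | xss. xss \<in> blocks M \<Theta> \<and> P (xss @ cs)}"
proof -
  obtain \<phi> where \<phi>: "wf_fm L (concat (\<Theta> @ \<Psi>)) \<phi>"
    "\<forall>xss\<in>blocks M (\<Theta> @ \<Psi>). sat M (concat xss) \<phi> = P xss"
    using assms(1) unfolding expressible_def by (elim exE conjE)
  have sat: "sat M (concat xss @ concat cs) \<phi> = P (xss @ cs)" if "xss \<in> blocks M \<Theta>" for xss
    using \<phi>(2) blocks_append[OF that assms(2)] by (metis concat_append)
  have "{concat xss | xss. xss \<in> blocks M \<Theta> \<and> P (xss @ cs)} =
      {xs \<in> tuples M (concat \<Theta>). sat M (xs @ concat cs) \<phi>}"
    using sat blocks_concat by (force elim!: tuples_concatE)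
  then show ?thesis
    unfolding definable_def using \<phi>(1) blocks_concat[OF assms(2)] assms(3)
    by (intro exI[of _ "concat \<Psi>"] exI[of _ \<phi>] exI[of _ "concat cs"]) simp
qed

lemma definable_expressible_1:
  assumes "expressible L M (\<Gamma> # \<Psi>) P" "cs \<in> blocks M \<Psi>" "set (concat cs) \<subseteq> B"
    and "\<And>u. u \<in> tuples M \<Gamma> \<Longrightarrow> P (u # cs) \<longleftrightarrow> R u"
  shows "definable L M B \<Gamma> {u \<in> tuples M \<Gamma>. R u}"
proof -
  have "definable L M B (concat [\<Gamma>]) {concat xss | xss. xss \<in> blocks M [\<Gamma>] \<and> P (xss @ cs)}"
    by (rule definable_expressible[OF _ assms(2,3)]) (use assms(1) in simp)
  moreover have "xss \<in> blocks M [\<Gamma>] \<longleftrightarrow> (\<exists>u. xss = [u] \<and> u \<in> tuples M \<Gamma>)" for xss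
    by (auto simp: blocks_def list_all2_Cons2)
  then have "{concat xss | xss. xss \<in> blocks M [\<Gamma>] \<and> P (xss @ cs)} = {u \<in> tuples M \<Gamma>. P (u # cs)}"
    (is "?A = ?B")
  proof (intro equalityI subsetI)
    fix x assume "x \<in> ?B"
    then have "x = concat [x] \<and> [x] \<in> blocks M [\<Gamma>] \<and> P ([x] @ cs)" by (simp add: blocks_Cons)
    then show "x \<in> ?A" by blast
  qed (use \<open>\<And>xss. xss \<in> blocks M [\<Gamma>] \<longleftrightarrow> (\<exists>u. xss = [u] \<and> u \<in> tuples M \<Gamma>)\<close> in auto)
  ultimately show ?thesis using assms(4) by (simp cong: conj_cong)
qed

lemma definable_expressible_2:
  assumes "expressible L M (\<Gamma> # \<Delta> # \<Psi>) P" "cs \<in> blocks M \<Psi>" "set (concat cs) \<subseteq> B"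
    and "\<And>u v. u \<in> tuples M \<Gamma> \<Longrightarrow> v \<in> tuples M \<Delta> \<Longrightarrow> P (u # v # cs) \<longleftrightarrow> R u v"
  shows "definable L M B (\<Gamma> @ \<Delta>) {u @ v | u v. u \<in> tuples M \<Gamma> \<and> v \<in> tuples M \<Delta> \<and> R u v}"
proof -
  have "definable L M B (concat [\<Gamma>, \<Delta>]) {concat xss | xss. xss \<in> blocks M [\<Gamma>, \<Delta>] \<and> P (xss @ cs)}"
    by (rule definable_expressible[OF _ assms(2,3)]) (use assms(1) in simp)
  moreover have "xss \<in> blocks M [\<Gamma>, \<Delta>] \<longleftrightarrow> (\<exists>u v. xss = [u, v] \<and> u \<in> tuples M \<Gamma> \<and> v \<in> tuples M \<Delta>)" for xss
    by (auto simp: blocks_def list_all2_Cons2)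
  then have "{concat xss | xss. xss \<in> blocks M [\<Gamma>, \<Delta>] \<and> P (xss @ cs)} =
      {u @ v | u v. u \<in> tuples M \<Gamma> \<and> v \<in> tuples M \<Delta> \<and> P (u # v # cs)}"
    (is "?A = ?B")
  proof (intro equalityI subsetI)
    fix x assume "x \<in> ?B"
    then obtain u v where "x = u @ v" "u \<in> tuples M \<Gamma>" "v \<in> tuples M \<Delta>" "P (u # v # cs)" by blast
    then have "x = concat [u, v] \<and> [u, v] \<in> blocks M [\<Gamma>, \<Delta>] \<and> P ([u, v] @ cs)"
      by (simp add: blocks_Cons)
    then show "x \<in> ?A" by blast
  next
    fix x assume "x \<in> ?A"
    then obtain xss where "x = concat xss" "xss \<in> blocks M [\<Gamma>, \<Delta>]" "P (xss @ cs)" by blast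
    then show "x \<in> ?B"
      using \<open>\<And>xss. xss \<in> blocks M [\<Gamma>, \<Delta>] \<longleftrightarrow> (\<exists>u v. xss = [u, v] \<and> u \<in> tuples M \<Gamma> \<and> v \<in> tuples M \<Delta>)\<close>
      by fastforce
  qed
  moreover have "{u @ v | u v. u \<in> tuples M \<Gamma> \<and> v \<in> tuples M \<Delta> \<and> P (u # v # cs)} =
      {u @ v | u v. u \<in> tuples M \<Gamma> \<and> v \<in> tuples M \<Delta> \<and> R u v}"
    using assms(4) by blast
  ultimately show ?thesis by simp
qed

text \<open>Used for an automorphism, acting on nodes and on branches.\<close>

lemma shattered_image:
  assumes "\<And>x z. x \<in> P \<Longrightarrow> z \<in> W \<Longrightarrow> r (g x) (h z) = r x z" "g ` P \<subseteq> P" "shattered r P n W"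
  shows "shattered r P n (h ` W)"
  using assms(1,3)
proof (induction n arbitrary: W)
  case (Suc n)
  then obtain x where x: "x \<in> P" "shattered r P n {z \<in> W. r x z}" "shattered r P n {z \<in> W. \<not> r x z}"
    by auto
  have "shattered r P n (h ` {z \<in> W. r x z})" "shattered r P n (h ` {z \<in> W. \<not> r x z})"
    using Suc(1)[OF _ x(2)] Suc(1)[OF _ x(3)] Suc(2) by auto
  moreover have "h ` {z \<in> W. r x z} = {z \<in> h ` W. r (g x) z}" "h ` {z \<in> W. \<not> r x z} = {z \<in> h ` W. \<not> r (g x) z}"
    using Suc(2)[OF x(1)] by auto
  ultimately show ?case using assms(2) x(1) by auto
qed simp

context stable_in_NIP
begin

lemma small_list: "small_set \<kappa> M B \<Longrightarrow> set xs \<subseteq> universe M \<Longrightarrow> small_set \<kappa> M (set xs \<union> B)"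
  using small_Un_finite[of B "set xs"] by (simp add: Un_commute)

lemma pow_universe: "d \<in> pow_set S l \<Longrightarrow> set d \<subseteq> universe M"
  using pow_tuples tuples_universe by blast

lemmas small_pow = small_list[OF small_C pow_universe]

text \<open>
  \<open>S\<^sup>e\<^sup>q\<close> consists of the tuples that are definable from elements of \<open>S\<close>: such a tuple is the value at
  \<open>d\<close> of a \<open>C\<close>-definable map, and its kernel is the equivalence relation to take.
\<close>

lemma in_SeqI:
  assumes d: "d \<in> pow_set S l" and t: "set t \<subseteq> dcl L M (set d \<union> C)"
  shows "t \<in> Seq L M C \<Gamma> S"
proof -
  let ?P = "pow_sorts \<Gamma> l"
  obtain \<Delta> where \<Delta>: "t \<in> tuples M \<Delta>"
    using universe_tuples[OF subset_trans[OF t dcl_universe]] by (elim exE)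
  obtain \<Delta>1 c \<alpha> where \<alpha>: "wf_fm L (\<Delta> @ ?P @ \<Delta>1) \<alpha>" "c \<in> tuples M \<Delta>1" "set c \<subseteq> C"
    "{t} = {xs \<in> tuples M \<Delta>. sat M (xs @ d @ c) \<alpha>}"
    using definable_split[OF dcl_definable[OF small_pow[OF d] \<Delta> t] pow_tuples[OF d]] by blast
  obtain \<Delta>2 \<delta> c' where \<delta>: "wf_fm L (?P @ \<Delta>2) \<delta>" "c' \<in> tuples M \<Delta>2" "set c' \<subseteq> C"
    "pow_set S l = {xs \<in> tuples M ?P. sat M (xs @ c') \<delta>}"
    using definable_pow_set[OF def_S, of l] unfolding definable_def by (elim exE conjE)
  define U where "U u y \<longleftrightarrow> (\<forall>y' \<in> tuples M \<Delta>. sat M (y' @ u @ c) \<alpha> \<longleftrightarrow> y' = y)" for u y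
  define D where "D = {u \<in> pow_set S l. \<exists>y \<in> tuples M \<Delta>. U u y}"
  define f where "f u = (SOME y. y \<in> tuples M \<Delta> \<and> U u y)" for u
  have U_unique: "y = y'" if "U u y" "U u y'" "y \<in> tuples M \<Delta>" "y' \<in> tuples M \<Delta>" for u y y'
    using that unfolding U_def by blast
  have f: "f u \<in> tuples M \<Delta> \<and> U u (f u)" if "u \<in> D" for u
    using that unfolding D_def f_def by (metis (mono_tags, lifting) mem_Collect_eq someI_ex)
  have f_eq: "f u = y \<longleftrightarrow> U u y" if "u \<in> D" "y \<in> tuples M \<Delta>" for u y
    using f[OF that(1)] that(2) U_unique by blast
  have "U d t" using \<alpha>(4) \<Delta> unfolding U_def by blast
  then have dD: "d \<in> D" "f d = t" using d \<Delta> f_eq by (auto simp: D_def)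
  define in_D where "in_D u \<longleftrightarrow> sat M (u @ c') \<delta> \<and> (\<exists>y \<in> tuples M \<Delta>. U u y)" for u
  have in_D: "u \<in> D \<longleftrightarrow> in_D u" if "u \<in> tuples M ?P" for u
    using that \<delta>(4) by (auto simp: D_def in_D_def)
  have D_tuples: "D \<subseteq> tuples M ?P" using pow_tuples by (auto simp: D_def)
  have cc: "[c, c'] \<in> blocks M [\<Delta>1, \<Delta>2]" "set (concat [c, c']) \<subseteq> C"
    using \<alpha> \<delta> by (auto simp: blocks_Cons)
  have exprU: "expressible L M \<Theta> (\<lambda>xss. \<forall>y' \<in> tuples M \<Delta>.
      sat M (concat (map ((!) (y' # xss)) [0, Suc i, Suc j])) \<alpha> \<longleftrightarrow> (y' # xss) ! 0 = (y' # xss) ! (Suc k))"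
    if "i < length \<Theta>" "j < length \<Theta>" "k < length \<Theta>" "\<Theta> ! i = ?P" "\<Theta> ! j = \<Delta>1" "\<Theta> ! k = \<Delta>" for \<Theta> i j k
    by (intro expressible_all expressible_iff expressible_fm expressible_eq) (use \<alpha>(1) that in auto)
  have exprD: "expressible L M \<Theta> (\<lambda>xss. sat M (concat (map ((!) xss) [i, k])) \<delta> \<and> (\<exists>y \<in> tuples M \<Delta>.
      \<forall>y' \<in> tuples M \<Delta>. sat M (concat (map ((!) (y' # y # xss)) [0, Suc (Suc i), Suc (Suc j)])) \<alpha> \<longleftrightarrow>
        (y' # y # xss) ! 0 = (y' # y # xss) ! (Suc 0)))"
    if "i < length \<Theta>" "j < length \<Theta>" "k < length \<Theta>" "\<Theta> ! i = ?P" "\<Theta> ! j = \<Delta>1" "\<Theta> ! k = \<Delta>2" for \<Theta> i j k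
    by (intro expressible_conj expressible_ex exprU expressible_fm) (use \<delta>(1) that in auto)
  have defD: "definable L M C ?P D"
  proof -
    have "expressible L M [?P, \<Delta>1, \<Delta>2] (\<lambda>xss. sat M (concat (map ((!) xss) [0, 2])) \<delta> \<and> (\<exists>y \<in> tuples M \<Delta>.
      \<forall>y' \<in> tuples M \<Delta>. sat M (concat (map ((!) (y' # y # xss)) [0, Suc (Suc 0), Suc (Suc 1)])) \<alpha> \<longleftrightarrow>
        (y' # y # xss) ! 0 = (y' # y # xss) ! (Suc 0)))"
      by (rule exprD) auto
    then have "definable L M C ?P {u \<in> tuples M ?P. in_D u}"
      by (rule definable_expressible_1[OF _ cc]) (simp add: in_D_def U_def)
    moreover have "{u \<in> tuples M ?P. in_D u} = D" using in_D D_tuples by auto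
    ultimately show ?thesis by simp
  qed
  define E where "E = {(u, u'). u \<in> D \<and> u' \<in> D \<and> f u = f u'}"
  have "definable_rel L M C ?P E"
  proof -
    have "expressible L M [?P, ?P, \<Delta>1, \<Delta>2] (\<lambda>xss.
       (sat M (concat (map ((!) xss) [0, 3])) \<delta> \<and> (\<exists>y \<in> tuples M \<Delta>.
      \<forall>y' \<in> tuples M \<Delta>. sat M (concat (map ((!) (y' # y # xss)) [0, Suc (Suc 0), Suc (Suc 2)])) \<alpha> \<longleftrightarrow>
        (y' # y # xss) ! 0 = (y' # y # xss) ! (Suc 0))) \<and>
       (sat M (concat (map ((!) xss) [1, 3])) \<delta> \<and> (\<exists>y \<in> tuples M \<Delta>.
      \<forall>y' \<in> tuples M \<Delta>. sat M (concat (map ((!) (y' # y # xss)) [0, Suc (Suc 1), Suc (Suc 2)])) \<alpha> \<longleftrightarrow>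
        (y' # y # xss) ! 0 = (y' # y # xss) ! (Suc 0))) \<and>
       (\<exists>y \<in> tuples M \<Delta>.
         (\<forall>y' \<in> tuples M \<Delta>. sat M (concat (map ((!) (y' # y # xss)) [0, Suc 1, Suc 3])) \<alpha> \<longleftrightarrow>
           (y' # y # xss) ! 0 = (y' # y # xss) ! (Suc 0)) \<and>
         (\<forall>y' \<in> tuples M \<Delta>. sat M (concat (map ((!) (y' # y # xss)) [0, Suc 2, Suc 3])) \<alpha> \<longleftrightarrow>
           (y' # y # xss) ! 0 = (y' # y # xss) ! (Suc 0))))"
      by (intro expressible_conj[OF exprD] expressible_conj[OF exprU] exprU exprD expressible_ex) auto
    then have "definable L M C (?P @ ?P) {u @ v | u v. u \<in> tuples M ?P \<and> v \<in> tuples M ?P \<and>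
        in_D u \<and> in_D v \<and> (\<exists>y \<in> tuples M \<Delta>. U u y \<and> U v y)}"
      by (rule definable_expressible_2[OF _ cc]) (simp add: in_D_def U_def)
    moreover have "u \<in> tuples M ?P \<and> v \<in> tuples M ?P \<and> in_D u \<and> in_D v \<and> (\<exists>y \<in> tuples M \<Delta>. U u y \<and> U v y)
      \<longleftrightarrow> (u, v) \<in> E" for u v
    proof (cases "u \<in> D \<and> v \<in> D")
      case True
      then have "(\<exists>y \<in> tuples M \<Delta>. U u y \<and> U v y) \<longleftrightarrow> (\<exists>y \<in> tuples M \<Delta>. f u = y \<and> f v = y)"
        using f_eq by blast
      also have "\<dots> \<longleftrightarrow> f u = f v" using f True by auto
      finally show ?thesis using True in_D D_tuples by (auto simp: E_def)
    qed (use in_D in \<open>auto simp: E_def\<close>)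
    ultimately have "definable L M C (?P @ ?P) {xs @ ys | xs ys. (xs, ys) \<in> E}" by simp
    then show ?thesis unfolding definable_rel_def using D_tuples by (auto simp: E_def)
  qed
  moreover have "definable_map L M C ?P D \<Delta> f"
  proof -
    have "expressible L M [?P, \<Delta>, \<Delta>1, \<Delta>2] (\<lambda>xss.
       (sat M (concat (map ((!) xss) [0, 3])) \<delta> \<and> (\<exists>y \<in> tuples M \<Delta>.
      \<forall>y' \<in> tuples M \<Delta>. sat M (concat (map ((!) (y' # y # xss)) [0, Suc (Suc 0), Suc (Suc 2)])) \<alpha> \<longleftrightarrow>
        (y' # y # xss) ! 0 = (y' # y # xss) ! (Suc 0))) \<and>
       (\<forall>y' \<in> tuples M \<Delta>. sat M (concat (map ((!) (y' # xss)) [0, Suc 0, Suc 2])) \<alpha> \<longleftrightarrow>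
           (y' # xss) ! 0 = (y' # xss) ! (Suc 1)))"
      by (intro expressible_conj[OF exprD] exprU) auto
    then have "definable L M C (?P @ \<Delta>) {u @ y | u y. u \<in> tuples M ?P \<and> y \<in> tuples M \<Delta> \<and> in_D u \<and> U u y}"
      by (rule definable_expressible_2[OF _ cc]) (simp add: in_D_def U_def)
    moreover have "u \<in> tuples M ?P \<and> y \<in> tuples M \<Delta> \<and> in_D u \<and> U u y \<longleftrightarrow> u \<in> D \<and> y = f u" for u y
      using in_D D_tuples f f_eq by blast
    then have "{u @ y | u y. u \<in> tuples M ?P \<and> y \<in> tuples M \<Delta> \<and> in_D u \<and> U u y} = {xs @ f xs | xs. xs \<in> D}"
      by auto
    ultimately have "definable L M C (?P @ \<Delta>) {xs @ f xs | xs. xs \<in> D}" by simp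
    then show ?thesis unfolding definable_map_def using D_tuples f by auto
  qed
  moreover have "equiv D E" by (rule equivI) (auto simp: E_def refl_on_def sym_def trans_def)
  ultimately show ?thesis
    unfolding Seq_def mem_Collect_eq using defD dD
    by (intro exI[of _ l] exI[of _ D] exI[of _ E] exI[of _ \<Delta>] exI[of _ f] exI[of _ d])
      (auto simp: E_def D_def)
qed

lemma in_SeqE:
  assumes "t \<in> Seq L M C \<Gamma> S"
  obtains l d where "d \<in> pow_set S l" "set t \<subseteq> dcl L M (set d \<union> C)"
proof -
  obtain l D \<Delta> f d where D: "D \<subseteq> pow_set S l" "definable_map L M C (pow_sorts \<Gamma> l) D \<Delta> f" "d \<in> D" "t = f d"
    using assms unfolding Seq_def by blast
  let ?G = "{xs @ f xs | xs. xs \<in> D}"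
  have G: "definable L M C (pow_sorts \<Gamma> l @ \<Delta>) ?G" and t: "t \<in> tuples M \<Delta>"
    using D unfolding definable_map_def by auto
  have d: "d \<in> pow_set S l" using D by blast
  have "set t \<subseteq> dcl L M (set d \<union> C)"
  proof
    fix y assume y: "y \<in> set t"
    show "y \<in> dcl L M (set d \<union> C)"
    proof (rule fixed_in_dcl[OF small_pow[OF d]])
      show "y \<in> universe M" using y tuples_universe[OF t] by blast
      fix \<sigma> assume \<sigma>: "\<sigma> \<in> auts L M (set d \<union> C)"
      then have "\<sigma> \<in> auts L M C" using auts_mono[of C "set d \<union> C"] by auto
      moreover have "d @ t \<in> tuples M (pow_sorts \<Gamma> l @ \<Delta>)" by (intro tuples_append pow_tuples d t)
      ultimately have "map \<sigma> (d @ t) \<in> ?G" using definable_invariant[OF struct G] D(3,4) by blast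
      then obtain xs where xs: "map \<sigma> d @ map \<sigma> t = xs @ f xs" "xs \<in> D" by auto
      moreover have "map \<sigma> d = d" using auts_fix_list[OF \<sigma>] by simp
      moreover have "length xs = length d" using d xs(2) D(1) pow_tuples by (metis subsetD tuples_length)
      ultimately have "map \<sigma> t = t" using D(4) by (metis append_eq_append_conv)
      then show "\<sigma> y = y" using y by (metis map_eq_conv map_ident)
    qed
  qed
  then show ?thesis using that d by blast
qed

text \<open>
  Stable embeddedness, in the form of invariance over finitely many elements of \<open>S\<close>. If every such
  set of elements had an automorphism over it moving \<open>\<phi>(S, c)\<close>, then the conjugates of \<open>c\<close> would be
  the leaves of trees of any height with nodes in \<open>S\<close>.
\<close>

lemma stably_embedded:
  assumes \<phi>: "wf_fm L (pow_sorts \<Gamma> k @ \<Delta>) \<phi>" and c: "c \<in> tuples M \<Delta>"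
  shows "\<exists>l. \<exists>d \<in> pow_set S l. \<forall>\<sigma> \<in> auts L M (set d \<union> C). \<forall>x \<in> pow_set S k.
    sat M (map \<sigma> x @ c) \<phi> = sat M (x @ c) \<phi>"
proof (rule ccontr)
  assume "\<not> ?thesis"
  then have move: "\<exists>\<sigma> \<in> auts L M (set d \<union> C). \<exists>x \<in> pow_set S k. sat M (map \<sigma> x @ c) \<phi> \<noteq> sat M (x @ c) \<phi>"
    if "d \<in> pow_set S l" for l d using that by blast
  define r where "r x z = sat M (x @ z) \<phi>" for x z
  define W where "W d = {map \<sigma> c | \<sigma>. \<sigma> \<in> auts L M (set d \<union> C)}" for d
  have r_aut: "r (map \<sigma> x) (map \<sigma> z) = r x z"
    if "automorphism L M \<sigma>" "x \<in> pow_set S k" "z \<in> tuples M \<Delta>" for \<sigma> x z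
    using sat_aut[OF that(1) \<phi> tuples_append[OF pow_tuples[OF that(2)] that(3)]] by (simp add: r_def)
  have W_tuples: "W d \<subseteq> tuples M \<Delta>" for d
    using c aut_tuples auts_automorphism by (fastforce simp: W_def)
  have tree: "shattered r (pow_set S k) n (W d)" if "d \<in> pow_set S l" for n l d
    using that
  proof (induction n arbitrary: l d)
    case 0
    show ?case using id_auts by (auto simp: W_def)
  next
    case (Suc n)
    obtain \<sigma> x0 where \<sigma>: "\<sigma> \<in> auts L M (set d \<union> C)" and x0: "x0 \<in> pow_set S k"
      and ne: "r (map \<sigma> x0) c \<noteq> r x0 c"
      using move[OF Suc(2)] unfolding r_def by blast
    have \<sigma>C: "\<sigma> \<in> auts L M C" using \<sigma> auts_mono[of C "set d \<union> C"] by auto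
    have \<sigma>a: "automorphism L M \<sigma>" using \<sigma> by (rule auts_automorphism)
    define x where "x = map \<sigma> x0"
    have x: "x \<in> pow_set S k" using pow_set_aut[OF \<sigma>C pow_tuples[OF x0]] x0 by (simp add: x_def)
    \<comment> \<open>Over \<open>?d\<close> the truth values at the new node \<open>x\<close> are constant on each of the two subtrees.\<close>
    let ?d = "d @ x0 @ x"
    have IH: "shattered r (pow_set S k) n (W ?d)"
      by (rule Suc(1)[where l = "l + (k + k)"]) (intro pow_set_append Suc(2) x0 x)
    have "W ?d \<subseteq> {z \<in> W d. r x z = r x c}"
    proof
      fix z assume "z \<in> W ?d"
      then obtain \<rho> where \<rho>: "\<rho> \<in> auts L M (set ?d \<union> C)" "z = map \<rho> c" by (auto simp: W_def)
      then have "z \<in> W d" using auts_mono[of "set d \<union> C" "set ?d \<union> C"] by (auto simp: W_def)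
      moreover have "r (map \<rho> x) (map \<rho> c) = r x c" by (rule r_aut[OF auts_automorphism[OF \<rho>(1)] x c])
      moreover have "map \<rho> x = x" by (rule auts_fix_list[OF \<rho>(1)]) auto
      ultimately show "z \<in> {z \<in> W d. r x z = r x c}" using \<rho>(2) by simp
    qed
    then have 1: "shattered r (pow_set S k) n {z \<in> W d. r x z = r x c}" using IH shattered_mono by blast
    have "map \<sigma> ` W ?d \<subseteq> {z \<in> W d. r x z = r x0 c}"
    proof
      fix z' assume "z' \<in> map \<sigma> ` W ?d"
      then obtain \<rho> where \<rho>: "\<rho> \<in> auts L M (set ?d \<union> C)" "z' = map \<sigma> (map \<rho> c)" by (auto simp: W_def)
      then have "\<rho> \<in> auts L M (set d \<union> C)" using auts_mono[of "set d \<union> C" "set ?d \<union> C"] by auto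
      then have "\<sigma> \<circ> \<rho> \<in> auts L M (set d \<union> C)" using auts_comp \<sigma> by blast
      then have "z' \<in> W d" unfolding W_def \<rho>(2) by (auto intro!: exI[of _ "\<sigma> \<circ> \<rho>"])
      moreover have "r x z' = r x0 (map \<rho> c)"
        unfolding x_def \<rho>(2)
        by (rule r_aut[OF \<sigma>a x0]) (rule aut_tuples[OF auts_automorphism[OF \<rho>(1)] c])
      moreover have "r (map \<rho> x0) (map \<rho> c) = r x0 c" by (rule r_aut[OF auts_automorphism[OF \<rho>(1)] x0 c])
      moreover have "map \<rho> x0 = x0" by (rule auts_fix_list[OF \<rho>(1)]) auto
      ultimately show "z' \<in> {z \<in> W d. r x z = r x0 c}" by simp
    qed
    moreover have "shattered r (pow_set S k) n (map \<sigma> ` W ?d)"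
      by (rule shattered_image[where g = "map \<sigma>", OF _ _ IH])
        (use r_aut[OF \<sigma>a] W_tuples pow_set_aut[OF \<sigma>C] pow_tuples in auto)
    ultimately have 2: "shattered r (pow_set S k) n {z \<in> W d. r x z = r x0 c}"
      using shattered_mono by blast
    show ?case using 1 2 x ne unfolding x_def[symmetric] by (cases "r x c") auto
  qed
  obtain m1 where m1: "\<not> ladder (\<lambda>x z. sat M (x @ z) \<phi>) (pow_set S k) (tuples M \<Delta>) m1"
    using no_ladder[OF \<phi>] by blast
  obtain m2 where m2: "\<not> ladder (\<lambda>x z. sat M (x @ z) (Neg \<phi>)) (pow_set S k) (tuples M \<Delta>) m2"
    using no_ladder[of k \<Delta> "Neg \<phi>"] \<phi> by auto
  obtain h where h: "\<And>P W. shattered r P h W \<Longrightarrow> ladder r P W (max m1 m2) \<or> ladder (\<lambda>x z. \<not> r x z) P W (max m1 m2)"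
    using tree_ladder[of r "max m1 m2"] by blast
  have "[] \<in> pow_set S 0" by (simp add: pow_set_def)
  then have "shattered r (pow_set S k) h (tuples M \<Delta>)" using tree shattered_mono W_tuples by blast
  then have "ladder r (pow_set S k) (tuples M \<Delta>) m1 \<or> ladder (\<lambda>x z. \<not> r x z) (pow_set S k) (tuples M \<Delta>) m2"
    using h ladder_le by (metis max.cobounded1 max.cobounded2)
  then show False using m1 m2 by (simp add: r_def[abs_def])
qed

end

context stable_in_NIP
begin

text \<open>
  The trace of a formula on a power of \<open>S\<close> has a code in \<open>S\<^sup>e\<^sup>q\<close>: it can be defined with parameters
  \<open>d\<close> from \<open>S\<close>, and eliminating the equivalence ``\<open>u\<close> and \<open>u'\<close> define the same set'' provides a code
  of the class of \<open>d\<close>.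
\<close>

lemma code_in_Seq:
  assumes \<phi>: "wf_fm L (pow_sorts \<Gamma> k @ \<Delta>) \<phi>" and c: "c \<in> tuples M \<Delta>"
  shows "\<exists>t \<in> Seq L M C \<Gamma> S. set t \<subseteq> universe M \<and> (\<forall>\<sigma> \<in> auts L M C. map \<sigma> t = t \<longleftrightarrow>
    (\<forall>x \<in> pow_set S k. sat M (map \<sigma> x @ c) \<phi> = sat M (x @ c) \<phi>))"
proof -
  let ?P = "pow_sorts \<Gamma> k"
  define Z where "Z = {x \<in> pow_set S k. sat M (x @ c) \<phi>}"
  obtain l d where d: "d \<in> pow_set S l"
    and inv: "\<And>\<sigma> x. \<sigma> \<in> auts L M (set d \<union> C) \<Longrightarrow> x \<in> pow_set S k \<Longrightarrow> sat M (map \<sigma> x @ c) \<phi> = sat M (x @ c) \<phi>"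
    using stably_embedded[OF assms] by blast
  have "definable L M (C \<union> set c) ?P (tuples M ?P \<inter> (\<Inter>b\<in>{True, False}.
      if b then pow_set S k else {x \<in> tuples M ?P. sat M (x @ c) \<phi>}))"
  proof (rule definable_finite_Int)
    have "definable L M (C \<union> set c) ?P (pow_set S k)"
      using definable_mono[OF definable_pow_set[OF def_S]] by blast
    moreover have "definable L M (C \<union> set c) ?P {x \<in> tuples M ?P. sat M (x @ c) \<phi>}"
      unfolding definable_def using \<phi> c by blast
    ultimately show "definable L M (C \<union> set c) ?P
        (if b then pow_set S k else {x \<in> tuples M ?P. sat M (x @ c) \<phi>})" for b by simp
  qed simp
  moreover have "tuples M ?P \<inter> (\<Inter>b\<in>{True, False}.
      if b then pow_set S k else {x \<in> tuples M ?P. sat M (x @ c) \<phi>}) = Z"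
    using pow_tuples by (auto simp: Z_def)
  ultimately have "definable L M (C \<union> set c) ?P Z" by simp
  then have "definable L M (set d \<union> C) ?P Z"
  proof (rule invariant_definable[OF small_pow[OF d]])
    fix \<sigma> x assume \<sigma>: "\<sigma> \<in> auts L M (set d \<union> C)" and x: "x \<in> Z"
    then have "map \<sigma> x \<in> pow_set S k"
      using pow_set_aut[of \<sigma> x k] pow_tuples auts_mono[of C "set d \<union> C" L M] by (auto simp: Z_def)
    then show "map \<sigma> x \<in> Z" using inv[OF \<sigma>] x by (auto simp: Z_def)
  qed
  then obtain \<Delta>1 c1 \<zeta> where \<zeta>: "wf_fm L (?P @ pow_sorts \<Gamma> l @ \<Delta>1) \<zeta>" "c1 \<in> tuples M \<Delta>1" "set c1 \<subseteq> C"
    "Z = {x \<in> tuples M ?P. sat M (x @ d @ c1) \<zeta>}"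
    using definable_split[OF _ pow_tuples[OF d]] by blast
  let ?\<Theta> = "pow_sorts \<Gamma> l @ \<Delta>1" and ?u = "d @ c1"
  have u: "?u \<in> tuples M ?\<Theta>" using pow_tuples[OF d] \<zeta>(2) by (rule tuples_append)
  define same where "same u v \<longleftrightarrow> (\<forall>x \<in> tuples M ?P. sat M (x @ u) \<zeta> = sat M (x @ v) \<zeta>)" for u v
  define E where "E = {(u, v). u \<in> tuples M ?\<Theta> \<and> v \<in> tuples M ?\<Theta> \<and> same u v}"
  have equiv: "equiv (tuples M ?\<Theta>) E"
    by (rule equivI) (auto simp: E_def refl_on_def sym_def trans_def same_def)
  have "expressible L M [?\<Theta>, ?\<Theta>] (\<lambda>xss. \<forall>x \<in> tuples M ?P.
      sat M (concat (map ((!) (x # xss)) [0, 1])) \<zeta> \<longleftrightarrow> sat M (concat (map ((!) (x # xss)) [0, 2])) \<zeta>)"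
    by (intro expressible_all expressible_iff expressible_fm) (use \<zeta>(1) in auto)
  then have "definable L M {} (?\<Theta> @ ?\<Theta>) {u @ v | u v. u \<in> tuples M ?\<Theta> \<and> v \<in> tuples M ?\<Theta> \<and> same u v}"
    by (rule definable_expressible_2[where cs = "[]"]) (auto simp: same_def)
  moreover have "{u @ v | u v. u \<in> tuples M ?\<Theta> \<and> v \<in> tuples M ?\<Theta> \<and> same u v} = {xs @ ys | xs ys. (xs, ys) \<in> E}"
    by (simp add: E_def)
  moreover have "E \<subseteq> tuples M ?\<Theta> \<times> tuples M ?\<Theta>" unfolding E_def by blast
  ultimately have "definable_rel L M {} ?\<Theta> E"
    unfolding definable_rel_def by metis
  then have "\<exists>\<Delta>t. \<exists>t \<in> tuples M \<Delta>t. \<forall>\<sigma>. automorphism L M \<sigma> \<longrightarrow>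
      (map \<sigma> ` (E `` {?u}) = E `` {?u} \<longleftrightarrow> map \<sigma> t = t)"
    by (rule EI[unfolded eliminates_imaginaries_def, THEN spec, THEN spec, THEN mp, OF equiv, THEN mp, THEN bspec, OF _ u])
  then obtain \<Delta>t t where t: "t \<in> tuples M \<Delta>t"
    and codes: "\<forall>\<sigma>. automorphism L M \<sigma> \<longrightarrow> (map \<sigma> ` (E `` {?u}) = E `` {?u} \<longleftrightarrow> map \<sigma> t = t)"
    by (elim exE bexE)
  have code: "map \<sigma> ` (E `` {?u}) = E `` {?u} \<longleftrightarrow> map \<sigma> t = t" if "automorphism L M \<sigma>" for \<sigma>
    using codes that by simp
  have E_aut: "(map \<sigma> v, map \<sigma> w) \<in> E \<longleftrightarrow> (v, w) \<in> E"
    if \<sigma>: "automorphism L M \<sigma>" and vw: "v \<in> tuples M ?\<Theta>" "w \<in> tuples M ?\<Theta>" for \<sigma> v w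
  proof -
    have 1: "sat M (map \<sigma> x @ map \<sigma> v) \<zeta> = sat M (x @ v) \<zeta>" if "x \<in> tuples M ?P" "v \<in> tuples M ?\<Theta>" for x v
      using sat_aut[OF \<sigma> \<zeta>(1) tuples_append[OF that]] by simp
    have "same (map \<sigma> v) (map \<sigma> w) \<longleftrightarrow> same v w"
    proof
      assume s: "same (map \<sigma> v) (map \<sigma> w)"
      show "same v w" unfolding same_def
        using s[unfolded same_def] 1 vw aut_tuples[OF \<sigma>] by blast
    next
      assume s: "same v w"
      show "same (map \<sigma> v) (map \<sigma> w)" unfolding same_def
      proof
        fix y assume "y \<in> tuples M ?P"
        then obtain x where "x \<in> tuples M ?P" "map \<sigma> x = y" using aut_tuples_surj[OF \<sigma>] by blast
        then show "sat M (y @ map \<sigma> v) \<zeta> = sat M (y @ map \<sigma> w) \<zeta>"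
          using s[unfolded same_def] 1 vw by blast
      qed
    qed
    then show ?thesis using vw aut_tuples[OF \<sigma>] by (simp add: E_def)
  qed
  have class_iff: "map \<sigma> ` (E `` {?u}) = E `` {?u} \<longleftrightarrow> (?u, map \<sigma> ?u) \<in> E" if \<sigma>: "automorphism L M \<sigma>" for \<sigma>
  proof -
    have "map \<sigma> ` (E `` {?u}) = E `` {map \<sigma> ?u}"
    proof (intro equalityI subsetI)
      fix w assume "w \<in> E `` {map \<sigma> ?u}"
      then have "(map \<sigma> ?u, w) \<in> E" "w \<in> tuples M ?\<Theta>" by (auto simp: E_def)
      moreover obtain v where "v \<in> tuples M ?\<Theta>" "map \<sigma> v = w"
        using aut_tuples_surj[OF \<sigma>] calculation(2) by blast
      ultimately have "v \<in> E `` {?u}" using E_aut[OF \<sigma> u] by blast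
      then show "w \<in> map \<sigma> ` (E `` {?u})" using \<open>map \<sigma> v = w\<close> by blast
    next
      fix w assume "w \<in> map \<sigma> ` (E `` {?u})"
      then obtain v where v: "(?u, v) \<in> E" "w = map \<sigma> v" by blast
      then have "v \<in> tuples M ?\<Theta>" by (simp add: E_def)
      then show "w \<in> E `` {map \<sigma> ?u}" using E_aut[OF \<sigma> u] v by blast
    qed
    then show ?thesis using eq_equiv_class_iff[OF equiv u aut_tuples[OF \<sigma> u]] by blast
  qed
  have Z_iff: "(?u, map \<sigma> ?u) \<in> E \<longleftrightarrow> (\<forall>x \<in> pow_set S k. sat M (map \<sigma> x @ c) \<phi> = sat M (x @ c) \<phi>)"
    if \<sigma>: "\<sigma> \<in> auts L M C" for \<sigma>
  proof -
    have \<sigma>a: "automorphism L M \<sigma>" using \<sigma> by (rule auts_automorphism)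
    have 1: "sat M (map \<sigma> x @ map \<sigma> ?u) \<zeta> = sat M (x @ ?u) \<zeta>" if "x \<in> tuples M ?P" for x
      using sat_aut[OF \<sigma>a \<zeta>(1) tuples_append[OF that u]] by simp
    have memZ: "sat M (x @ ?u) \<zeta> \<longleftrightarrow> x \<in> Z" if "x \<in> tuples M ?P" for x using \<zeta>(4) that by simp
    have "(?u, map \<sigma> ?u) \<in> E \<longleftrightarrow> (\<forall>y \<in> tuples M ?P. sat M (y @ ?u) \<zeta> = sat M (y @ map \<sigma> ?u) \<zeta>)"
      using u aut_tuples[OF \<sigma>a u] by (simp only: E_def same_def case_prod_conv mem_Collect_eq simp_thms)
    also have "\<dots> \<longleftrightarrow> (\<forall>x \<in> tuples M ?P. sat M (map \<sigma> x @ ?u) \<zeta> = sat M (map \<sigma> x @ map \<sigma> ?u) \<zeta>)"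
      using aut_tuples[OF \<sigma>a] aut_tuples_surj[OF \<sigma>a] by metis
    also have "\<dots> \<longleftrightarrow> (\<forall>x \<in> tuples M ?P. map \<sigma> x \<in> Z \<longleftrightarrow> x \<in> Z)"
      using 1 memZ aut_tuples[OF \<sigma>a] by simp
    also have "\<dots> \<longleftrightarrow> (\<forall>x \<in> pow_set S k. sat M (map \<sigma> x @ c) \<phi> = sat M (x @ c) \<phi>)"
      using pow_set_aut[OF \<sigma>] pow_tuples by (auto simp: Z_def)
    finally show ?thesis .
  qed
  have "set t \<subseteq> dcl L M (set d \<union> C)"
  proof
    fix y assume y: "y \<in> set t"
    show "y \<in> dcl L M (set d \<union> C)"
    proof (rule fixed_in_dcl[OF small_pow[OF d]])
      show "y \<in> universe M" using y tuples_universe[OF t] by blast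
      fix \<sigma> assume \<sigma>: "\<sigma> \<in> auts L M (set d \<union> C)"
      have "map \<sigma> ?u = ?u" by (rule auts_fix_list[OF \<sigma>]) (use \<zeta>(3) in auto)
      then have "(?u, map \<sigma> ?u) \<in> E" using u by (simp only: E_def same_def) simp
      then have "map \<sigma> t = t" using class_iff code auts_automorphism[OF \<sigma>] by blast
      then show "\<sigma> y = y" using y by (metis map_eq_conv map_ident)
    qed
  qed
  then have "t \<in> Seq L M C \<Gamma> S" by (rule in_SeqI[OF d])
  moreover have "map \<sigma> t = t \<longleftrightarrow> (\<forall>x \<in> pow_set S k. sat M (map \<sigma> x @ c) \<phi> = sat M (x @ c) \<phi>)"
    if "\<sigma> \<in> auts L M C" for \<sigma>
    using class_iff[OF auts_automorphism[OF that]] code[OF auts_automorphism[OF that]] Z_iff[OF that] by blast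
  ultimately show ?thesis using tuples_universe[OF t] by blast
qed

text \<open>Concatenate the elements of powers of \<open>S\<close> that define the single points.\<close>

lemma Seq_list:
  assumes "set ys \<subseteq> \<Union>(set ` Seq L M C \<Gamma> S)"
  shows "\<exists>l. \<exists>d \<in> pow_set S l. set ys \<subseteq> dcl L M (set d \<union> C)"
  using assms
proof (induction ys)
  case Nil
  show ?case by (intro exI[of _ 0] bexI[of _ "[]"]) (auto simp: pow_set_def)
next
  case (Cons y ys)
  then obtain l d where d: "d \<in> pow_set S l" "set ys \<subseteq> dcl L M (set d \<union> C)" by auto
  obtain t where t: "t \<in> Seq L M C \<Gamma> S" "y \<in> set t" using Cons(2) by auto
  obtain l' d' where d': "d' \<in> pow_set S l'" "set t \<subseteq> dcl L M (set d' \<union> C)"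
    using in_SeqE[OF t(1)] by blast
  have "set (y # ys) \<subseteq> dcl L M (set (d @ d') \<union> C)"
    using d(2) d'(2) t(2) dcl_mono[of "set d \<union> C" "set (d @ d') \<union> C" L M]
      dcl_mono[of "set d' \<union> C" "set (d @ d') \<union> C" L M] by auto
  then show ?case using pow_set_append[OF d(1) d'(1)] by blast
qed

text \<open>
  A definably closed subset \<open>X\<close> of \<open>S\<^sup>e\<^sup>q\<close> that contains \<open>S\<^sup>e\<^sup>q \<inter> dcl(A)\<close> does not grow when \<open>A\<close> is
  added to the parameters: what \<open>A\<close> contributes to the definition of a point of \<open>S\<^sup>e\<^sup>q\<close> is a set with
  a code in \<open>S\<^sup>e\<^sup>q \<inter> dcl(A)\<close>.
\<close>

lemma closed_over_parameters:
  assumes A: "C \<subseteq> A" "small_set \<kappa> M A"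
    and X: "dcl_closed_in L M C (Seq L M C \<Gamma> S) X" "dcl_in L M (Seq L M C \<Gamma> S) A \<subseteq> X"
    and e: "e \<in> Seq L M C \<Gamma> S" "set e \<subseteq> dcl L M (A \<union> \<Union>(set ` X))"
  shows "e \<in> X"
proof -
  let ?Q = "Seq L M C \<Gamma> S" and ?U = "\<Union>(set ` X)"
  have XQ: "X \<subseteq> ?Q" using X(1) unfolding dcl_closed_in_def dcl_in_def by blast
  have "y \<in> dcl L M (?U \<union> C)" if y: "y \<in> set e" for y
  proof -
    obtain s where s: "y \<in> carr M s" "definable L M (A \<union> ?U) [s] {[y]}"
      using y e(2) by (auto simp: dcl_def)
    then obtain \<Delta>0 \<phi>0 bs where bs: "wf_fm L ([s] @ \<Delta>0) \<phi>0" "bs \<in> tuples M \<Delta>0" "set bs \<subseteq> A \<union> ?U"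
      "{[y]} = {xs \<in> tuples M [s]. sat M (xs @ bs) \<phi>0}"
      unfolding definable_def by (elim exE conjE)
    define u where "u = filter (\<lambda>b. b \<in> ?U) bs"
    define c where "c = filter (\<lambda>b. b \<in> A) bs"
    have "set u \<subseteq> universe M" "set c \<subseteq> universe M"
      using tuples_universe[OF bs(2)] by (auto simp: u_def c_def)
    then obtain \<Delta>u \<Delta>c where u: "u \<in> tuples M \<Delta>u" and c: "c \<in> tuples M \<Delta>c"
      using universe_tuples by (metis (no_types))
    have sets: "set u \<subseteq> ?U" "set c \<subseteq> A" "set bs \<subseteq> set (u @ c)" using bs(3) by (auto simp: u_def c_def)
    obtain \<phi> where \<phi>: "wf_fm L ([s] @ \<Delta>u @ \<Delta>c) \<phi>"
      "\<forall>xs \<in> tuples M [s]. sat M (xs @ u @ c) \<phi> \<longleftrightarrow> sat M (xs @ bs) \<phi>0"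
      using reparametrize[OF struct bs(1,2) tuples_append[OF u c] sets(3)] by blast
    let ?v = "y # u" and ?\<Delta> = "s # \<Delta>u"
    have v: "?v \<in> tuples M ?\<Delta>" using s(1) u by (simp add: tuples_Cons)
    have "set ?v \<subseteq> \<Union>(set ` ?Q)" using y e(1) sets(1) XQ by auto
    then obtain l d where d: "d \<in> pow_set S l" "set ?v \<subseteq> dcl L M (set d \<union> C)" using Seq_list by blast
    obtain \<Delta>1 c0 \<alpha> where \<alpha>: "wf_fm L (?\<Delta> @ pow_sorts \<Gamma> l @ \<Delta>1) \<alpha>" "c0 \<in> tuples M \<Delta>1" "set c0 \<subseteq> C"
      "{?v} = {xs \<in> tuples M ?\<Delta>. sat M (xs @ d @ c0) \<alpha>}"
      using definable_split[OF dcl_definable[OF small_pow[OF d(1)] v d(2)] pow_tuples[OF d(1)]] by blast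
    have "expressible L M [pow_sorts \<Gamma> l, \<Delta>1, \<Delta>c] (\<lambda>xss. \<exists>w \<in> tuples M ?\<Delta>.
        sat M (concat (map ((!) (w # xss)) [0, 1, 2])) \<alpha> \<and> sat M (concat (map ((!) (w # xss)) [0, 3])) \<phi>)"
      by (intro expressible_ex expressible_conj expressible_fm) (use \<alpha>(1) \<phi>(1) in auto)
    then obtain \<chi> where \<chi>: "wf_fm L (concat [pow_sorts \<Gamma> l, \<Delta>1, \<Delta>c]) \<chi>"
      "\<forall>xss \<in> blocks M [pow_sorts \<Gamma> l, \<Delta>1, \<Delta>c]. sat M (concat xss) \<chi> = (\<exists>w \<in> tuples M ?\<Delta>.
        sat M (concat (map ((!) (w # xss)) [0, 1, 2])) \<alpha> \<and> sat M (concat (map ((!) (w # xss)) [0, 3])) \<phi>)"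
      unfolding expressible_def by (elim exE conjE)
    have \<chi>_sat: "sat M (x @ c0 @ c) \<chi> \<longleftrightarrow> (\<exists>w \<in> tuples M ?\<Delta>. sat M (w @ x @ c0) \<alpha> \<and> sat M (w @ c) \<phi>)"
      if "x \<in> tuples M (pow_sorts \<Gamma> l)" for x
      using \<chi>(2)[rule_format, of "[x, c0, c]"] that \<alpha>(2) c by (simp add: blocks_Cons)
    have cc: "c0 @ c \<in> tuples M (\<Delta>1 @ \<Delta>c)" using \<alpha>(2) c by (rule tuples_append)
    have \<chi>': "wf_fm L (pow_sorts \<Gamma> l @ \<Delta>1 @ \<Delta>c) \<chi>" using \<chi>(1) by simp
    obtain t where t: "t \<in> ?Q" "set t \<subseteq> universe M" and code: "\<And>\<sigma>. \<sigma> \<in> auts L M C \<Longrightarrow> map \<sigma> t = t \<longleftrightarrow>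
        (\<forall>x \<in> pow_set S l. sat M (map \<sigma> x @ c0 @ c) \<chi> = sat M (x @ c0 @ c) \<chi>)"
      using code_in_Seq[OF \<chi>' cc] by blast
    have "set t \<subseteq> dcl L M A"
    proof
      fix z assume z: "z \<in> set t"
      show "z \<in> dcl L M A"
      proof (rule fixed_in_dcl[OF A(2)])
        show "z \<in> universe M" using z t(2) by blast
        fix \<sigma> assume \<sigma>: "\<sigma> \<in> auts L M A"
        have "map \<sigma> (c0 @ c) = c0 @ c" by (rule auts_fix_list[OF \<sigma>]) (use \<alpha>(3) sets(2) A(1) in auto)
        then have "sat M (map \<sigma> x @ c0 @ c) \<chi> = sat M (x @ c0 @ c) \<chi>" if "x \<in> pow_set S l" for x
          using sat_aut[OF auts_automorphism[OF \<sigma>] \<chi>' tuples_append[OF pow_tuples[OF that] cc]] by simp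
        then have "map \<sigma> t = t" using code \<sigma> auts_mono[OF A(1)] by blast
        then show "\<sigma> z = z" using z by (metis map_eq_conv map_ident)
      qed
    qed
    then have "t \<in> X" using X(2) t(1) by (auto simp: dcl_in_def)
    then have tU: "set t \<subseteq> ?U" by blast
    have "y \<in> dcl L M (C \<union> set (u @ t))"
    proof (rule fixed_in_dcl)
      show "small_set \<kappa> M (C \<union> set (u @ t))"
        by (rule small_Un_finite[OF small_C]) (use t(2) \<open>set u \<subseteq> universe M\<close> in auto)
      show "y \<in> universe M" using s(1) by (auto simp: universe_def)
      fix \<sigma> assume \<sigma>: "\<sigma> \<in> auts L M (C \<union> set (u @ t))"
      then have \<sigma>C: "\<sigma> \<in> auts L M C" using auts_mono[of C "C \<union> set (u @ t)" L M] by auto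
      have \<sigma>a: "automorphism L M \<sigma>" using \<sigma> by (rule auts_automorphism)
      have fx: "map \<sigma> u = u" "map \<sigma> t = t" "map \<sigma> c0 = c0"
        by (rule auts_fix_list[OF \<sigma>], use \<alpha>(3) in auto)+
      have "[y] \<in> {[y]}" by simp
      then have "sat M ([y] @ bs) \<phi>0" unfolding bs(4) by simp
      moreover have "[y] \<in> tuples M [s]" using s(1) by (simp add: tuples_Cons)
      ultimately have "sat M ([y] @ u @ c) \<phi>" using \<phi>(2) by blast
      then have "sat M (?v @ c) \<phi>" by simp
      moreover have "sat M (?v @ d @ c0) \<alpha>" using \<alpha>(4) by blast
      ultimately have "sat M (d @ c0 @ c) \<chi>" using \<chi>_sat[OF pow_tuples[OF d(1)]] v by blast
      then have "sat M (map \<sigma> d @ c0 @ c) \<chi>" using code[OF \<sigma>C] fx(2) d(1) by blast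
      then obtain w where w: "w \<in> tuples M ?\<Delta>" "sat M (w @ map \<sigma> d @ c0) \<alpha>" "sat M (w @ c) \<phi>"
        using \<chi>_sat[OF aut_tuples[OF \<sigma>a pow_tuples[OF d(1)]]] by blast
      obtain w' where w': "w' \<in> tuples M ?\<Delta>" "map \<sigma> w' = w" using aut_tuples_surj[OF \<sigma>a w(1)] by blast
      have "sat M (map \<sigma> (w' @ d @ c0)) \<alpha> = sat M (w' @ d @ c0) \<alpha>"
        by (rule sat_aut[OF \<sigma>a \<alpha>(1)]) (intro tuples_append w' pow_tuples[OF d(1)] \<alpha>(2))
      then have "sat M (w' @ d @ c0) \<alpha>" using w(2) w'(2) fx(3) by simp
      then have "w' = ?v" using \<alpha>(4) w'(1) by blast
      then have "w = \<sigma> y # u" using w'(2) fx(1) by simp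
      then have "sat M ([\<sigma> y] @ u @ c) \<phi>" "[\<sigma> y] \<in> tuples M [s]"
        using w(1,3) by (auto simp: tuples_Cons)
      then have "[\<sigma> y] \<in> {[y]}" using \<phi>(2) bs(4) by blast
      then show "\<sigma> y = y" by simp
    qed
    moreover have "C \<union> set (u @ t) \<subseteq> ?U \<union> C" using sets(1) tU by auto
    ultimately show ?thesis using dcl_mono by blast
  qed
  then have "e \<in> dcl_in L M ?Q (?U \<union> C)" using e(1) by (auto simp: dcl_in_def)
  then show ?thesis using X(1) unfolding dcl_closed_in_def by blast
qed

end

section \<open>Sequences of independent values\<close>

context stable_in_NIP
begin

text \<open>
  If the automorphism obtained for the values before \<open>e\<^sub>s\<close> happens to fix \<open>e\<^sub>s\<close>, compose it with one
  that moves \<open>e\<^sub>s\<close> and fixes the earlier values: this does not change its effect on them.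
\<close>

lemma move_all_from:
  fixes s :: nat
  assumes "\<And>j. j < s \<Longrightarrow> \<exists>\<sigma> \<in> auts L M A. (\<forall>i<j. map \<sigma> (e i) = e i) \<and> map \<sigma> (e j) \<noteq> e j"
    and "\<And>j. set (e j) \<subseteq> universe M" and "k \<le> s"
  shows "\<exists>\<tau> \<in> auts L M A. (\<forall>i<k. map \<tau> (e i) = e i) \<and> (\<forall>j. k \<le> j \<and> j < s \<longrightarrow> map \<tau> (e j) \<noteq> e j)"
  using assms(3,1)
proof (induction s rule: dec_induct)
  case base
  show ?case using id_auts by (intro bexI[of _ id]) auto
next
  case (step s)
  obtain \<tau> where \<tau>: "\<tau> \<in> auts L M A" "\<forall>i<k. map \<tau> (e i) = e i"
    "\<forall>j. k \<le> j \<and> j < s \<longrightarrow> map \<tau> (e j) \<noteq> e j"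
    using step.IH step.prems by (metis less_SucI)
  show ?case
  proof (cases "map \<tau> (e s) = e s")
    case False
    then show ?thesis using \<tau> by (auto simp: less_Suc_eq)
  next
    case True
    obtain \<sigma> where \<sigma>: "\<sigma> \<in> auts L M A" "\<forall>i<s. map \<sigma> (e i) = e i" "map \<sigma> (e s) \<noteq> e s"
      using step.prems by blast
    obtain \<Delta> where \<Delta>: "e s \<in> tuples M \<Delta>" using universe_tuples[OF assms(2)] by blast
    have same: "map (\<tau> \<circ> \<sigma>) (e i) = map \<tau> (e i)" if "i < s" for i
      using \<sigma>(2) that by (metis map_map)
    have "map (\<tau> \<circ> \<sigma>) (e s) \<noteq> e s"
    proof
      assume "map (\<tau> \<circ> \<sigma>) (e s) = e s"
      then have "map \<tau> (map \<sigma> (e s)) = map \<tau> (e s)" using True by simp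
      then show False
        using aut_tuples_inj[OF auts_automorphism[OF \<tau>(1)] aut_tuples[OF auts_automorphism[OF \<sigma>(1)] \<Delta>] \<Delta>] \<sigma>(3)
        by blast
    qed
    moreover have "\<tau> \<circ> \<sigma> \<in> auts L M A" using auts_comp \<tau>(1) \<sigma>(1) by blast
    moreover have "map (\<tau> \<circ> \<sigma>) (e i) = e i" if "i < k" for i
      using same[of i] \<tau>(2) that step.hyps by simp
    moreover have "map (\<tau> \<circ> \<sigma>) (e j) \<noteq> e j" if "k \<le> j" "j < s" for j
      using same[OF that(2)] \<tau>(3) that by metis
    ultimately show ?thesis
      by (intro bexI[of _ "\<tau> \<circ> \<sigma>"]) (auto simp only: less_Suc_eq)
  qed
qed

text \<open>
  The values \<open>e\<^sub>n\<close> enter only through \<open>\<theta>(d\<^sub>n, w\<^sub>n, y)\<close>, to be read as \<open>h(w\<^sub>n, y) = e\<^sub>n\<close>, where \<open>d\<^sub>n\<close>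
  is an element of a power of \<open>S\<close> from which \<open>e\<^sub>n\<close> is defined. The hypotheses \<open>fixed\<close> and \<open>moved\<close>
  express that \<open>h\<close> is a function of \<open>y\<close> and that a conjugate of \<open>d\<^sub>n\<close> defines the conjugate of \<open>e\<^sub>n\<close>.
  The proof shows that \<open>\<theta>\<close> shatters arbitrarily many of the pairs \<open>(d\<^sub>n, w\<^sub>n)\<close>, removing the indices
  from the pattern one at a time.
\<close>

lemma no_independent_sequence:
  fixes d w e :: "nat \<Rightarrow> 'm list"
  assumes CA: "C \<subseteq> A"
    and \<theta>: "wf_fm L (pow_sorts \<Gamma> l @ \<Delta>w @ \<Delta>a) \<theta>"
    and d: "\<And>n. d n \<in> pow_set S l" and w: "\<And>n. w n \<in> tuples M \<Delta>w" "\<And>n. set (w n) \<subseteq> A"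
    and a: "a \<in> tuples M \<Delta>a" "\<And>n. sat M (d n @ w n @ a) \<theta>"
    and fixed: "\<And>\<tau> n y. \<tau> \<in> auts L M A \<Longrightarrow> map \<tau> (e n) = e n \<Longrightarrow> y \<in> tuples M \<Delta>a \<Longrightarrow>
      sat M (map \<tau> (d n) @ w n @ y) \<theta> = sat M (d n @ w n @ y) \<theta>"
    and moved: "\<And>\<tau> n y. \<tau> \<in> auts L M A \<Longrightarrow> map \<tau> (e n) \<noteq> e n \<Longrightarrow> y \<in> tuples M \<Delta>a \<Longrightarrow>
      sat M (d n @ w n @ y) \<theta> \<Longrightarrow> \<not> sat M (map \<tau> (d n) @ w n @ y) \<theta>"
    and indep: "\<And>n. \<exists>\<sigma> \<in> auts L M A. (\<forall>m<n. map \<sigma> (e m) = e m) \<and> map \<sigma> (e n) \<noteq> e n"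
    and e: "\<And>n. set (e n) \<subseteq> universe M"
  shows False
proof -
  let ?P = "pow_sorts \<Gamma> l"
  have "has_IP M (?P @ \<Delta>w) \<Delta>a \<theta>"
    unfolding has_IP_def
  proof
    fix n :: nat
    define R where "R b f \<longleftrightarrow> (\<exists>y \<in> tuples M \<Delta>a. \<forall>i<n. sat M (d (f i) @ w (f i) @ y) \<theta> \<longleftrightarrow> i \<in> b)"
      for b :: "nat set" and f :: "nat \<Rightarrow> nat"
    have R_cong: "R b f = R b g" if "\<And>i. i < n \<Longrightarrow> f i = g i" for b f g
      using that by (auto simp: R_def)
    let ?\<Theta>x = "replicate n ?P" and ?\<Theta>z = "[?P, \<Delta>w] @ replicate n \<Delta>w"
    \<comment> \<open>The conditions of the pattern \<open>b\<close> at places other than \<open>p\<close> imply the positive condition at \<open>(d\<^sub>q, w\<^sub>q)\<close>,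
      whose two blocks have the indices \<open>n\<close> and \<open>n + 1\<close>.\<close>
    define Q where "Q b p xss \<longleftrightarrow> (\<forall>y \<in> tuples M \<Delta>a.
        (\<forall>i<n. i \<noteq> p \<longrightarrow> (sat M (concat (map ((!) (y # xss)) [Suc i, Suc (n + 2 + i), 0])) \<theta> \<longleftrightarrow> i \<in> b)) \<longrightarrow>
        sat M (concat (map ((!) (y # xss)) [Suc n, Suc (n + 1), 0])) \<theta>)"
      for b :: "nat set" and p :: nat and xss
    have Q_expr: "expressible L M (?\<Theta>x @ ?\<Theta>z) (Q b p)" for b p
      unfolding Q_def
      by (intro expressible_all expressible_imp expressible_all_less expressible_iff expressible_const expressible_fm)
        (use \<theta> in \<open>auto simp: nth_append\<close>)
    have Q_eval: "Q b p (Xs @ [u, v] @ Ws) \<longleftrightarrow> (\<forall>y \<in> tuples M \<Delta>a.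
        (\<forall>i<n. i \<noteq> p \<longrightarrow> (sat M (Xs ! i @ Ws ! i @ y) \<theta> \<longleftrightarrow> i \<in> b)) \<longrightarrow> sat M (u @ v @ y) \<theta>)"
      if "length Xs = n" for b p Xs u v Ws
      using that by (simp add: Q_def nth_append)
    have ex_bound: "\<exists>m. \<not> ladder (\<lambda>Xs Zs. Q b p (Xs @ Zs)) {Xs. length Xs = n \<and> set Xs \<subseteq> pow_set S l}
        (blocks M ?\<Theta>z) m" for b p
    proof -
      obtain \<rho> where \<rho>: "wf_fm L (concat (?\<Theta>x @ ?\<Theta>z)) \<rho>"
        "\<forall>xss\<in>blocks M (?\<Theta>x @ ?\<Theta>z). sat M (concat xss) \<rho> = Q b p xss"
        using Q_expr[of b p] unfolding expressible_def by (elim exE conjE)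
      have "wf_fm L (pow_sorts \<Gamma> (n * l) @ concat ?\<Theta>z) \<rho>"
        using \<rho>(1) by (simp only: concat_append pow_sorts_mult)
      then obtain m where m: "\<not> ladder (\<lambda>x z. sat M (x @ z) \<rho>) (pow_set S (n * l)) (tuples M (concat ?\<Theta>z)) m"
        using no_ladder by blast
      have "\<not> ladder (\<lambda>Xs Zs. Q b p (Xs @ Zs)) {Xs. length Xs = n \<and> set Xs \<subseteq> pow_set S l} (blocks M ?\<Theta>z) m"
      proof
        assume "ladder (\<lambda>Xs Zs. Q b p (Xs @ Zs)) {Xs. length Xs = n \<and> set Xs \<subseteq> pow_set S l} (blocks M ?\<Theta>z) m"
        then obtain X Z where XZ:
          "\<forall>i<m. X i \<in> {Xs. length Xs = n \<and> set Xs \<subseteq> pow_set S l} \<and> Z i \<in> blocks M ?\<Theta>z"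
          "\<forall>i<m. \<forall>j<m. Q b p (X i @ Z j) \<longleftrightarrow> i < j"
          unfolding ladder_def by (elim exE conjE)
        have "concat (X i) \<in> pow_set S (n * l) \<and> concat (Z i) \<in> tuples M (concat ?\<Theta>z)" if "i < m" for i
          using XZ(1) that pow_set_concat[of "X i" S l] blocks_concat by blast
        moreover have "sat M (concat (X i) @ concat (Z j)) \<rho> \<longleftrightarrow> i < j" if "i < m" "j < m" for i j
        proof -
          have "length (X i) = n" "set (X i) \<subseteq> pow_set S l" using XZ(1) that(1) by auto
          then have "X i \<in> blocks M ?\<Theta>x" using pow_tuples by (auto simp: blocks_iff dest!: nth_mem)
          then have "X i @ Z j \<in> blocks M (?\<Theta>x @ ?\<Theta>z)" using XZ(1) that(2) blocks_append by blast
          then have "sat M (concat (X i @ Z j)) \<rho> = Q b p (X i @ Z j)" using \<rho>(2) by blast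
          then show ?thesis using XZ(2) that by (simp only: concat_append)
        qed
        ultimately have "ladder (\<lambda>x z. sat M (x @ z) \<rho>) (pow_set S (n * l)) (tuples M (concat ?\<Theta>z)) m"
          unfolding ladder_def by (intro exI[of _ "\<lambda>i. concat (X i)"] exI[of _ "\<lambda>i. concat (Z i)"]) simp
        then show False using m by simp
      qed
      then show ?thesis by blast
    qed
    define bound where "bound b p = (SOME m. \<not> ladder (\<lambda>Xs Zs. Q b p (Xs @ Zs))
        {Xs. length Xs = n \<and> set Xs \<subseteq> pow_set S l} (blocks M ?\<Theta>z) m)" for b p
    have bound: "\<not> ladder (\<lambda>Xs Zs. Q b p (Xs @ Zs))
        {Xs. length Xs = n \<and> set Xs \<subseteq> pow_set S l} (blocks M ?\<Theta>z) (bound b p)" for b p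
      unfolding bound_def by (rule someI_ex) (rule ex_bound)
    define m where "m = Max ((\<lambda>(b, p). bound b p) ` (Pow {..<n} \<times> {..n}))"
    have m: "\<not> ladder (\<lambda>Xs Zs. Q b p (Xs @ Zs))
        {Xs. length Xs = n \<and> set Xs \<subseteq> pow_set S l} (blocks M ?\<Theta>z) m" if "b \<subseteq> {..<n}" "p < n" for b p
    proof -
      have "bound b p \<le> m" unfolding m_def by (rule Max_ge) (use that in force)+
      then show ?thesis using bound ladder_le by blast
    qed
    define K where "K = Pow (Pow {..<n})"
    have "finite K" by (simp add: K_def)
    from ramsey_sequences[OF this, of n "m + n"]
    obtain N where N: "\<And>col :: nat list \<Rightarrow> nat set set. \<forall>is. length is = n \<and> sorted_wrt (<) is \<and> set is \<subseteq> {..<N} \<longrightarrow> col is \<in> K \<Longrightarrow>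
      \<exists>h k. strict_mono_on {..<m + n} h \<and> h ` {..<m + n} \<subseteq> {..<N} \<and>
      (\<forall>is. length is = n \<and> sorted_wrt (<) is \<and> set is \<subseteq> {..<m + n} \<longrightarrow> col (map h is) = k)"
      by blast
    obtain h G where h: "strict_mono_on {..<m + n} h"
      and G: "\<forall>is. length is = n \<and> sorted_wrt (<) is \<and> set is \<subseteq> {..<m + n} \<longrightarrow>
        {b. b \<subseteq> {..<n} \<and> R b (\<lambda>i. map h is ! i)} = G"
      using N[of "\<lambda>is. {b. b \<subseteq> {..<n} \<and> R b (\<lambda>i. is ! i)}"] unfolding K_def by blast
    have G': "R b (\<lambda>i. h (f i)) \<longleftrightarrow> b \<in> G"
      if "b \<subseteq> {..<n}" "\<And>i. i < n \<Longrightarrow> f i < m + n" "\<And>i j. i < j \<Longrightarrow> j < n \<Longrightarrow> f i < f j" for b f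
    proof -
      let ?is = "map f [0..<n]"
      have "length ?is = n" "sorted_wrt (<) ?is" "set ?is \<subseteq> {..<m + n}"
        using that by (auto simp: sorted_wrt_iff_nth_less)
      then have "b \<in> G \<longleftrightarrow> R b (\<lambda>i. map h ?is ! i)" using G that(1) by blast
      also have "\<dots> = R b (\<lambda>i. h (f i))" by (rule R_cong) simp
      finally show ?thesis by blast
    qed
    have all: "b \<in> G" if "b \<subseteq> {..<n}" for b
      using that
    proof (induction "card ({..<n} - b)" arbitrary: b rule: less_induct)
      case less
      show ?case
      proof (cases "{..<n} - b = {}")
        case True
        then have "R b h" unfolding R_def using a by (intro bexI[of _ a]) auto
        then show ?thesis using G'[of b "\<lambda>i. i"] less(2) by simp
      next
        case False
        then obtain p where p: "p < n" "p \<notin> b" by blast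
        let ?b = "insert p b"
        have b: "?b \<subseteq> {..<n}" using less(2) p(1) by auto
        have "{..<n} - ?b \<subset> {..<n} - b" using p by auto
        then have "card ({..<n} - ?b) < card ({..<n} - b)" by (intro psubset_card_mono) auto
        then have bG: "?b \<in> G" using less(1)[OF _ b] by blast
        show ?thesis
        proof (rule ccontr)
          assume nG: "b \<notin> G"
          \<comment> \<open>The \<open>m\<close> indices from \<open>p\<close> on are candidates for the place \<open>p\<close> of the pattern.\<close>
          define J where "J q i = (if i < p then i else if i = p then q else m + i)" for q i :: nat
          have J: "R b0 (\<lambda>i. h (J (p + j) i)) \<longleftrightarrow> b0 \<in> G" if "b0 \<subseteq> {..<n}" "j < m" for b0 j
            by (rule G') (use that p in \<open>auto simp: J_def\<close>)
          let ?q = "\<lambda>j. h (p + j)"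
          have "\<exists>\<tau> \<in> auts L M A. (\<forall>i<k. map \<tau> (e (?q i)) = e (?q i)) \<and>
              (\<forall>j. k \<le> j \<and> j < m \<longrightarrow> map \<tau> (e (?q j)) \<noteq> e (?q j))" if "k \<le> m" for k
          proof (rule move_all_from[OF _ e that])
            fix j assume j: "j < m"
            obtain \<sigma> where "\<sigma> \<in> auts L M A" "\<forall>i<?q j. map \<sigma> (e i) = e i" "map \<sigma> (e (?q j)) \<noteq> e (?q j)"
              using indep by blast
            moreover have "?q i < ?q j" if "i < j" for i
              using strict_mono_on_less[OF h, of "p + i" "p + j"] that j p(1) by simp
            ultimately show "\<exists>\<sigma> \<in> auts L M A. (\<forall>i<j. map \<sigma> (e (?q i)) = e (?q i)) \<and> map \<sigma> (e (?q j)) \<noteq> e (?q j)"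
              by blast
          qed
          then obtain \<tau> where \<tau>: "\<And>k. k \<le> m \<Longrightarrow> \<tau> k \<in> auts L M A"
            "\<And>k i. k \<le> m \<Longrightarrow> i < k \<Longrightarrow> map (\<tau> k) (e (?q i)) = e (?q i)"
            "\<And>k j. k \<le> m \<Longrightarrow> k \<le> j \<Longrightarrow> j < m \<Longrightarrow> map (\<tau> k) (e (?q j)) \<noteq> e (?q j)"
            by metis
          have \<tau>C: "\<tau> k \<in> auts L M C" if "k \<le> m" for k using \<tau>(1)[OF that] auts_mono[OF CA] by blast
          let ?g = "\<lambda>i. h (J p i)"
          have "\<forall>k i. \<exists>x. k \<le> m \<longrightarrow> x \<in> pow_set S l \<and> map (\<tau> k) x = d (?g i)"
            using pow_set_surj[OF \<tau>C d] by blast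
          then obtain xb where xb: "\<And>k i. k \<le> m \<Longrightarrow> xb k i \<in> pow_set S l \<and> map (\<tau> k) (xb k i) = d (?g i)"
            by metis
          \<comment> \<open>The block of \<open>X k\<close> at \<open>p\<close> is a dummy.\<close>
          define X where "X k = map (xb k) [0..<n]" for k
          define Ws where "Ws = map (\<lambda>i. w (?g i)) [0..<n]"
          define Z where "Z j = [d (?q j), w (?q j)] @ Ws" for j
          have Ws: "Ws \<in> blocks M (replicate n \<Delta>w)" using w(1) by (auto simp: blocks_iff Ws_def)
          have Z: "Z j \<in> blocks M ?\<Theta>z" for j
            unfolding Z_def using Ws w(1) pow_tuples[OF d] by (simp add: blocks_Cons)
          have X: "X k \<in> {Xs. length Xs = n \<and> set Xs \<subseteq> pow_set S l}" if "k \<le> m" for k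
            using xb[OF that] by (auto simp: X_def)
          have main: "Q b p (X k @ Z j) \<longleftrightarrow> j < k" if "k \<le> m" "j < m" for k j
          proof -
            have \<tau>k: "\<tau> k \<in> auts L M A" "automorphism L M (\<tau> k)"
              using \<tau>(1)[OF that(1)] auts_automorphism by blast+
            have "X k \<in> blocks M ?\<Theta>x" using X[OF that(1)] pow_tuples by (auto simp: blocks_iff dest!: nth_mem)
            then have "X k @ Z j \<in> blocks M (?\<Theta>x @ ?\<Theta>z)" using Z blocks_append by blast
            then have "Q b p (X k @ Z j) = Q b p (map (map (\<tau> k)) (X k @ Z j))"
              by (rule expressible_aut[OF \<tau>k(2) Q_expr, symmetric])
            also have "map (map (\<tau> k)) (X k @ Z j) =
                map (\<lambda>i. d (?g i)) [0..<n] @ [map (\<tau> k) (d (?q j)), w (?q j)] @ Ws"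
              using xb[OF that(1)] auts_fix_list[OF \<tau>k(1) w(2)] by (simp add: X_def Z_def Ws_def)
            also have "Q b p \<dots> \<longleftrightarrow> (\<forall>y \<in> tuples M \<Delta>a.
                (\<forall>i<n. i \<noteq> p \<longrightarrow> (sat M (d (?g i) @ w (?g i) @ y) \<theta> \<longleftrightarrow> i \<in> b)) \<longrightarrow>
                sat M (map (\<tau> k) (d (?q j)) @ w (?q j) @ y) \<theta>)"
              by (subst Q_eval) (auto simp: Ws_def)
            also have "\<dots> \<longleftrightarrow> j < k"
            proof (cases "j < k")
              case True
              have "sat M (map (\<tau> k) (d (?q j)) @ w (?q j) @ y) \<theta>"
                if y: "y \<in> tuples M \<Delta>a" "\<forall>i<n. i \<noteq> p \<longrightarrow> (sat M (d (?g i) @ w (?g i) @ y) \<theta> \<longleftrightarrow> i \<in> b)" for y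
              proof (rule ccontr)
                assume "\<not> sat M (map (\<tau> k) (d (?q j)) @ w (?q j) @ y) \<theta>"
                then have "\<not> sat M (d (?q j) @ w (?q j) @ y) \<theta>"
                  using fixed[OF \<tau>k(1) \<tau>(2)[OF \<open>k \<le> m\<close> True] y(1)] by simp
                then have "\<forall>i<n. sat M (d (h (J (p + j) i)) @ w (h (J (p + j) i)) @ y) \<theta> \<longleftrightarrow> i \<in> b"
                  using y(2) p(2) by (auto simp: J_def)
                then have "R b (\<lambda>i. h (J (p + j) i))" using y(1) by (auto simp: R_def)
                then show False using J[OF less(2) \<open>j < m\<close>] nG by simp
              qed
              then show ?thesis using True by blast
            next
              case False
              have "R ?b (\<lambda>i. h (J (p + j) i))" using J[OF b \<open>j < m\<close>] bG by simp
              then obtain y where y: "y \<in> tuples M \<Delta>a"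
                "\<forall>i<n. sat M (d (h (J (p + j) i)) @ w (h (J (p + j) i)) @ y) \<theta> \<longleftrightarrow> i \<in> ?b"
                by (auto simp: R_def)
              have "\<forall>i<n. i \<noteq> p \<longrightarrow> (sat M (d (?g i) @ w (?g i) @ y) \<theta> \<longleftrightarrow> i \<in> b)"
                using y(2) by (auto simp: J_def)
              moreover have "sat M (d (?q j) @ w (?q j) @ y) \<theta>"
                using y(2)[rule_format, of p] p(1) by (simp add: J_def)
              then have "\<not> sat M (map (\<tau> k) (d (?q j)) @ w (?q j) @ y) \<theta>"
                using moved[OF \<tau>k(1) \<tau>(3)[OF \<open>k \<le> m\<close> _ \<open>j < m\<close>] y(1)] False by simp
              ultimately show ?thesis using y(1) False by blast
            qed
            finally show ?thesis .
          qed
          have "(Q b p (X (m - 1 - i) @ Z (m - 1 - j))) = (i < j)" if "i < m" "j < m" for i j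
            using main[of "m - 1 - i" "m - 1 - j"] that by auto
          moreover have "X (m - 1 - i) \<in> {Xs. length Xs = n \<and> set Xs \<subseteq> pow_set S l}" for i
            by (rule X) simp
          ultimately have "ladder (\<lambda>Xs Zs. Q b p (Xs @ Zs)) {Xs. length Xs = n \<and> set Xs \<subseteq> pow_set S l}
              (blocks M ?\<Theta>z) m"
            using Z unfolding ladder_def
            by (intro exI[of _ "\<lambda>i. X (m - 1 - i)"] exI[of _ "\<lambda>j. Z (m - 1 - j)"]) blast
          then show False using m[OF less(2) p(1)] by blast
        qed
      qed
    qed
    show "\<exists>a. (\<forall>i<n. a i \<in> tuples M (?P @ \<Delta>w)) \<and>
        (\<forall>I\<subseteq>{..<n}. \<exists>b\<in>tuples M \<Delta>a. \<forall>i<n. sat M (a i @ b) \<theta> = (i \<in> I))"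
    proof (intro exI[of _ "\<lambda>i. d (h i) @ w (h i)"] conjI allI impI)
      show "d (h i) @ w (h i) \<in> tuples M (?P @ \<Delta>w)" for i by (intro tuples_append pow_tuples[OF d] w)
      fix I assume I: "I \<subseteq> {..<n}"
      then have "R I h" using G'[of I "\<lambda>i. i"] all by simp
      then show "\<exists>b\<in>tuples M \<Delta>a. \<forall>i<n. sat M ((d (h i) @ w (h i)) @ b) \<theta> = (i \<in> I)" by (simp add: R_def)
    qed
  qed
  moreover have "wf_fm L ((?P @ \<Delta>w) @ \<Delta>a) \<theta>" using \<theta> by simp
  ultimately show False using NIP unfolding NIP_def by blast
qed

end

section \<open>Counting formulas\<close>

lemma card_finite_le_infinite:
  assumes "finite A" "infinite B"
  shows "|A| \<le>o |B|"
proof -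
  have "|A| <o natLeq" using assms(1) by (simp add: finite_iff_ordLess_natLeq)
  moreover have "natLeq \<le>o |B|" using assms(2) infinite_iff_natLeq_ordLeq by blast
  ultimately show ?thesis by (rule ordLess_imp_ordLeq[OF ordLess_ordLeq_trans])
qed

lemma wf_fold_Ex: "wf_fm L [] (fold Ex \<Gamma> \<phi>) \<longleftrightarrow> wf_fm L \<Gamma> \<phi>"
proof (induction \<Gamma> rule: rev_induct)
  case (snoc s \<Gamma>)
  have "wf_fm L \<Delta> (fold Ex \<Gamma> \<phi>) \<longleftrightarrow> wf_fm L (\<Gamma> @ \<Delta>) \<phi>" for \<Gamma> \<Delta> and \<phi> :: "('a, 'b, 'c) fm"
    by (induction \<Gamma> arbitrary: \<phi>) auto
  then show ?case by (metis append_Nil2)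
qed simp

lemma fold_Ex_inject:
  "length \<Gamma> = length \<Delta> \<Longrightarrow> fold Ex \<Gamma> \<phi> = fold Ex \<Delta> \<psi> \<Longrightarrow> \<Gamma> = \<Delta> \<and> \<phi> = \<psi>"
proof (induction \<Gamma> \<Delta> arbitrary: \<phi> \<psi> rule: list_induct2)
  case (Cons x xs y ys)
  then show ?case by fastforce
qed simp

context monster
begin

lemma card_Times_le_T:
  assumes "|A| \<le>o |T|" "|B| \<le>o |T|"
  shows "|A \<times> B| \<le>o |T|"
  by (rule card_of_Times_ordLeq_infinite_Field)
    (use assms infinite_T in \<open>simp_all add: Field_card_of card_of_card_order_on\<close>)

lemma nat_le_T: "|UNIV :: nat set| \<le>o |T|"
  using infinite_T infinite_iff_card_of_nat by blast

text \<open>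
  A formula is determined by its existential closure together with the number of its variables,
  and \<open>T\<close> contains every sentence or its negation.
\<close>

lemma card_formulas: "|{(\<Gamma>, \<phi>). wf_fm L \<Gamma> \<phi>}| \<le>o |T|"
proof -
  define g where "g = (\<lambda>(\<Gamma>, \<phi>). (length \<Gamma>, fold Ex \<Gamma> \<phi> \<in> T,
    if fold Ex \<Gamma> \<phi> \<in> T then fold Ex \<Gamma> \<phi> else Neg (fold Ex \<Gamma> \<phi>)))"
  have "inj_on g {(\<Gamma>, \<phi>). wf_fm L \<Gamma> \<phi>}"
    unfolding g_def inj_on_def by (auto split: if_splits dest: fold_Ex_inject)
  moreover have "\<psi> \<in> T \<or> Neg \<psi> \<in> T" if "wf_fm L [] \<psi>" for \<psi>
    using complete that unfolding complete_theory_def by blast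
  then have "fold Ex \<Gamma> \<phi> \<in> T \<or> Neg (fold Ex \<Gamma> \<phi>) \<in> T" if "wf_fm L \<Gamma> \<phi>" for \<Gamma> \<phi>
    using wf_fold_Ex that by blast
  then have "g ` {(\<Gamma>, \<phi>). wf_fm L \<Gamma> \<phi>} \<subseteq> UNIV \<times> UNIV \<times> T"
    unfolding g_def by (force simp: image_subset_iff)
  ultimately have "|{(\<Gamma>, \<phi>). wf_fm L \<Gamma> \<phi>}| \<le>o |(UNIV :: nat set) \<times> (UNIV :: bool set) \<times> T|"
    by (metis card_of_ordLeq)
  moreover have "|(UNIV :: nat set) \<times> (UNIV :: bool set) \<times> T| \<le>o |T|"
    by (rule card_Times_le_T[OF nat_le_T card_Times_le_T[OF card_finite_le_infinite[OF _ infinite_T]]])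
      (simp_all add: card_of_refl ordIso_imp_ordLeq)
  ultimately show ?thesis by (rule ordLeq_transitive)
qed

end

lemma infinite_increasing_sequence:
  assumes r: "Well_order r" and I: "I \<subseteq> Field r" "infinite I"
  shows "\<exists>f :: nat \<Rightarrow> _. (\<forall>n. f n \<in> I) \<and> (\<forall>m n. m < n \<longrightarrow> (f m, f n) \<in> r \<and> f m \<noteq> f n)"
proof -
  have wo: "wo_rel r" using r by (simp add: wo_rel_def)
  define G where "G n = ((\<lambda>J. J - {wo_rel.minim r J}) ^^ n) I" for n :: nat
  define f where "f n = wo_rel.minim r (G n)" for n
  have G_Suc: "G (Suc n) = G n - {f n}" for n by (simp add: G_def f_def)
  have G: "G n \<subseteq> I \<and> infinite (G n)" for n
  proof (induction n)
    case 0
    show ?case using I by (simp add: G_def)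
  next
    case (Suc n)
    then show ?case unfolding G_Suc by auto
  qed
  have f: "f n \<in> G n" for n
    unfolding f_def by (rule wo_rel.minim_in[OF wo]) (use G[of n] I in auto)
  have anti: "G n \<subseteq> G m" if "m \<le> n" for m n
    using that by (induction n rule: dec_induct) (auto simp: G_Suc)
  have "(f m, f n) \<in> r \<and> f m \<noteq> f n" if "m < n" for m n
  proof -
    have "f n \<in> G (Suc m)" using f anti[of "Suc m" n] that by auto
    then have "f n \<in> G m" "f n \<noteq> f m" by (auto simp: G_Suc)
    moreover have "(f m, f n) \<in> r"
      unfolding f_def[of m] by (rule wo_rel.minim_least[OF wo]) (use calculation G[of m] I in auto)
    ultimately show ?thesis by simp
  qed
  then show ?thesis using f G by blast
qed

section \<open>Chains in \<open>S\<^sup>e\<^sup>q\<close>\<close>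

context stable_in_NIP
begin

text \<open>
  How a point \<open>e\<close> of \<open>S\<^sup>e\<^sup>q \<inter> dcl(A a)\<close> is tied to \<open>a\<close>: if \<open>\<alpha>(x, d)\<close> defines \<open>e\<close> from \<open>d\<close> in \<open>S\<close> and
  \<open>\<eta>(x, a)\<close> defines it over \<open>A a\<close>, then \<open>\<theta>(d, y)\<close> says that \<open>\<alpha>(x, d)\<close> and \<open>\<eta>(x, y)\<close> are equivalent.
\<close>

definition defines_over ::
  "'m set \<Rightarrow> 's list \<Rightarrow> 'm list \<Rightarrow> nat \<Rightarrow> 's list \<Rightarrow> ('s, 'f, 'r) fm \<Rightarrow> 'm list \<Rightarrow> 'm list \<Rightarrow> 'm list \<Rightarrow> bool" where
  "defines_over A \<Delta>a a l \<Delta>w \<theta> e d w \<longleftrightarrow>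
     wf_fm L (pow_sorts \<Gamma> l @ \<Delta>w @ \<Delta>a) \<theta> \<and> d \<in> pow_set S l \<and> w \<in> tuples M \<Delta>w \<and> set w \<subseteq> A \<and>
     sat M (d @ w @ a) \<theta> \<and>
     (\<forall>\<tau> \<in> auts L M A. \<forall>y \<in> tuples M \<Delta>a. sat M (d @ w @ y) \<theta> \<and> map \<tau> e \<noteq> e \<longrightarrow> \<not> sat M (map \<tau> d @ w @ y) \<theta>) \<and>
     (\<forall>\<tau> \<in> auts L M A. \<forall>y \<in> tuples M \<Delta>a. map \<tau> e = e \<longrightarrow> sat M (map \<tau> d @ w @ y) \<theta> = sat M (d @ w @ y) \<theta>)"

lemma ex_defines_over:
  assumes A: "C \<subseteq> A" "small_set \<kappa> M A" and a: "a \<in> tuples M \<Delta>a"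
    and e: "e \<in> Seq L M C \<Gamma> S" "set e \<subseteq> dcl L M (A \<union> set a)"
  shows "\<exists>l \<Delta>w \<theta> d w. defines_over A \<Delta>a a l \<Delta>w \<theta> e d w"
proof -
  obtain l d where d: "d \<in> pow_set S l" "set e \<subseteq> dcl L M (set d \<union> C)" using in_SeqE[OF e(1)] .
  obtain \<Delta>e where \<Delta>e: "e \<in> tuples M \<Delta>e"
    using universe_tuples[OF subset_trans[OF e(2) dcl_universe]] by (elim exE)
  obtain \<Delta>0 c0 \<alpha> where \<alpha>: "wf_fm L (\<Delta>e @ pow_sorts \<Gamma> l @ \<Delta>0) \<alpha>" "c0 \<in> tuples M \<Delta>0" "set c0 \<subseteq> C"
    "{e} = {xs \<in> tuples M \<Delta>e. sat M (xs @ d @ c0) \<alpha>}"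
    using definable_split[OF dcl_definable[OF small_pow[OF d(1)] \<Delta>e d(2)] pow_tuples[OF d(1)]] by blast
  have "small_set \<kappa> M (set a \<union> A)" by (rule small_list[OF A(2) tuples_universe[OF a]])
  moreover have "set e \<subseteq> dcl L M (set a \<union> A)" using e(2) by (simp add: Un_commute)
  ultimately obtain \<Delta>1 c1 \<eta> where \<eta>: "wf_fm L (\<Delta>e @ \<Delta>a @ \<Delta>1) \<eta>" "c1 \<in> tuples M \<Delta>1" "set c1 \<subseteq> A"
    "{e} = {xs \<in> tuples M \<Delta>e. sat M (xs @ a @ c1) \<eta>}"
    using definable_split[OF dcl_definable[OF _ \<Delta>e] a] by blast
  have "expressible L M [pow_sorts \<Gamma> l, \<Delta>0, \<Delta>1, \<Delta>a] (\<lambda>xss. \<forall>x \<in> tuples M \<Delta>e.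
      sat M (concat (map ((!) (x # xss)) [0, 4, 3])) \<eta> \<longleftrightarrow> sat M (concat (map ((!) (x # xss)) [0, 1, 2])) \<alpha>)"
    by (intro expressible_all expressible_iff expressible_fm) (use \<alpha>(1) \<eta>(1) in auto)
  then obtain \<theta> where \<theta>: "wf_fm L (concat [pow_sorts \<Gamma> l, \<Delta>0, \<Delta>1, \<Delta>a]) \<theta>"
    "\<forall>xss \<in> blocks M [pow_sorts \<Gamma> l, \<Delta>0, \<Delta>1, \<Delta>a]. sat M (concat xss) \<theta> = (\<forall>x \<in> tuples M \<Delta>e.
      sat M (concat (map ((!) (x # xss)) [0, 4, 3])) \<eta> \<longleftrightarrow> sat M (concat (map ((!) (x # xss)) [0, 1, 2])) \<alpha>)"
    unfolding expressible_def by (elim exE conjE)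
  let ?w = "c0 @ c1"
  have \<theta>_sat: "sat M (u @ ?w @ y) \<theta> \<longleftrightarrow>
      (\<forall>x \<in> tuples M \<Delta>e. sat M (x @ y @ c1) \<eta> \<longleftrightarrow> sat M (x @ u @ c0) \<alpha>)"
    if "u \<in> tuples M (pow_sorts \<Gamma> l)" "y \<in> tuples M \<Delta>a" for u y
    using \<theta>(2)[rule_format, of "[u, c0, c1, y]"] that \<alpha>(2) \<eta>(2) by (simp add: blocks_Cons)
  have \<alpha>_iff: "sat M (x @ map \<tau> d @ c0) \<alpha> \<longleftrightarrow> x = map \<tau> e"
    if \<tau>: "\<tau> \<in> auts L M A" and x: "x \<in> tuples M \<Delta>e" for \<tau> x
  proof -
    have \<tau>a: "automorphism L M \<tau>" using \<tau> by (rule auts_automorphism)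
    obtain x' where x': "x' \<in> tuples M \<Delta>e" "map \<tau> x' = x" using aut_tuples_surj[OF \<tau>a x] by blast
    have "map \<tau> c0 = c0" by (rule auts_fix_list[OF \<tau>]) (use \<alpha>(3) A(1) in auto)
    moreover have "sat M (map \<tau> (x' @ d @ c0)) \<alpha> = sat M (x' @ d @ c0) \<alpha>"
      by (rule sat_aut[OF \<tau>a \<alpha>(1)]) (intro tuples_append x' pow_tuples[OF d(1)] \<alpha>(2))
    ultimately have "sat M (x @ map \<tau> d @ c0) \<alpha> = sat M (x' @ d @ c0) \<alpha>" using x'(2) by simp
    also have "\<dots> \<longleftrightarrow> x' = e" using \<alpha>(4) x'(1) by blast
    also have "\<dots> \<longleftrightarrow> x = map \<tau> e" using aut_tuples_inj[OF \<tau>a x'(1) \<Delta>e] x'(2) by blast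
    finally show ?thesis .
  qed
  have \<theta>_iff: "sat M (map \<tau> d @ ?w @ y) \<theta> \<longleftrightarrow> (\<forall>x \<in> tuples M \<Delta>e. sat M (x @ y @ c1) \<eta> \<longleftrightarrow> x = map \<tau> e)"
    if "\<tau> \<in> auts L M A" "y \<in> tuples M \<Delta>a" for \<tau> y
    using \<theta>_sat[OF aut_tuples[OF auts_automorphism[OF that(1)] pow_tuples[OF d(1)]] that(2)]
      \<alpha>_iff[OF that(1)] by simp
  have \<theta>_id: "sat M (d @ ?w @ y) \<theta> \<longleftrightarrow> (\<forall>x \<in> tuples M \<Delta>e. sat M (x @ y @ c1) \<eta> \<longleftrightarrow> x = e)"
    if "y \<in> tuples M \<Delta>a" for y
    using \<theta>_iff[OF id_auts that] by simp
  have "defines_over A \<Delta>a a l (\<Delta>0 @ \<Delta>1) \<theta> e d ?w"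
    unfolding defines_over_def
  proof (intro conjI ballI impI)
    show "wf_fm L (pow_sorts \<Gamma> l @ (\<Delta>0 @ \<Delta>1) @ \<Delta>a) \<theta>" using \<theta>(1) by simp
    show "?w \<in> tuples M (\<Delta>0 @ \<Delta>1)" using \<alpha>(2) \<eta>(2) by (rule tuples_append)
    show "set ?w \<subseteq> A" using \<alpha>(3) \<eta>(3) A(1) by auto
    show "sat M (d @ ?w @ a) \<theta>" using \<theta>_id[OF a] \<eta>(4) by blast
    fix \<tau> y assume \<tau>: "\<tau> \<in> auts L M A" and y: "y \<in> tuples M \<Delta>a"
    have \<tau>e: "map \<tau> e \<in> tuples M \<Delta>e" by (rule aut_tuples[OF auts_automorphism[OF \<tau>] \<Delta>e])
    show "sat M (map \<tau> d @ ?w @ y) \<theta> = sat M (d @ ?w @ y) \<theta>" if "map \<tau> e = e"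
      unfolding \<theta>_iff[OF \<tau> y] \<theta>_id[OF y] that ..
    show "\<not> sat M (map \<tau> d @ ?w @ y) \<theta>" if "sat M (d @ ?w @ y) \<theta> \<and> map \<tau> e \<noteq> e"
      using that \<theta>_iff[OF \<tau> y] \<theta>_id[OF y] \<tau>e by blast
  qed (rule d(1))
  then show ?thesis by blast
qed

text \<open>
  The index set, an infinite successor cardinal, has no last element and has more elements than
  there are formulas, so infinitely many steps of the chain use the same formula.
\<close>

theorem bounded_stabilizing_Seq: "bounded_stabilizing \<kappa> L T M C (Seq L M C \<Gamma> S)"
  unfolding bounded_stabilizing_def
proof (intro allI impI notI, elim exE conjE)
  fix A a X
  let ?r = "cardSuc ( |T| +c |C| )" and ?Q = "Seq L M C \<Gamma> S"
  assume CA: "C \<subseteq> A" and smallA: "small_set \<kappa> M A" and aU: "set a \<subseteq> universe M"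
    and X: "\<forall>i \<in> Field ?r. dcl_closed_in L M C ?Q (X i) \<and> dcl_in L M ?Q A \<subseteq> X i \<and> X i \<subseteq> dcl_in L M ?Q (A \<union> set a)"
    and chain: "\<forall>i j. (i, j) \<in> ?r \<longrightarrow> i \<noteq> j \<longrightarrow> X i \<subset> X j"
  obtain \<Delta>a where a: "a \<in> tuples M \<Delta>a" using universe_tuples[OF aU] by (elim exE)
  have co: "Card_order ( |T| +c |C| )" by (rule Card_order_csum)
  have r: "Card_order ?r" by (rule cardSuc_Card_order[OF co])
  then have wo: "Well_order ?r" by (simp add: card_order_on_well_order_on)
  have TC: "|T| +c |C| = |T <+> C|" by (simp add: csum_def Field_card_of)
  have infTC: "infinite (T <+> C)" using infinite_T by simp
  have infr: "infinite (Field ?r)"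
    using cardSuc_finite[OF co] infTC by (simp add: TC Field_card_of)
  have mono: "X i \<subseteq> X j" if "(i, j) \<in> ?r" for i j using chain that by blast
  \<comment> \<open>\<open>nxt\<close> is the successor of an index.\<close>
  define later where "later i = {j \<in> Field ?r. j \<noteq> i \<and> (i, j) \<in> ?r}" for i
  define nxt where "nxt i = wo_rel.minim ?r (later i)" for i
  have wor: "wo_rel ?r" using wo by (simp add: wo_rel_def)
  have nxt: "(i, nxt i) \<in> ?r" "i \<noteq> nxt i" "nxt i \<in> Field ?r" if "i \<in> Field ?r" for i
  proof -
    have "later i \<noteq> {}" using infinite_Card_order_limit[OF r infr that] by (auto simp: later_def)
    then have "nxt i \<in> later i"
      unfolding nxt_def by (intro wo_rel.minim_in[OF wor]) (auto simp: later_def)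
    then show "(i, nxt i) \<in> ?r" "i \<noteq> nxt i" "nxt i \<in> Field ?r" by (auto simp: later_def)
  qed
  have nxt_le: "(nxt i, j) \<in> ?r" if "(i, j) \<in> ?r" "i \<noteq> j" for i j
    unfolding nxt_def
    by (rule wo_rel.minim_least[OF wor]) (use that in \<open>auto simp: later_def Field_def\<close>)
  define e where "e i = (SOME x. x \<in> X (nxt i) - X i)" for i
  have e: "e i \<in> X (nxt i) - X i" if "i \<in> Field ?r" for i
  proof -
    have "X i \<subset> X (nxt i)" by (rule chain[rule_format, OF nxt(1,2)[OF that]])
    then have "\<exists>x. x \<in> X (nxt i) - X i" by auto
    then show ?thesis unfolding e_def by (rule someI_ex)
  qed
  have eQ: "e i \<in> ?Q" "set (e i) \<subseteq> dcl L M (A \<union> set a)" if "i \<in> Field ?r" for i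
    using X nxt[OF that] e[OF that] unfolding dcl_in_def by auto
  have "\<forall>i. \<exists>key d w. i \<in> Field ?r \<longrightarrow>
      (case key of (l, \<Delta>w, \<theta>) \<Rightarrow> defines_over A \<Delta>a a l \<Delta>w \<theta> (e i) d w)"
  proof
    fix i
    show "\<exists>key d w. i \<in> Field ?r \<longrightarrow> (case key of (l, \<Delta>w, \<theta>) \<Rightarrow> defines_over A \<Delta>a a l \<Delta>w \<theta> (e i) d w)"
    proof (cases "i \<in> Field ?r")
      case True
      then obtain l \<Delta>w \<theta> d w where "defines_over A \<Delta>a a l \<Delta>w \<theta> (e i) d w"
        using ex_defines_over[OF CA smallA a eQ] by blast
      then show ?thesis by (intro exI[of _ "(l, \<Delta>w, \<theta>)"] exI[of _ d] exI[of _ w]) simp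
    qed simp
  qed
  then obtain key d w where key: "\<And>i. i \<in> Field ?r \<Longrightarrow>
      (case key i of (l, \<Delta>w, \<theta>) \<Rightarrow> defines_over A \<Delta>a a l \<Delta>w \<theta> (e i) (d i) (w i))"
    by metis
  define Keys where "Keys = {(l, \<Delta>w, \<theta>). wf_fm L (pow_sorts \<Gamma> l @ \<Delta>w @ \<Delta>a) \<theta>}"
  have key_in: "key i \<in> Keys" if "i \<in> Field ?r" for i
    using key[OF that] by (auto simp: Keys_def defines_over_def split: prod.splits)
  have "|Keys| \<le>o |T <+> C|"
  proof -
    let ?F = "{(\<Gamma>, \<phi>). wf_fm L \<Gamma> \<phi>}"
    define g where "g = (\<lambda>(l :: nat, \<Delta>w, \<theta> :: ('s, 'f, 'r) fm). (l, pow_sorts \<Gamma> l @ \<Delta>w @ \<Delta>a, \<theta>))"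
    have "inj_on g Keys" "g ` Keys \<subseteq> UNIV \<times> ?F" by (auto simp: inj_on_def g_def Keys_def)
    then have "|Keys| \<le>o |(UNIV :: nat set) \<times> ?F|" by (metis card_of_ordLeq)
    also have "|(UNIV :: nat set) \<times> ?F| \<le>o |T|"
      by (intro card_Times_le_T nat_le_T card_formulas)
    also have "|T| \<le>o |T <+> C|" by (rule card_of_Plus1)
    finally show ?thesis .
  qed
  have "\<exists>k. infinite {i \<in> Field ?r. key i = k}"
  proof (rule ccontr)
    assume "\<nexists>k. infinite {i \<in> Field ?r. key i = k}"
    then have "\<forall>k\<in>Keys. |{i \<in> Field ?r. key i = k}| \<le>o |T <+> C|"
      using card_finite_le_infinite[OF _ infTC] by blast
    then have "|\<Union>k\<in>Keys. {i \<in> Field ?r. key i = k}| \<le>o |T <+> C|"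
      by (rule card_of_UNION_ordLeq_infinite[OF infTC \<open>|Keys| \<le>o |T <+> C|\<close>])
    moreover have "(\<Union>k\<in>Keys. {i \<in> Field ?r. key i = k}) = Field ?r" using key_in by auto
    ultimately have "|Field ?r| \<le>o |T <+> C|" by simp
    then have "?r \<le>o |T| +c |C|"
      unfolding TC using card_of_Field_ordIso[OF r] ordIso_symmetric ordIso_ordLeq_trans TC by metis
    then show False using cardSuc_greater[OF co] not_ordLess_ordLeq by blast
  qed
  then obtain k where k: "infinite {i \<in> Field ?r. key i = k}" by blast
  obtain l \<Delta>w \<theta> where k_eq: "k = (l, \<Delta>w, \<theta>)" by (cases k)
  obtain f :: "nat \<Rightarrow> _" where f: "\<And>n. f n \<in> {i \<in> Field ?r. key i = k}"
    "\<And>m n. m < n \<Longrightarrow> (f m, f n) \<in> ?r \<and> f m \<noteq> f n"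
    using infinite_increasing_sequence[OF wo _ k] by blast
  have fr: "f n \<in> Field ?r" for n using f(1) by blast
  have def: "defines_over A \<Delta>a a l \<Delta>w \<theta> (e (f n)) (d (f n)) (w (f n))" for n
    using key[OF fr[of n]] f(1)[of n] k_eq by auto
  have eU: "set (e (f n)) \<subseteq> universe M" for n by (rule subset_trans[OF eQ(2)[OF fr] dcl_universe])
  have indep: "\<exists>\<sigma> \<in> auts L M A. (\<forall>m<n. map \<sigma> (e (f m)) = e (f m)) \<and> map \<sigma> (e (f n)) \<noteq> e (f n)" for n
  proof -
    let ?F = "\<Union>m<n. set (e (f m))"
    have "e (f m) \<in> X (f n)" if "m < n" for m
    proof -
      have "X (nxt (f m)) \<subseteq> X (f n)" using f(2)[OF that] by (intro mono nxt_le) auto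
      then show ?thesis using e[OF fr[of m]] by auto
    qed
    then have F: "?F \<subseteq> \<Union>(set ` X (f n))" by blast
    have smallF: "small_set \<kappa> M (A \<union> ?F)" by (rule small_Un_finite[OF smallA]) (use eU in auto)
    have "dcl_closed_in L M C ?Q (X (f n))" "dcl_in L M ?Q A \<subseteq> X (f n)" using X fr[of n] by auto
    from closed_over_parameters[OF CA smallA this eQ(1)[OF fr]]
    have "\<not> set (e (f n)) \<subseteq> dcl L M (A \<union> \<Union>(set ` X (f n)))" using e[OF fr[of n]] by auto
    moreover have "dcl L M (A \<union> ?F) \<subseteq> dcl L M (A \<union> \<Union>(set ` X (f n)))"
      by (rule dcl_mono) (use F in blast)
    ultimately obtain y where y: "y \<in> set (e (f n))" "y \<notin> dcl L M (A \<union> ?F)" by blast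
    then obtain \<sigma> where \<sigma>: "\<sigma> \<in> auts L M (A \<union> ?F)" "\<sigma> y \<noteq> y"
      using fixed_in_dcl[OF smallF, of y] eU[of n] by auto
    have "map \<sigma> (e (f m)) = e (f m)" if "m < n" for m
      by (rule auts_fix_list[OF \<sigma>(1)]) (use that in auto)
    moreover have "map \<sigma> (e (f n)) \<noteq> e (f n)" using y(1) \<sigma>(2) by (metis map_eq_conv map_ident)
    moreover have "\<sigma> \<in> auts L M A" using \<sigma>(1) auts_mono[of A "A \<union> ?F" L M] by blast
    ultimately show ?thesis by blast
  qed
  show False
  proof (rule no_independent_sequence[OF CA, of l \<Delta>w \<Delta>a \<theta> "\<lambda>n. d (f n)" "\<lambda>n. w (f n)" a "\<lambda>n. e (f n)"])
    fix \<tau> n y assume "\<tau> \<in> auts L M A" "y \<in> tuples M \<Delta>a"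
    then show "map \<tau> (e (f n)) = e (f n) \<Longrightarrow>
        sat M (map \<tau> (d (f n)) @ w (f n) @ y) \<theta> = sat M (d (f n) @ w (f n) @ y) \<theta>"
      and "map \<tau> (e (f n)) \<noteq> e (f n) \<Longrightarrow> sat M (d (f n) @ w (f n) @ y) \<theta> \<Longrightarrow>
        \<not> sat M (map \<tau> (d (f n)) @ w (f n) @ y) \<theta>"
      using def[of n] unfolding defines_over_def by blast+
  qed (use def indep eU a in \<open>auto simp: defines_over_def\<close>)
qed

end

theorem proposition3p9:
  fixes L :: "('s, 'f, 'r) lang"
    and T :: "('s, 'f, 'r) fm set"
    and M :: "('s, 'f, 'r, 'm) struct"
    and \<kappa> :: "'k rel"
    and C :: "'m set"
    and \<Gamma> :: "'s list"
    and S :: "'m list set"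
  assumes "complete_theory L T"
    and "monster_model \<kappa> L T M"
    and "eliminates_imaginaries L M"
    and "NIP L M"
    and "small_set \<kappa> M C"
    and "definable L M C \<Gamma> S"
    and "stable_set L M C \<Gamma> S"
  shows "bounded_stabilizing \<kappa> L T M C (Seq L M C \<Gamma> S)"
proof -
  interpret stable_in_NIP L T M \<kappa> C \<Gamma> S
    using assms by unfold_locales
  show ?thesis by (rule bounded_stabilizing_Seq)
qed

end
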